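(* Let $\gamma>0$ and let $g_1(t)=(\cosh \pi\gamma t)^{-1}$, $t\in\mathbb{R}$. For $a>0$ let $\Lambda(a)=a\mathbb{Z}\times a\mathbb{Z}$, and let $\tilde A(a)$ and $\tilde B(a)$ denote the (best possible) lower and upper frame bounds of the Gabor system $\mathcal{G}(g_1,\Lambda(a))$. There exist constants $0<c<C<\infty$ such that for each $a\in(1/2,1)$ $$c\,(1-a^2)\le\tilde A(a)\le C\,(1-a^2)$$ and $$c\le\tilde B(a)\le C.$$
   Context: For $\lambda=(x,\xi)\in\mathbb{R}^2$ the time-frequency shift $\pi_\lambda$ acts on $f\in L^2(\mathbb{R})$ by $\pi_\lambda f(t)=e^{2\pi i\xi t}f(t-x)$. For $g\in L^2(\mathbb{R})$ and a lattice $\Lambda\subset\mathbb{R}^2$, the Gabor system is $\mathcal{G}(g,\Lambda)=\{\pi_\lambda g:\lambda\in\Lambda\}$. It is a frame if there are constants $A,B>0$ such that for all $f\in L^2(\mathbb{R})$ $$A\|f\|^2_{L^2(\mathbb{R})}\le\sum_{\lambda\in\Lambda}|\langle f,\pi_\lambda g\rangle_{L^2(\mathbb{R})}|^2\le B\|f\|^2_{L^2(\mathbb{R})}.$$ The lower frame bound is the largest possible $A$ and the upper frame bound is the smallest possible $B$ in this inequality. The parameter $\gamma>0$ is fixed; the constants $c,C$ may depend on $\gamma$ but not on $a$. *)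

theory Defs
  imports "HOL-Analysis.Analysis"
begin

text \<open>
  Elements of $L^2$ of the real line are given by Borel measurable representatives; everything
  below depends only on the class up to equality almost everywhere, and every class of Lebesgue
  measurable functions has a Borel measurable representative.
\<close>

definition L2 :: "(real \<Rightarrow> complex) set" where
  "L2 = {f. f \<in> borel_measurable lborel \<and> integrable lborel (\<lambda>t. (cmod (f t))\<^sup>2)}"

definition L2_inner :: "(real \<Rightarrow> complex) \<Rightarrow> (real \<Rightarrow> complex) \<Rightarrow> complex" where
  "L2_inner f g = (LINT t|lborel. f t * cnj (g t))"

definition L2_norm :: "(real \<Rightarrow> complex) \<Rightarrow> real" where
  "L2_norm f = sqrt (LINT t|lborel. (cmod (f t))\<^sup>2)"

definition tf_shift :: "real \<times> real \<Rightarrow> (real \<Rightarrow> complex) \<Rightarrow> real \<Rightarrow> complex" where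
  "tf_shift = (\<lambda>(x, \<xi>) f t. exp (2 * of_real pi * \<i> * of_real \<xi> * of_real t) * f (t - x))"

text \<open>
  The sum is taken in the extended nonnegative reals, so that it is infinite, rather than an
  arbitrary default, when it diverges. The Gabor system is treated as a family indexed by
  \<open>\<Lambda>\<close>.
\<close>

definition gabor_sum ::
    "(real \<Rightarrow> complex) \<Rightarrow> (real \<times> real) set \<Rightarrow> (real \<Rightarrow> complex) \<Rightarrow> ennreal" where
  "gabor_sum g \<Lambda> f = (\<Sum>\<^sub>\<infinity>l\<in>\<Lambda>. ennreal ((cmod (L2_inner f (tf_shift l g)))\<^sup>2))"

definition is_lower_bound :: "(real \<Rightarrow> complex) \<Rightarrow> (real \<times> real) set \<Rightarrow> real \<Rightarrow> bool" where
  "is_lower_bound g \<Lambda> A \<longleftrightarrow>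
     0 < A \<and> (\<forall>f\<in>L2. ennreal (A * (L2_norm f)\<^sup>2) \<le> gabor_sum g \<Lambda> f)"

definition is_upper_bound :: "(real \<Rightarrow> complex) \<Rightarrow> (real \<times> real) set \<Rightarrow> real \<Rightarrow> bool" where
  "is_upper_bound g \<Lambda> B \<longleftrightarrow>
     0 < B \<and> (\<forall>f\<in>L2. gabor_sum g \<Lambda> f \<le> ennreal (B * (L2_norm f)\<^sup>2))"

definition gabor_frame :: "(real \<Rightarrow> complex) \<Rightarrow> (real \<times> real) set \<Rightarrow> bool" where
  "gabor_frame g \<Lambda> \<longleftrightarrow> (\<exists>A B. is_lower_bound g \<Lambda> A \<and> is_upper_bound g \<Lambda> B)"

text \<open>The following two values are meaningful only when \<open>gabor_frame g \<Lambda>\<close> holds.\<close>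

definition lower_frame_bound :: "(real \<Rightarrow> complex) \<Rightarrow> (real \<times> real) set \<Rightarrow> real" where
  "lower_frame_bound g \<Lambda> = (GREATEST A. is_lower_bound g \<Lambda> A)"

definition upper_frame_bound :: "(real \<Rightarrow> complex) \<Rightarrow> (real \<times> real) set \<Rightarrow> real" where
  "upper_frame_bound g \<Lambda> = (LEAST B. is_upper_bound g \<Lambda> B)"

definition square_lattice :: "real \<Rightarrow> (real \<times> real) set" where
  "square_lattice a = {(a * of_int m, a * of_int n) | m n. True}"

definition g1 :: "real \<Rightarrow> real \<Rightarrow> complex" where
  "g1 \<gamma> t = of_real (inverse (cosh (pi * \<gamma> * t)))"

end

theory Submission
  imports Defs
begin

text \<open>
  Write $T = 1/a$ and $d = T - a = (1 - a^2)/a$. Parseval on $[0,T)$ turns the frame inequality into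
  the inequality $\sum_m |\sum_k c_k g(t + kT - am)|^2 \ge A \sum_k |c_k|^2$ on each fibre $t + T\mathbb{Z}$.
  For $g = 1/\cosh(\kappa\,\cdot)$ the matrix $g(t + kT - am)$ is a Cauchy matrix up to diagonal factors. Keeping for each
  $k$ only the sample $s_k \in a\mathbb{Z}$ nearest to $p_k = t + kT$, one gets a square matrix with an
  explicit inverse whose entries are, up to a constant, at most
  $\exp(-2\kappa \sum (T/2 \mp \delta_i))$, the sum running over the indices between row and column, where
  $\delta_i = s_i - p_i$. Since $\delta_i$ drifts by $-d$ modulo $a$ in each step, this sum grows by a
  fixed amount on every block of about $d^{-1/2}$ indices, and Schur's test bounds the inverse by a multiple of $d^{-1/2}$.

  Conversely, $\sum_k (-1)^k g(u + kT)$ vanishes at $u = T/2$. Modulating this alternating sequence by a tent of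
  width $d^{-1/2}$ and placing it on a short window around $T/2$ gives a function whose Gabor
  coefficients have energy of order $d$.
\<close>

subsection \<open>Fourier series of square-integrable functions on a period\<close>

text \<open>The exponent 1/2 comes from a balance. At a = 1 nothing forces decay of the inverse: all
  offsets may equal T/2, and then every term T/2 - \<open>\<delta>\<close> vanishes. For d > 0, two
  indices at distance q have offsets differing by q d modulo a, so as long as q d <= a/2 the two
  terms add up to at least q d. A block made of q such pairs contributes q^2 d, which reaches order
  1 when q is about d^(-1/2). The inverse then has Schur norm of order q, and squaring it gives a
  lower frame bound of order 1/q^2, that is, of order d. The test function meets the same balance
  from the other side: for a tent of half-width n = q, its slope 1/n, the drift n d over its support
  and the width of the window around T/2 are all of order d^(1/2). Infinite matrices never appear.
  The fibre estimates are uniform in a finite index window, functions are first truncated to compact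
  support, and the Gabor sum is a supremum over finite sets. Finally 1 - a^2 = a d lies between d/2
  and d, so d may replace 1 - a^2 throughout.\<close>

lemma borel_measurable_cis [measurable]:
  assumes [measurable]: "f \<in> borel_measurable M"
  shows "(\<lambda>t. cis (f t)) \<in> borel_measurable M"
  unfolding cis_conv_exp by measurable

lemma borel_measurable_cnj [measurable]:
  assumes [measurable]: "f \<in> borel_measurable M"
  shows "(\<lambda>t. cnj (f t)) \<in> borel_measurable M"
proof -
  have "cnj \<in> borel_measurable borel"
    by (intro borel_measurable_continuous_onI continuous_on_cnj continuous_on_id)
  then show ?thesis using assms by (rule measurable_compose[rotated])
qed

section \<open>Trigonometric polynomials and uniform approximation on a period\<close>

inductive trig_poly :: "real \<Rightarrow> (real \<Rightarrow> complex) \<Rightarrow> bool" for T where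
  monomial: "trig_poly T (\<lambda>t. c * cis (2 * pi * of_int n * t / T))"
| add: "trig_poly T p \<Longrightarrow> trig_poly T q \<Longrightarrow> trig_poly T (\<lambda>t. p t + q t)"

lemma trig_poly_const: "trig_poly T (\<lambda>t. c)"
  using trig_poly.monomial[of T c 0] by simp

lemma trig_poly_cmult: "trig_poly T p \<Longrightarrow> trig_poly T (\<lambda>t. c * p t)"
proof (induction rule: trig_poly.induct)
  case (monomial b n)
  then show ?case using trig_poly.monomial[of T "c * b" n] by (simp add: mult.assoc)
qed (simp add: distrib_left trig_poly.add)

lemma trig_poly_mult:
  assumes "trig_poly T p" "trig_poly T q"
  shows "trig_poly T (\<lambda>t. p t * q t)"
  using assms(1)
proof (induction rule: trig_poly.induct)
  case (monomial c n)
  show ?case using assms(2)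
  proof (induction rule: trig_poly.induct)
    case (monomial d m)
    have "c * cis (2 * pi * of_int n * t / T) * (d * cis (2 * pi * of_int m * t / T)) =
        (c * d) * cis (2 * pi * of_int (n + m) * t / T)" for t
      by (simp add: cis_mult[symmetric] distrib_left distrib_right add_divide_distrib)
    then show ?case using trig_poly.monomial[of T "c * d" "n + m"] by (simp only:)
  qed (simp add: distrib_left trig_poly.add)
qed (simp add: distrib_right trig_poly.add)

text \<open>The inductive form serves closure under sums and products; Parseval needs explicit
  coefficients, and they are recovered here.\<close>

lemma trig_poly_sum_cis:
  assumes "trig_poly T p"
  obtains F a where "finite F" "p = (\<lambda>t. \<Sum>n\<in>F. a n * cis (2 * pi * of_int n * t / T))"
proof -
  have "\<exists>F a. finite F \<and> p = (\<lambda>t. \<Sum>n\<in>F. a n * cis (2 * pi * of_int n * t / T))"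
    using assms
  proof (induction rule: trig_poly.induct)
    case (monomial c n)
    show ?case by (rule exI[of _ "{n}"], rule exI[of _ "\<lambda>_. c"]) simp
  next
    case (add p q)
    then obtain F a G b where F: "finite F" "p = (\<lambda>t. \<Sum>n\<in>F. a n * cis (2 * pi * of_int n * t / T))"
      and G: "finite G" "q = (\<lambda>t. \<Sum>n\<in>G. b n * cis (2 * pi * of_int n * t / T))" by blast
    let ?c = "\<lambda>n. (if n \<in> F then a n else 0) + (if n \<in> G then b n else 0)"
    have "p t + q t = (\<Sum>n\<in>F \<union> G. ?c n * cis (2 * pi * of_int n * t / T))" for t
    proof -
      have 1: "p t = (\<Sum>n\<in>F \<union> G. (if n \<in> F then a n else 0) * cis (2 * pi * of_int n * t / T))"
        unfolding F by (rule sum.mono_neutral_cong_left) (use F G in auto)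
      have 2: "q t = (\<Sum>n\<in>F \<union> G. (if n \<in> G then b n else 0) * cis (2 * pi * of_int n * t / T))"
        unfolding G by (rule sum.mono_neutral_cong_left) (use F G in auto)
      show ?thesis unfolding 1 2 by (simp add: sum.distrib[symmetric] distrib_right)
    qed
    then show ?case using F G by (intro exI[of _ "F \<union> G"] exI[of _ ?c]) auto
  qed
  then show ?thesis using that by blast
qed

lemma trig_poly_continuous:
  assumes "trig_poly T p"
  shows "continuous_on UNIV p"
  using assms
proof induction
  case (monomial c n)
  show ?case by (cases "T = 0") (auto intro!: continuous_intros)
qed (auto intro: continuous_intros)

text \<open>By closure under sums and products only real-linear functionals matter. Such an
  \<open>f\<close> equals f 1 times the real part plus f \<i> times the imaginary part, and Euler's
  formulas turn cosine and sine into exponentials of frequency 1 and -1.\<close>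

lemma real_polynomial_function_cis_trig_poly:
  fixes g :: "complex \<Rightarrow> real"
  assumes "real_polynomial_function g"
  shows "trig_poly T (\<lambda>t. of_real (g (cis (2 * pi * t / T))))"
  using assms
proof (induction rule: real_polynomial_function.induct)
  case (linear f)
  interpret f: bounded_linear f by fact
  have eq: "complex_of_real (f (cis (2 * pi * t / T))) =
      of_real (f 1) / 2 * (cis (2 * pi * of_int 1 * t / T) + cis (2 * pi * of_int (-1) * t / T)) +
      of_real (f \<i>) / (2 * \<i>) * (cis (2 * pi * of_int 1 * t / T) - cis (2 * pi * of_int (-1) * t / T))" for t
  proof -
    let ?x = "2 * pi * t / T"
    have "cis ?x = cos ?x *\<^sub>R 1 + sin ?x *\<^sub>R \<i>"
      by (simp add: complex_eq_iff)
    then have "f (cis ?x) = cos ?x * f 1 + sin ?x * f \<i>"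
      by (simp only: f.add f.scale) simp
    moreover have "cis (2 * pi * of_int (-1) * t / T) = cis (- ?x)" by simp
    ultimately show ?thesis by (simp add: complex_eq_iff)
  qed
  have "trig_poly T (\<lambda>t. (of_real (f 1) / 2 + of_real (f \<i>) / (2 * \<i>)) * cis (2 * pi * of_int 1 * t / T) +
      (of_real (f 1) / 2 - of_real (f \<i>) / (2 * \<i>)) * cis (2 * pi * of_int (-1) * t / T))"
    by (intro trig_poly.intros)
  then show ?case unfolding eq by (simp add: algebra_simps)
qed (auto intro: trig_poly_const trig_poly.add trig_poly_mult)

lemma trig_poly_uniform_approx:
  fixes F :: "real \<Rightarrow> real"
  assumes T: "T > 0" and cont: "continuous_on {0..T} F" and "F 0 = F T" and e: "e > 0"
  obtains p where "trig_poly T p" "\<And>t. 0 \<le> t \<Longrightarrow> t < T \<Longrightarrow> cmod (of_real (F t) - p t) < e"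
proof -
  define \<phi> where "\<phi> = (\<lambda>s. F (T * s))"
  have "path \<phi>" unfolding path_def \<phi>_def
    by (rule continuous_on_compose2[OF cont]) (use T in \<open>auto intro!: continuous_intros simp: mult_left_le\<close>)
  moreover have "pathfinish \<phi> = pathstart \<phi>"
    using assms by (simp add: pathfinish_def pathstart_def \<phi>_def)
  \<comment> \<open>The constant homotopy of the loop is a device: transferring it to circle maps
    yields continuity of the function on the circle, although \<open>Arg2pi\<close> itself jumps at
    the point 1.\<close>
  ultimately have "homotopic_loops UNIV \<phi> \<phi>" by (simp add: homotopic_loops_refl)
  from homotopic_loops_imp_homotopic_circlemaps[OF this, THEN homotopic_with_imp_continuous]
  have c: "continuous_on (sphere 0 1) (\<phi> \<circ> (\<lambda>z. Arg2pi z / (2 * pi)))" by simp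
  from Stone_Weierstrass_real_polynomial_function[OF _ c e] obtain g where
    g: "real_polynomial_function g"
    "\<And>z. z \<in> sphere (0::complex) 1 \<Longrightarrow> \<bar>(\<phi> \<circ> (\<lambda>z. Arg2pi z / (2 * pi))) z - g z\<bar> < e" by auto
  show ?thesis
  proof (rule that[OF real_polynomial_function_cis_trig_poly[OF g(1)]])
    fix t assume t: "0 \<le> t" "t < T"
    let ?x = "2 * pi * t / T"
    have "Arg2pi (cis ?x) = ?x"
      by (rule Arg2pi_unique[of 1]) (use t T in \<open>auto simp: cis_conv_exp field_simps\<close>)
    then have "\<phi> (Arg2pi (cis ?x) / (2 * pi)) = F t" using T by (simp add: \<phi>_def)
    with g(2)[of "cis ?x"] have "\<bar>F t - g (cis ?x)\<bar> < e" by simp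
    then show "cmod (of_real (F t) - of_real (g (cis ?x))) < e"
      by (metis norm_of_real of_real_diff)
  qed
qed

section \<open>Density of trigonometric polynomials in L2 of a period\<close>

definition trig_approximable :: "real measure \<Rightarrow> real \<Rightarrow> (real \<Rightarrow> complex) \<Rightarrow> bool" where
  "trig_approximable M T H \<longleftrightarrow>
     H \<in> borel_measurable M \<and> integrable M (\<lambda>t. (cmod (H t))\<^sup>2) \<and>
     (\<forall>e>0. \<exists>p. trig_poly T p \<and> (LINT t|M. (cmod (H t - p t))\<^sup>2) < e)"

lemma cmod_add_square_le: "(cmod (x + y))\<^sup>2 \<le> 2 * (cmod x)\<^sup>2 + 2 * (cmod y)\<^sup>2"
proof -
  have "(cmod (x + y))\<^sup>2 \<le> (cmod x + cmod y)\<^sup>2"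
    by (intro power_mono norm_triangle_ineq norm_ge_zero)
  also have "\<dots> \<le> 2 * (cmod x)\<^sup>2 + 2 * (cmod y)\<^sup>2"
    using sum_squares_bound[of "cmod x" "cmod y"] by (simp add: power2_sum)
  finally show ?thesis .
qed

lemma cmod_diff_square_le: "(cmod (x - y))\<^sup>2 \<le> 2 * (cmod x)\<^sup>2 + 2 * (cmod y)\<^sup>2"
  using cmod_add_square_le[of x "- y"] by simp

lemma integrable_cmod_square_add:
  assumes [measurable]: "f \<in> borel_measurable M" "g \<in> borel_measurable M"
    and "integrable M (\<lambda>t. (cmod (f t))\<^sup>2)" "integrable M (\<lambda>t. (cmod (g t))\<^sup>2)"
  shows "integrable M (\<lambda>t. (cmod (f t + g t))\<^sup>2)"
  by (rule Bochner_Integration.integrable_bound[of M "\<lambda>t. 2 * (cmod (f t))\<^sup>2 + 2 * (cmod (g t))\<^sup>2"])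
    (use assms in \<open>auto simp: cmod_add_square_le\<close>)

lemma integrable_cmod_square_diff:
  assumes "f \<in> borel_measurable M" "g \<in> borel_measurable M"
    and "integrable M (\<lambda>t. (cmod (f t))\<^sup>2)" "integrable M (\<lambda>t. (cmod (g t))\<^sup>2)"
  shows "integrable M (\<lambda>t. (cmod (f t - g t))\<^sup>2)"
  using integrable_cmod_square_add[of f M "\<lambda>t. - g t"] assms by simp

context
  fixes M :: "real measure" and T :: real
  assumes fin: "finite_measure M" and sets_M [measurable_cong]: "sets M = sets borel"
    and T: "T > 0" and AE_M: "AE t in M. 0 < t \<and> t < T"
begin

interpretation finite_measure M by (fact fin)

lemma trig_poly_measurable: "trig_poly T p \<Longrightarrow> p \<in> borel_measurable M"
  using borel_measurable_continuous_onI[OF trig_poly_continuous] sets_M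
  by (metis measurable_cong_sets)

lemma trig_poly_square_integrable:
  assumes "trig_poly T p"
  shows "integrable M (\<lambda>t. (cmod (p t))\<^sup>2)"
proof -
  have [measurable]: "p \<in> borel_measurable M" by (rule trig_poly_measurable) fact
  have "\<exists>B. \<forall>t. cmod (p t) \<le> B" using assms
  proof induction
    case (monomial c n)
    show ?case by (intro exI[of _ "cmod c"]) (simp add: norm_mult)
  next
    case (add p q)
    then show ?case by (meson add_mono norm_triangle_le order_trans)
  qed
  then obtain B where B: "\<And>t. cmod (p t) \<le> B" by blast
  show ?thesis
    by (rule integrable_const_bound[of _ "B\<^sup>2"]) (use B in \<open>auto intro!: power_mono\<close>)
qed

lemma integral_cmod_square_add_le:
  assumes [measurable]: "f \<in> borel_measurable M" "g \<in> borel_measurable M"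
    and i: "integrable M (\<lambda>t. (cmod (f t))\<^sup>2)" "integrable M (\<lambda>t. (cmod (g t))\<^sup>2)"
  shows "(LINT t|M. (cmod (f t + g t))\<^sup>2) \<le> 2 * (LINT t|M. (cmod (f t))\<^sup>2) + 2 * (LINT t|M. (cmod (g t))\<^sup>2)"
proof -
  have "(LINT t|M. (cmod (f t + g t))\<^sup>2) \<le> (LINT t|M. 2 * (cmod (f t))\<^sup>2 + 2 * (cmod (g t))\<^sup>2)"
    by (rule integral_mono[OF integrable_cmod_square_add[OF assms]]) (use i cmod_add_square_le in auto)
  then show ?thesis using i by simp
qed

lemma trig_approximable_add:
  assumes f: "trig_approximable M T f" and g: "trig_approximable M T g"
  shows "trig_approximable M T (\<lambda>t. f t + g t)"
  unfolding trig_approximable_def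
proof (intro conjI allI impI)
  have [measurable]: "f \<in> borel_measurable M" "g \<in> borel_measurable M"
    using f g by (auto simp: trig_approximable_def)
  show "(\<lambda>t. f t + g t) \<in> borel_measurable M" by measurable
  have int: "integrable M (\<lambda>t. (cmod (f t))\<^sup>2)" "integrable M (\<lambda>t. (cmod (g t))\<^sup>2)"
    using f g by (auto simp: trig_approximable_def)
  then show "integrable M (\<lambda>t. (cmod (f t + g t))\<^sup>2)"
    by (intro integrable_cmod_square_add) auto
  fix e :: real assume "e > 0"
  then have "e / 4 > 0" by simp
  with f g obtain p q where p: "trig_poly T p" "(LINT t|M. (cmod (f t - p t))\<^sup>2) < e / 4"
    and q: "trig_poly T q" "(LINT t|M. (cmod (g t - q t))\<^sup>2) < e / 4"
    unfolding trig_approximable_def by meson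
  note [measurable] = trig_poly_measurable[OF p(1)] trig_poly_measurable[OF q(1)]
  have i: "integrable M (\<lambda>t. (cmod (f t - p t))\<^sup>2)" "integrable M (\<lambda>t. (cmod (g t - q t))\<^sup>2)"
    using int by (auto intro!: integrable_cmod_square_diff trig_poly_square_integrable[OF p(1)] trig_poly_square_integrable[OF q(1)])
  have "(LINT t|M. (cmod (f t + g t - (p t + q t)))\<^sup>2) \<le>
      2 * (LINT t|M. (cmod (f t - p t))\<^sup>2) + 2 * (LINT t|M. (cmod (g t - q t))\<^sup>2)"
    using integral_cmod_square_add_le[OF _ _ i] by (simp add: algebra_simps)
  also have "\<dots> < e" using p q i by simp
  finally show "\<exists>p. trig_poly T p \<and> (LINT t|M. (cmod (f t + g t - p t))\<^sup>2) < e"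
    using trig_poly.add[OF p(1) q(1)] by (intro exI[of _ "\<lambda>t. p t + q t"]) simp
qed

lemma trig_approximable_cmult:
  assumes f: "trig_approximable M T f"
  shows "trig_approximable M T (\<lambda>t. c * f t)"
  unfolding trig_approximable_def
proof (intro conjI allI impI)
  have [measurable]: "f \<in> borel_measurable M" using f by (auto simp: trig_approximable_def)
  show "(\<lambda>t. c * f t) \<in> borel_measurable M" by measurable
  show "integrable M (\<lambda>t. (cmod (c * f t))\<^sup>2)"
    using f by (simp add: trig_approximable_def norm_mult power_mult_distrib)
  fix e :: real assume e: "e > 0"
  \<comment> \<open>The summand 1 keeps the divisor positive when \<open>c\<close> = 0.\<close>
  have pos: "(cmod c)\<^sup>2 + 1 > 0" by (rule add_nonneg_pos) auto
  with e f obtain p where p: "trig_poly T p" "(LINT t|M. (cmod (f t - p t))\<^sup>2) < e / ((cmod c)\<^sup>2 + 1)"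
    unfolding trig_approximable_def by (meson divide_pos_pos)
  have "(LINT t|M. (cmod (c * f t - c * p t))\<^sup>2) = (cmod c)\<^sup>2 * (LINT t|M. (cmod (f t - p t))\<^sup>2)"
    unfolding right_diff_distrib[symmetric] norm_mult power_mult_distrib by simp
  also have "\<dots> \<le> ((cmod c)\<^sup>2 + 1) * (LINT t|M. (cmod (f t - p t))\<^sup>2)"
    by (intro mult_right_mono) auto
  also have "\<dots> < e" using p(2) pos by (simp add: field_simps)
  finally show "\<exists>p. trig_poly T p \<and> (LINT t|M. (cmod (c * f t - p t))\<^sup>2) < e"
    using trig_poly_cmult[OF p(1)] by (intro exI[of _ "\<lambda>t. c * p t"]) simp
qed

lemma trig_approximable_closed:
  assumes [measurable]: "f \<in> borel_measurable M" and int: "integrable M (\<lambda>t. (cmod (f t))\<^sup>2)"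
    and ex: "\<And>e. e > 0 \<Longrightarrow> \<exists>g. trig_approximable M T g \<and> (LINT t|M. (cmod (f t - g t))\<^sup>2) < e"
  shows "trig_approximable M T f"
  unfolding trig_approximable_def
proof (intro conjI allI impI assms(1,2))
  fix e :: real assume e: "e > 0"
  then have "e / 4 > 0" by simp
  with ex obtain g where g: "trig_approximable M T g" "(LINT t|M. (cmod (f t - g t))\<^sup>2) < e / 4"
    by meson
  with \<open>e / 4 > 0\<close> obtain p where p: "trig_poly T p" "(LINT t|M. (cmod (g t - p t))\<^sup>2) < e / 4"
    unfolding trig_approximable_def by meson
  have [measurable]: "g \<in> borel_measurable M" using g by (auto simp: trig_approximable_def)
  note [measurable] = trig_poly_measurable[OF p(1)]
  have "integrable M (\<lambda>t. (cmod (g t))\<^sup>2)" using g by (auto simp: trig_approximable_def)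
  then have i: "integrable M (\<lambda>t. (cmod (f t - g t))\<^sup>2)" "integrable M (\<lambda>t. (cmod (g t - p t))\<^sup>2)"
    using int by (auto intro!: integrable_cmod_square_diff trig_poly_square_integrable[OF p(1)])
  have "(LINT t|M. (cmod (f t - p t))\<^sup>2) \<le>
      2 * (LINT t|M. (cmod (f t - g t))\<^sup>2) + 2 * (LINT t|M. (cmod (g t - p t))\<^sup>2)"
    using integral_cmod_square_add_le[OF _ _ i] by simp
  also have "\<dots> < e" using p g i by simp
  finally show "\<exists>p. trig_poly T p \<and> (LINT t|M. (cmod (f t - p t))\<^sup>2) < e"
    using p by blast
qed

text \<open>Dominated convergence for |f - s i|^2 <= 4 w^2, followed by closedness. All later limit
  passages go through it: cutoffs of closed sets, disjoint unions of Borel sets, and monotone limits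
  of nonnegative functions.\<close>

lemma trig_approximable_limit:
  assumes s: "\<And>i. trig_approximable M T (s i)" and [measurable]: "f \<in> borel_measurable M"
    and lim: "AE t in M. (\<lambda>i. s i t) \<longlonglongrightarrow> f t"
    and dom: "AE t in M. \<forall>i. cmod (s i t) \<le> w t"
    and w: "w \<in> borel_measurable M" "integrable M (\<lambda>t. (w t)\<^sup>2)"
  shows "trig_approximable M T f"
proof (rule trig_approximable_closed)
  note [measurable] = w(1)
  have [measurable]: "s i \<in> borel_measurable M" for i using s by (auto simp: trig_approximable_def)
  show "f \<in> borel_measurable M" by fact
  have fw: "AE t in M. cmod (f t) \<le> w t" using lim dom
  proof eventually_elim
    case (elim t)
    show ?case by (rule LIMSEQ_le_const2[OF tendsto_norm[OF elim(1)]]) (use elim in auto)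
  qed
  show "integrable M (\<lambda>t. (cmod (f t))\<^sup>2)"
  proof (rule Bochner_Integration.integrable_bound[OF w(2)])
    show "AE t in M. norm ((cmod (f t))\<^sup>2) \<le> norm ((w t)\<^sup>2)"
      using fw by eventually_elim (simp add: power_mono)
  qed measurable
  have "(\<lambda>i. LINT t|M. (cmod (f t - s i t))\<^sup>2) \<longlonglongrightarrow> (LINT t|M. 0)"
  proof (rule integral_dominated_convergence[where w = "\<lambda>t. 4 * (w t)\<^sup>2"])
    show "integrable M (\<lambda>t. 4 * (w t)\<^sup>2)" using w by simp
    show "AE t in M. (\<lambda>i. (cmod (f t - s i t))\<^sup>2) \<longlonglongrightarrow> 0" using lim
    proof eventually_elim
      case (elim t)
      have "(\<lambda>i. (cmod (f t - s i t))\<^sup>2) \<longlonglongrightarrow> (cmod (f t - f t))\<^sup>2"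
        by (intro tendsto_intros elim)
      then show ?case by simp
    qed
    fix i
    show "AE t in M. norm ((cmod (f t - s i t))\<^sup>2) \<le> 4 * (w t)\<^sup>2" using fw dom
    proof eventually_elim
      case (elim t)
      have "(cmod (f t))\<^sup>2 \<le> (w t)\<^sup>2" "(cmod (s i t))\<^sup>2 \<le> (w t)\<^sup>2"
        using elim by (auto intro!: power_mono)
      then show ?case using cmod_diff_square_le[of "f t" "s i t"] by simp
    qed
  qed measurable
  then have lim0: "(\<lambda>i. LINT t|M. (cmod (f t - s i t))\<^sup>2) \<longlonglongrightarrow> 0" by simp
  fix e :: real assume "e > 0"
  then have "eventually (\<lambda>i. (LINT t|M. (cmod (f t - s i t))\<^sup>2) < e) sequentially"
    using order_tendstoD(2)[OF lim0] by simp
  then show "\<exists>g. trig_approximable M T g \<and> (LINT t|M. (cmod (f t - g t))\<^sup>2) < e"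
    using s by (auto simp: eventually_sequentially)
qed

lemma trig_approximable_continuous:
  fixes F :: "real \<Rightarrow> real"
  assumes cont: "continuous_on UNIV F" and F0: "F 0 = F T" and bd: "\<And>t. \<bar>F t\<bar> \<le> 1"
  shows "trig_approximable M T (\<lambda>t. of_real (F t))"
  unfolding trig_approximable_def
proof (intro conjI allI impI)
  have "F \<in> borel_measurable borel" by (rule borel_measurable_continuous_onI[OF cont])
  then have [measurable]: "F \<in> borel_measurable M" using sets_M by (metis measurable_cong_sets)
  show "(\<lambda>t. complex_of_real (F t)) \<in> borel_measurable M" by measurable
  show "integrable M (\<lambda>t. (cmod (complex_of_real (F t)))\<^sup>2)"
    by (rule integrable_const_bound[of _ 1]) (use bd in \<open>auto simp: abs_square_le_1\<close>)
  fix e :: real assume e: "e > 0"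
  define \<mu> where "\<mu> = measure M (space M) + 1"
  have \<mu>: "\<mu> > 0" unfolding \<mu>_def by (rule add_nonneg_pos) auto
  define \<delta> where "\<delta> = sqrt (e / (2 * \<mu>))"
  have \<delta>: "\<delta> > 0" "\<delta>\<^sup>2 = e / (2 * \<mu>)" using e \<mu> by (auto simp: \<delta>_def)
  obtain p where p: "trig_poly T p" "\<And>t. 0 \<le> t \<Longrightarrow> t < T \<Longrightarrow> cmod (of_real (F t) - p t) < \<delta>"
    using trig_poly_uniform_approx[OF T _ F0 \<delta>(1)] continuous_on_subset[OF cont] by blast
  note [measurable] = trig_poly_measurable[OF p(1)]
  have b: "AE t in M. (cmod (of_real (F t) - p t))\<^sup>2 \<le> \<delta>\<^sup>2"
    using AE_M
  proof eventually_elim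
    case (elim t)
    then show ?case using p(2)[of t] by (intro power_mono) auto
  qed
  have "(LINT t|M. (cmod (of_real (F t) - p t))\<^sup>2) \<le> (LINT t|M. \<delta>\<^sup>2)"
    by (rule integral_mono_AE) (use b in \<open>auto intro!: integrable_const_bound[of _ "\<delta>\<^sup>2"]\<close>)
  also have "\<dots> = \<delta>\<^sup>2 * measure M (space M)" by simp
  also have "\<dots> \<le> \<delta>\<^sup>2 * \<mu>" unfolding \<mu>_def by (intro mult_left_mono) auto
  also have "\<dots> < e" using \<delta>(2) e \<mu> by simp
  finally show "\<exists>p. trig_poly T p \<and> (LINT t|M. (cmod (of_real (F t) - p t))\<^sup>2) < e"
    using p(1) by blast
qed

lemma trig_approximable_closed_set:
  assumes A: "closed A" "A \<noteq> {}"
  shows "trig_approximable M T (indicator A)"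
proof -
  \<comment> \<open>The first factor shrinks to the indicator of \<open>A\<close> by distance. The
    second is a trapezoid vanishing at 0 and \<open>T\<close>, so that the endpoint values agree as
    uniform approximation requires; it tends to 1 on the open interval, where \<open>M\<close>
    lives.\<close>
  define F where "F = (\<lambda>i t. max 0 (1 - real i * infdist t A) * max 0 (min 1 (real i * min t (T - t))))"
  have F: "0 \<le> F i t" "F i t \<le> 1" for i t
  proof -
    have "F i t \<le> 1 * 1" unfolding F_def by (rule mult_mono) (auto simp: infdist_nonneg)
    then show "F i t \<le> 1" by simp
    show "0 \<le> F i t" unfolding F_def by simp
  qed
  show ?thesis
  proof (rule trig_approximable_limit[where w = "\<lambda>_. 1" and s = "\<lambda>i t. of_real (F i t)"])
    show "trig_approximable M T (\<lambda>t. complex_of_real (F i t))" for i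
    proof (rule trig_approximable_continuous)
      show "continuous_on UNIV (F i)" unfolding F_def by (intro continuous_intros)
      show "F i 0 = F i T" using T by (simp add: F_def)
      show "\<bar>F i t\<bar> \<le> 1" for t using F[of i t] by simp
    qed
    have "A \<in> sets borel" using A by simp
    then have [measurable]: "A \<in> sets M" by (simp add: sets_M)
    show "indicator A \<in> borel_measurable M" by measurable
    show "AE t in M. \<forall>i. cmod (complex_of_real (F i t)) \<le> 1" using F by simp
    show "(\<lambda>_. 1) \<in> borel_measurable M" "integrable M (\<lambda>t. 1\<^sup>2 :: real)" by auto
    show "AE t in M. (\<lambda>i. complex_of_real (F i t)) \<longlonglongrightarrow> indicator A t" using AE_M
    proof eventually_elim
      case (elim t)
      have big: "eventually (\<lambda>i. real i * x \<ge> 1) sequentially" if "x > 0" for x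
      proof -
        obtain N where "real N > 1 / x" using reals_Archimedean2 by blast
        then show ?thesis using that
          by (intro eventually_sequentiallyI[of N]) (smt (verit) divide_less_eq mult_right_mono of_nat_mono)
      qed
      have "eventually (\<lambda>i. complex_of_real (F i t) = indicator A t) sequentially"
      proof (cases "t \<in> A")
        case True
        have "eventually (\<lambda>i. real i * min t (T - t) \<ge> 1) sequentially"
          by (rule big) (use elim in auto)
        then show ?thesis by eventually_elim (use True in \<open>auto simp: F_def\<close>)
      next
        case False
        then have "infdist t A > 0"
          using A by (metis in_closed_iff_infdist_zero infdist_nonneg less_eq_real_def)
        from big[OF this] show ?thesis by eventually_elim (use False in \<open>auto simp: F_def\<close>)
      qed
      then show ?case by (rule tendsto_eventually)
    qed
  qed
qed

lemma trig_approximable_indicator: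
  assumes "A \<in> sets borel"
  shows "trig_approximable M T (indicator A)"
proof -
  have 0: "trig_approximable M T (\<lambda>_. 0)"
    using trig_approximable_cmult[of _ 0, OF trig_approximable_closed_set[of UNIV]] by simp
  have "Int_stable (Collect closed :: real set set)"
    by (auto simp: Int_stable_def)
  moreover have "Collect closed \<subseteq> Pow (UNIV :: real set)" by simp
  moreover have "A \<in> sigma_sets UNIV (Collect closed)"
    using assms by (simp add: borel_eq_closed)
  ultimately show ?thesis
  proof (induction rule: sigma_sets_induct_disjoint)
    case (basic A)
    \<comment> \<open>The empty set is separate because \<open>infdist\<close> to it is 0 by
      convention, so the distance cutoffs would not converge to its indicator.\<close>
    then show ?case using trig_approximable_closed_set[of A] 0
      by (cases "A = {}") auto
  next
    case empty
    then show ?case using 0 by simp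
  next
    case (compl A)
    have "indicator (UNIV - A) = (\<lambda>t. indicator UNIV t + (-1) * indicator A t :: complex)"
      by (auto simp: indicator_def)
    then show ?case
      using trig_approximable_add[OF trig_approximable_closed_set[of UNIV] trig_approximable_cmult[OF compl(2), of "-1"]]
      by simp
  next
    case (union A)
    have [measurable]: "A i \<in> sets M" for i
      using union(2) by (auto simp: sets_M borel_eq_closed)
    have sum_eq: "(\<Sum>j<i. indicator (A j) t) = (indicator (\<Union>j<i. A j) t :: complex)" for i t
      using union(1) by (intro indicator_UN_disjoint[symmetric]) (auto intro: disjoint_family_on_mono)
    show ?case
    proof (rule trig_approximable_limit[where w = "\<lambda>_. 1"])
      show "trig_approximable M T (\<lambda>t. \<Sum>j<i. indicator (A j) t)" for i
        by (induction i) (use 0 union(3) trig_approximable_add in auto)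
      show "AE t in M. (\<lambda>i. \<Sum>j<i. indicator (A j) t) \<longlonglongrightarrow> (indicator (\<Union> (range A)) t :: complex)"
        unfolding sum_eq by (intro AE_I2 LIMSEQ_indicator_UN)
      show "AE t in M. \<forall>i. cmod (\<Sum>j<i. indicator (A j) t) \<le> 1"
        unfolding sum_eq by (simp add: indicator_def)
    qed auto
  qed
qed

lemma trig_approximable_nonneg:
  fixes u :: "real \<Rightarrow> real"
  assumes "u \<in> borel_measurable M" "\<And>t. 0 \<le> u t" "integrable M (\<lambda>t. (u t)\<^sup>2)"
  shows "trig_approximable M T (\<lambda>t. of_real (u t))"
  using assms
proof (induction rule: borel_measurable_induct_real)
  case (set A)
  then have "trig_approximable M T (indicator A)"
    by (intro trig_approximable_indicator) (simp add: sets_M)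
  moreover have "(\<lambda>t. complex_of_real (indicator A t)) = indicator A"
    by (auto simp: indicator_def)
  ultimately show ?case by simp
next
  case (mult u c)
  show ?case
  proof (cases "c = 0")
    case True
    then show ?thesis
      using trig_approximable_cmult[of _ 0, OF trig_approximable_indicator[of UNIV]] by simp
  next
    case False
    then have "integrable M (\<lambda>t. (u t)\<^sup>2)" using mult by (simp add: power_mult_distrib)
    with mult show ?thesis using trig_approximable_cmult by simp
  qed
next
  case (add u v)
  have [measurable]: "u \<in> borel_measurable M" "v \<in> borel_measurable M" by fact+
  have "integrable M (\<lambda>t. (u t)\<^sup>2)" "integrable M (\<lambda>t. (v t)\<^sup>2)"
    by (rule Bochner_Integration.integrable_bound[OF add.prems];
      use add in \<open>auto intro!: AE_I2 power_mono\<close>)+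
  with add show ?case using trig_approximable_add by simp
next
  case (seq U)
  have [measurable]: "U i \<in> borel_measurable M" for i by fact
  have "space M = UNIV" using sets_eq_imp_space_eq[OF sets_M] by simp
  then have lim: "(\<lambda>i. U i t) \<longlonglongrightarrow> u t" for t using seq by simp
  have le: "U i t \<le> u t" for i t
    by (rule incseq_le[OF _ lim]) (use \<open>incseq U\<close> in \<open>auto simp: incseq_def le_fun_def\<close>)
  have int: "integrable M (\<lambda>t. (U i t)\<^sup>2)" for i
    by (rule Bochner_Integration.integrable_bound[OF seq.prems])
      (use seq le in \<open>auto intro!: power_mono\<close>)
  show ?case
  proof (rule trig_approximable_limit[where w = u])
    show "trig_approximable M T (\<lambda>t. complex_of_real (U i t))" for i
      using seq int by simp
    show "AE t in M. (\<lambda>i. complex_of_real (U i t)) \<longlonglongrightarrow> complex_of_real (u t)"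
      by (auto intro!: tendsto_of_real lim)
    show "AE t in M. \<forall>i. cmod (complex_of_real (U i t)) \<le> u t"
      using seq le by simp
  qed (use assms seq in auto)
qed

theorem trig_approximable_L2:
  assumes [measurable]: "H \<in> borel_measurable M" and int: "integrable M (\<lambda>t. (cmod (H t))\<^sup>2)"
  shows "trig_approximable M T H"
proof -
  have u: "trig_approximable M T (\<lambda>t. of_real (max 0 (r t)))"
    if [measurable]: "r \<in> borel_measurable M" and le: "\<And>t. \<bar>r t\<bar> \<le> cmod (H t)" for r :: "real \<Rightarrow> real"
  proof (rule trig_approximable_nonneg)
    show "integrable M (\<lambda>t. (max 0 (r t))\<^sup>2)"
    proof (rule Bochner_Integration.integrable_bound[OF int])
      have "(max 0 (r t))\<^sup>2 \<le> (cmod (H t))\<^sup>2" for t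
        using le[of t] by (intro power_mono) auto
      then show "AE t in M. norm ((max 0 (r t))\<^sup>2) \<le> norm ((cmod (H t))\<^sup>2)" by simp
    qed measurable
  qed auto
  have "H = (\<lambda>t. (of_real (max 0 (Re (H t))) + (-1) * of_real (max 0 (- Re (H t)))) +
      \<i> * (of_real (max 0 (Im (H t))) + (-1) * of_real (max 0 (- Im (H t)))))"
    by (auto simp: complex_eq_iff max_def)
  then show ?thesis
    by (subst \<open>H = _\<close>) (intro trig_approximable_add trig_approximable_cmult u;
      simp add: abs_Re_le_cmod abs_Im_le_cmod)
qed

end

text \<open>A density instead of a restricted space keeps \<open>UNIV\<close> as the underlying
  space, so Borel functions on the line stay measurable without a change of domain.\<close>

definition period_measure :: "real \<Rightarrow> real measure" where
  "period_measure T = density lborel (indicator {0<..<T})"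

lemma sets_period_measure [simp, measurable_cong]: "sets (period_measure T) = sets borel"
  by (simp add: period_measure_def)

lemma space_period_measure [simp]: "space (period_measure T) = UNIV"
  by (simp add: period_measure_def)

lemma AE_period_measure: "AE t in period_measure T. 0 < t \<and> t < T"
  unfolding period_measure_def by (subst AE_density) (auto simp: indicator_def)

lemma finite_measure_period: "finite_measure (period_measure T)"
proof (rule finite_measureI)
  have "emeasure (period_measure T) UNIV = emeasure lborel {0<..<T}"
    unfolding period_measure_def by (subst emeasure_density) auto
  then show "emeasure (period_measure T) (space (period_measure T)) \<noteq> \<infinity>"
    by (cases "T \<ge> 0") auto
qed

lemma integrable_period_measure:
  fixes f :: "real \<Rightarrow> 'a::{banach, second_countable_topology}"
  assumes "f \<in> borel_measurable borel"
  shows "integrable (period_measure T) f \<longleftrightarrow> integrable lborel (\<lambda>t. indicator {0<..<T} t *\<^sub>R f t)"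
proof -
  have "period_measure T = density lborel (\<lambda>t. ennreal (indicator {0<..<T} t))"
    unfolding period_measure_def by (simp add: ennreal_indicator)
  then show ?thesis using assms by (simp add: integrable_density)
qed

lemma integral_period_measure:
  fixes f :: "real \<Rightarrow> 'a::{banach, second_countable_topology}"
  assumes "f \<in> borel_measurable borel"
  shows "(LINT t|period_measure T. f t) = (LINT t|lborel. indicator {0<..<T} t *\<^sub>R f t)"
proof -
  have "period_measure T = density lborel (\<lambda>t. ennreal (indicator {0<..<T} t))"
    unfolding period_measure_def by (simp add: ennreal_indicator)
  then show ?thesis using assms by (simp add: integral_density)
qed

lemma measure_period_measure: "T > 0 \<Longrightarrow> measure (period_measure T) UNIV = T"
  using integral_period_measure[of "\<lambda>_. 1::real" T] by simp

section \<open>Fourier coefficients, Bessel's inequality and Parseval\<close>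

abbreviation fourier_exp :: "real \<Rightarrow> int \<Rightarrow> real \<Rightarrow> complex" where
  "fourier_exp T n t \<equiv> cis (2 * pi * of_int n * t / T)"

lemma integral_fourier_exp:
  assumes "T > 0"
  shows "(LINT t|period_measure T. fourier_exp T n t) = (if n = 0 then of_real T else 0)"
proof (cases "n = 0")
  case True
  then show ?thesis using measure_period_measure[OF assms] by (simp add: scaleR_conv_of_real)
next
  case False
  define F where "F = (\<lambda>t. of_real T / (2 * pi * of_int n * \<i>) * fourier_exp T n t)"
  have "(LINT t|period_measure T. fourier_exp T n t) = (LINT t|lborel. indicator {0..T} t *\<^sub>R fourier_exp T n t)"
  proof (subst integral_period_measure)
    show "(LINT t|lborel. indicator {0<..<T} t *\<^sub>R fourier_exp T n t) =
        (LINT t|lborel. indicator {0..T} t *\<^sub>R fourier_exp T n t)"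
    proof (rule integral_cong_AE)
      show "AE t in lborel. indicator {0<..<T} t *\<^sub>R fourier_exp T n t =
          indicator {0..T} t *\<^sub>R fourier_exp T n t"
        using AE_lborel_singleton[of 0] AE_lborel_singleton[of T]
        by eventually_elim (auto simp: indicator_def)
    qed auto
  qed auto
  also have "\<dots> = F T - F 0"
  proof (rule integral_FTC_Icc)
    show "0 \<le> T" using assms by simp
    fix t
    let ?c = "2 * complex_of_real pi * of_int n * \<i> / of_real T"
    have "((\<lambda>z. 1 / ?c * exp (?c * z)) has_field_derivative exp (?c * of_real t)) (at (of_real t))"
      using assms False by (auto intro!: derivative_eq_intros)
    from has_vector_derivative_real_field[OF this]
    have "((\<lambda>t. 1 / ?c * exp (?c * of_real t)) has_vector_derivative exp (?c * of_real t)) (at t within {0..T})" .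
    moreover have "exp (?c * of_real t) = fourier_exp T n t" for t
      by (simp add: cis_conv_exp mult_ac)
    ultimately show "(F has_vector_derivative fourier_exp T n t) (at t within {0..T})"
      unfolding F_def by simp
  qed (use assms in \<open>auto intro!: continuous_intros\<close>)
  also have "F T = F 0" using assms by (simp add: F_def cis_multiple_2pi)
  finally show ?thesis using False by simp
qed

text \<open>Completing the square around the optimal coefficients h n / T. Choosing \<open>a\<close>
  optimal makes the last sum vanish and gives Bessel; dropping that nonnegative sum for a good
  approximant gives the reverse inequality.\<close>

lemma fourier_distance_identity:
  assumes T: "T > 0" and [measurable]: "H \<in> borel_measurable borel"
    and int: "integrable (period_measure T) (\<lambda>t. (cmod (H t))\<^sup>2)" and F: "finite F"
  defines "h \<equiv> \<lambda>n. LINT t|period_measure T. H t * cnj (fourier_exp T n t)"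
  shows "(LINT t|period_measure T. (cmod (H t - (\<Sum>n\<in>F. a n * fourier_exp T n t)))\<^sup>2) =
    (LINT t|period_measure T. (cmod (H t))\<^sup>2) - (\<Sum>n\<in>F. (cmod (h n))\<^sup>2) / T
      + T * (\<Sum>n\<in>F. (cmod (a n - h n / T))\<^sup>2)"
proof -
  interpret finite_measure "period_measure T" by (rule finite_measure_period)
  have H: "integrable (period_measure T) H"
  proof (rule Bochner_Integration.integrable_bound[of _ "\<lambda>t. 1 + (cmod (H t))\<^sup>2"])
    have "x \<le> 1 + x\<^sup>2" for x :: real
      using sum_squares_bound[of x 1, simplified] zero_le_power2[of x] by linarith
    then show "AE t in period_measure T. norm (H t) \<le> norm (1 + (cmod (H t))\<^sup>2)" by simp
  qed (use int in auto)
  have He: "integrable (period_measure T) (\<lambda>t. H t * cnj (fourier_exp T n t))" for n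
    by (rule Bochner_Integration.integrable_bound[OF H]) (auto simp: norm_mult)
  have Hc: "integrable (period_measure T) (\<lambda>t. cnj (H t * cnj (fourier_exp T n t)))" for n
    by (simp only: integrable_cnj He)
  have ee: "integrable (period_measure T) (fourier_exp T n)" for n
    by (rule integrable_const_bound[of _ 1]) auto
  have i2: "integrable (period_measure T) (\<lambda>t. complex_of_real ((cmod (H t))\<^sup>2))"
    by (rule integrable_of_real[OF int])
  have pw: "complex_of_real ((cmod (H t - (\<Sum>n\<in>F. a n * fourier_exp T n t)))\<^sup>2) =
     complex_of_real ((cmod (H t))\<^sup>2) - (\<Sum>n\<in>F. cnj (a n) * (H t * cnj (fourier_exp T n t)))
      - (\<Sum>n\<in>F. a n * cnj (H t * cnj (fourier_exp T n t)))
      + (\<Sum>n\<in>F. \<Sum>m\<in>F. a n * cnj (a m) * fourier_exp T (n - m) t)" (is "?L = ?R") for t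
  proof -
    have e: "fourier_exp T (n - m) t = fourier_exp T n t * cnj (fourier_exp T m t)" for n m
      by (simp add: cis_cnj cis_mult diff_divide_distrib algebra_simps)
    let ?p = "\<Sum>n\<in>F. a n * fourier_exp T n t"
    have "?L = (H t - ?p) * cnj (H t - ?p)" by (rule complex_norm_square)
    also have "\<dots> = H t * cnj (H t) - H t * cnj ?p - ?p * cnj (H t) + ?p * cnj ?p"
      by (simp add: algebra_simps)
    also have "H t * cnj (H t) = complex_of_real ((cmod (H t))\<^sup>2)" by (rule complex_norm_square[symmetric])
    also have "H t * cnj ?p = (\<Sum>n\<in>F. cnj (a n) * (H t * cnj (fourier_exp T n t)))"
      by (simp add: sum_distrib_left mult_ac)
    also have "?p * cnj (H t) = (\<Sum>n\<in>F. a n * cnj (H t * cnj (fourier_exp T n t)))"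
      by (simp add: sum_distrib_left sum_distrib_right mult_ac)
    also have "?p * cnj ?p = (\<Sum>n\<in>F. \<Sum>m\<in>F. a n * cnj (a m) * fourier_exp T (n - m) t)"
      unfolding e cnj_sum sum_product by (intro sum.cong refl) simp
    finally show ?thesis .
  qed
  have "complex_of_real (LINT t|period_measure T. (cmod (H t - (\<Sum>n\<in>F. a n * fourier_exp T n t)))\<^sup>2) =
      (LINT t|period_measure T. complex_of_real ((cmod (H t - (\<Sum>n\<in>F. a n * fourier_exp T n t)))\<^sup>2))"
    by (rule integral_complex_of_real[symmetric])
  also have "\<dots> = complex_of_real (LINT t|period_measure T. (cmod (H t))\<^sup>2)
      - (\<Sum>n\<in>F. cnj (a n) * h n) - (\<Sum>n\<in>F. a n * cnj (h n))
      + (\<Sum>n\<in>F. \<Sum>m\<in>F. a n * cnj (a m) * (if n - m = 0 then of_real T else 0))"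
    unfolding pw h_def integral_fourier_exp[OF T, symmetric] integral_cnj[symmetric]
      integral_complex_of_real[symmetric]
    using He Hc ee i2 by (simp del: of_real_power of_int_diff cis_cnj complex_cnj_mult integral_complex_of_real)
  also have "(\<Sum>n\<in>F. \<Sum>m\<in>F. a n * cnj (a m) * (if n - m = 0 then of_real T else 0)) =
      (\<Sum>n\<in>F. a n * cnj (a n) * of_real T)"
    using F by (intro sum.cong refl) (simp add: if_distrib[of "\<lambda>x. _ * x"] sum.delta cong: if_cong)
  also have "complex_of_real (LINT t|period_measure T. (cmod (H t))\<^sup>2)
      - (\<Sum>n\<in>F. cnj (a n) * h n) - (\<Sum>n\<in>F. a n * cnj (h n)) + (\<Sum>n\<in>F. a n * cnj (a n) * of_real T) =
     complex_of_real (LINT t|period_measure T. (cmod (H t))\<^sup>2) +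
      (\<Sum>n\<in>F. T * ((a n - h n / T) * cnj (a n - h n / T)) - h n * cnj (h n) / T)"
    using T by (simp add: algebra_simps sum.distrib sum_subtractf sum_negf)
  also have "\<dots> = complex_of_real ((LINT t|period_measure T. (cmod (H t))\<^sup>2) - (\<Sum>n\<in>F. (cmod (h n))\<^sup>2) / T
      + T * (\<Sum>n\<in>F. (cmod (a n - h n / T))\<^sup>2))"
    unfolding complex_norm_square[symmetric]
    by (simp add: sum_subtractf sum_distrib_left sum_divide_distrib del: of_real_power)
  finally show ?thesis by (simp only: of_real_eq_iff)
qed

theorem bessel_inequality:
  assumes T: "T > 0" and H: "H \<in> borel_measurable borel"
    and int: "integrable (period_measure T) (\<lambda>t. (cmod (H t))\<^sup>2)" and F: "finite F"
  shows "(\<Sum>n\<in>F. (cmod (LINT t|period_measure T. H t * cnj (fourier_exp T n t)))\<^sup>2)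
    \<le> T * (LINT t|period_measure T. (cmod (H t))\<^sup>2)"
proof -
  let ?h = "\<lambda>n. LINT t|period_measure T. H t * cnj (fourier_exp T n t)"
  have "0 \<le> (LINT t|period_measure T. (cmod (H t - (\<Sum>n\<in>F. ?h n / T * fourier_exp T n t)))\<^sup>2)"
    by simp
  then show ?thesis
    unfolding fourier_distance_identity[OF assms] using T by (simp add: field_simps)
qed

text \<open>The finite set is the frequency set of a trigonometric polynomial within e/T of
  \<open>H\<close> in squared L2 distance. The form with an error and a finite set suits the Gabor
  sum, which is a supremum over finite sets.\<close>

theorem parseval_lower:
  assumes T: "T > 0" and H: "H \<in> borel_measurable borel"
    and int: "integrable (period_measure T) (\<lambda>t. (cmod (H t))\<^sup>2)" and e: "e > 0"
  obtains F where "finite F" "T * (LINT t|period_measure T. (cmod (H t))\<^sup>2) - e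
    \<le> (\<Sum>n\<in>F. (cmod (LINT t|period_measure T. H t * cnj (fourier_exp T n t)))\<^sup>2)"
proof -
  let ?h = "\<lambda>n. LINT t|period_measure T. H t * cnj (fourier_exp T n t)"
  have "trig_approximable (period_measure T) T H"
    by (rule trig_approximable_L2) (use T H int finite_measure_period AE_period_measure in auto)
  moreover have "e / T > 0" using T e by simp
  ultimately obtain p where p: "trig_poly T p"
    "(LINT t|period_measure T. (cmod (H t - p t))\<^sup>2) < e / T"
    unfolding trig_approximable_def by meson
  obtain F a where F: "finite F" "p = (\<lambda>t. \<Sum>n\<in>F. a n * fourier_exp T n t)"
    by (rule trig_poly_sum_cis[OF p(1)])
  have "(LINT t|period_measure T. (cmod (H t))\<^sup>2) - (\<Sum>n\<in>F. (cmod (?h n))\<^sup>2) / T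
      + T * (\<Sum>n\<in>F. (cmod (a n - ?h n / T))\<^sup>2) < e / T"
    using p(2) unfolding F(2) fourier_distance_identity[OF T H int F(1)] .
  moreover have "T * (\<Sum>n\<in>F. (cmod (a n - ?h n / T))\<^sup>2) \<ge> 0"
    using T by (simp add: sum_nonneg)
  ultimately have "(LINT t|period_measure T. (cmod (H t))\<^sup>2) - (\<Sum>n\<in>F. (cmod (?h n))\<^sup>2) / T < e / T"
    by linarith
  moreover have "x - y / T < e / T \<Longrightarrow> T * x - e \<le> y" for x y
    using mult_strict_left_mono[OF _ T, of "x - y / T" "e / T"] T by (simp add: right_diff_distrib)
  ultimately have "T * (LINT t|period_measure T. (cmod (H t))\<^sup>2) - e \<le> (\<Sum>n\<in>F. (cmod (?h n))\<^sup>2)"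
    by blast
  then show ?thesis using that F(1) by blast
qed

subsection \<open>Cauchy matrices and elementary sums\<close>

abbreviation sech :: "real \<Rightarrow> real" where
  "sech u \<equiv> inverse (cosh u)"

text \<open>Indices k of the cells [kT, (k+1)T) that tile [-NT, NT), hence the asymmetric upper
  end.\<close>

abbreviation window :: "nat \<Rightarrow> int set" where
  "window N \<equiv> {- int N..int N - 1}"

text \<open>A two-sided geometric series with exp \<eta> - 1 >= \<eta>. The bound is independent of
  the finite set and of the centre; its growth 1/\<eta> is what later becomes the block length in
  Schur's test.\<close>

lemma sum_exp_abs_int_le:
  fixes \<eta> :: real and F :: "int set"
  assumes \<eta>: "\<eta> > 0" and F: "finite F"
  shows "(\<Sum>k\<in>F. exp (- \<eta> * \<bar>real_of_int (k - j)\<bar>)) \<le> 1 + 2 / \<eta>"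
proof -
  let ?r = "exp (- \<eta>)"
  have sym: "(\<Sum>k\<in>{- int N..int N}. exp (- \<eta> * \<bar>real_of_int k\<bar>)) = 1 + 2 * (\<Sum>i<N. ?r ^ Suc i)" for N
  proof (induction N)
    case (Suc N)
    have "{- int (Suc N)..int (Suc N)} = insert (- int (Suc N)) (insert (int (Suc N)) {- int N..int N})"
      by auto
    moreover have "exp (- \<eta> * real (Suc N)) = ?r ^ Suc N"
      by (simp only: exp_of_nat_mult[symmetric]) (simp add: mult.commute)
    ultimately show ?case using Suc by (simp add: add.commute)
  qed simp
  have geo: "(\<Sum>i<N. ?r ^ Suc i) \<le> 1 / \<eta>" for N
  proof -
    have "(\<Sum>i<N. ?r ^ Suc i) = ?r * ((1 - ?r ^ N) / (1 - ?r))"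
      using \<eta> by (simp add: sum_distrib_left[symmetric] sum_gp_strict)
    also have "\<dots> \<le> ?r * (1 / (1 - ?r))"
      using \<eta> by (intro mult_left_mono divide_right_mono) auto
    also have "\<dots> = 1 / (exp \<eta> - 1)"
      using \<eta> by (simp add: exp_minus field_simps)
    also have "\<dots> \<le> 1 / \<eta>"
    proof (rule divide_left_mono)
      show "\<eta> \<le> exp \<eta> - 1" using exp_ge_add_one_self[of \<eta>] by linarith
    qed (use \<eta> in auto)
    finally show ?thesis .
  qed
  have "finite ((\<lambda>k. nat \<bar>k - j\<bar>) ` F)" using F by simp
  then obtain N where N: "\<And>k. k \<in> F \<Longrightarrow> nat \<bar>k - j\<bar> \<le> N"
    by (meson finite_nat_set_iff_bounded_le imageI)
  have "(\<Sum>k\<in>F. exp (- \<eta> * \<bar>real_of_int (k - j)\<bar>)) =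
      (\<Sum>k\<in>(\<lambda>k. k - j) ` F. exp (- \<eta> * \<bar>real_of_int k\<bar>))"
    by (subst sum.reindex) (auto simp: inj_on_def)
  also have "\<dots> \<le> (\<Sum>k\<in>{- int N..int N}. exp (- \<eta> * \<bar>real_of_int k\<bar>))"
    using N by (intro sum_mono2) force+
  also have "\<dots> \<le> 1 + 2 / \<eta>" unfolding sym using geo[of N] by simp
  finally show ?thesis .
qed

lemma sum_exp_abs_progression_le:
  fixes \<eta> b u :: real and F :: "int set"
  assumes \<eta>: "\<eta> > 0" and b: "b > 0" and F: "finite F"
  shows "(\<Sum>k\<in>F. exp (- \<eta> * \<bar>u + b * real_of_int k\<bar>)) \<le> exp (\<eta> * b) * (1 + 2 / (\<eta> * b))"
proof -
  \<comment> \<open>\<open>j\<close> is the index whose term lies nearest to 0. Moving the centre of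
    the exponentials to \<open>j\<close> costs the factor exp (\<eta> b).\<close>
  define j where "j = round (- u / b)"
  have "\<bar>u + b * real_of_int j\<bar> = b * \<bar>real_of_int j - (- u / b)\<bar>"
    using b by (simp add: abs_mult_pos' field_simps)
  also have "\<dots> \<le> b * (1 / 2)"
    using b of_int_round_abs_le[of "- u / b"] by (intro mult_left_mono) (auto simp: j_def)
  finally have j: "\<bar>u + b * real_of_int j\<bar> \<le> b" using b by simp
  have "exp (- \<eta> * \<bar>u + b * real_of_int k\<bar>) \<le> exp (\<eta> * b) * exp (- (\<eta> * b) * \<bar>real_of_int (k - j)\<bar>)" for k
  proof -
    have "b * \<bar>real_of_int (k - j)\<bar> = \<bar>(u + b * real_of_int k) - (u + b * real_of_int j)\<bar>"
      using b by (simp add: abs_mult_pos' algebra_simps)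
    also have "\<dots> \<le> \<bar>u + b * real_of_int k\<bar> + b" using j by linarith
    finally have "\<eta> * (b * \<bar>real_of_int (k - j)\<bar>) \<le> \<eta> * (\<bar>u + b * real_of_int k\<bar> + b)"
      using \<eta> by (intro mult_left_mono) auto
    then show ?thesis unfolding exp_add[symmetric] exp_le_cancel_iff by (simp add: algebra_simps)
  qed
  then have "(\<Sum>k\<in>F. exp (- \<eta> * \<bar>u + b * real_of_int k\<bar>)) \<le>
      exp (\<eta> * b) * (\<Sum>k\<in>F. exp (- (\<eta> * b) * \<bar>real_of_int (k - j)\<bar>))"
    by (simp add: sum_distrib_left sum_mono)
  also have "\<dots> \<le> exp (\<eta> * b) * (1 + 2 / (\<eta> * b))"
    using \<eta> b F by (intro mult_left_mono sum_exp_abs_int_le) auto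
  finally show ?thesis .
qed

lemma schur_test:
  fixes K :: "'a \<Rightarrow> 'b \<Rightarrow> real" and c :: "'b \<Rightarrow> complex"
  assumes "finite A" "finite B" and R: "0 \<le> R"
    and row: "\<And>i. i \<in> A \<Longrightarrow> (\<Sum>j\<in>B. \<bar>K i j\<bar>) \<le> R"
    and col: "\<And>j. j \<in> B \<Longrightarrow> (\<Sum>i\<in>A. \<bar>K i j\<bar>) \<le> R'"
  shows "(\<Sum>i\<in>A. (cmod (\<Sum>j\<in>B. c j * of_real (K i j)))\<^sup>2) \<le> R * R' * (\<Sum>j\<in>B. (cmod (c j))\<^sup>2)"
proof -
  have "(cmod (\<Sum>j\<in>B. c j * of_real (K i j)))\<^sup>2 \<le> R * (\<Sum>j\<in>B. \<bar>K i j\<bar> * (cmod (c j))\<^sup>2)" if "i \<in> A" for i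
  proof -
    have "cmod (\<Sum>j\<in>B. c j * of_real (K i j)) \<le> (\<Sum>j\<in>B. sqrt \<bar>K i j\<bar> * (sqrt \<bar>K i j\<bar> * cmod (c j)))"
    proof (rule order_trans[OF norm_sum], rule sum_mono)
      fix j
      have "sqrt \<bar>K i j\<bar> * (sqrt \<bar>K i j\<bar> * cmod (c j)) = \<bar>K i j\<bar> * cmod (c j)"
        by (simp only: mult.assoc[symmetric] real_sqrt_mult_self abs_abs)
      then show "cmod (c j * of_real (K i j)) \<le> sqrt \<bar>K i j\<bar> * (sqrt \<bar>K i j\<bar> * cmod (c j))"
        by (simp only: norm_mult norm_of_real mult.commute order_refl)
    qed
    then have "(cmod (\<Sum>j\<in>B. c j * of_real (K i j)))\<^sup>2 \<le> (\<Sum>j\<in>B. sqrt \<bar>K i j\<bar> * (sqrt \<bar>K i j\<bar> * cmod (c j)))\<^sup>2"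
      by (intro power_mono) auto
    also have "\<dots> \<le> (\<Sum>j\<in>B. (sqrt \<bar>K i j\<bar>)\<^sup>2) * (\<Sum>j\<in>B. (sqrt \<bar>K i j\<bar> * cmod (c j))\<^sup>2)"
      by (rule Cauchy_Schwarz_ineq_sum)
    also have "\<dots> = (\<Sum>j\<in>B. \<bar>K i j\<bar>) * (\<Sum>j\<in>B. \<bar>K i j\<bar> * (cmod (c j))\<^sup>2)"
      by (simp add: power_mult_distrib)
    also have "\<dots> \<le> R * (\<Sum>j\<in>B. \<bar>K i j\<bar> * (cmod (c j))\<^sup>2)"
      using row[OF that] by (intro mult_right_mono sum_nonneg) auto
    finally show ?thesis .
  qed
  then have "(\<Sum>i\<in>A. (cmod (\<Sum>j\<in>B. c j * of_real (K i j)))\<^sup>2) \<le> (\<Sum>i\<in>A. R * (\<Sum>j\<in>B. \<bar>K i j\<bar> * (cmod (c j))\<^sup>2))"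
    by (rule sum_mono)
  also have "\<dots> = R * (\<Sum>j\<in>B. (\<Sum>i\<in>A. \<bar>K i j\<bar>) * (cmod (c j))\<^sup>2)"
    by (simp only: sum_distrib_left[symmetric] sum_distrib_right) (subst sum.swap, rule refl)
  also have "\<dots> \<le> R * (\<Sum>j\<in>B. R' * (cmod (c j))\<^sup>2)"
    using R col by (intro mult_left_mono sum_mono mult_right_mono) auto
  finally show ?thesis by (simp add: sum_distrib_left mult.assoc)
qed

section \<open>Explicit inverse of a Cauchy matrix and its entry bounds\<close>

lemma lagrange_interpolation:
  fixes q :: "real poly" and x :: "'a \<Rightarrow> real"
  assumes S: "finite S" and inj: "inj_on x S" and deg: "degree q < card S"
  shows "poly q z = (\<Sum>j\<in>S. poly q (x j) * (\<Prod>i\<in>S - {j}. (z - x i) / (x j - x i)))"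
proof -
  define L where "L = (\<Sum>j\<in>S. smult (poly q (x j) / (\<Prod>i\<in>S - {j}. x j - x i)) (\<Prod>i\<in>S - {j}. [:- x i, 1:]))"
  have pL: "poly L z = (\<Sum>j\<in>S. poly q (x j) * (\<Prod>i\<in>S - {j}. (z - x i) / (x j - x i)))" for z
    unfolding L_def poly_sum
    by (intro sum.cong refl) (simp add: poly_prod prod_dividef)
  have "degree L \<le> card S - 1" unfolding L_def
  proof (rule degree_sum_le[OF S])
    fix j assume "j \<in> S"
    have "degree (\<Prod>i\<in>S - {j}. [:- x i, 1:]) \<le> (\<Sum>i\<in>S - {j}. degree [:- x i, 1:])"
      using S by (intro degree_prod_sum_le[unfolded o_def]) auto
    then show "degree (smult (poly q (x j) / (\<Prod>i\<in>S - {j}. x j - x i)) (\<Prod>i\<in>S - {j}. [:- x i, 1:])) \<le> card S - 1"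
      using S \<open>j \<in> S\<close> by (intro order_trans[OF degree_smult_le]) simp
  qed
  then have degL: "degree L < card S" using deg by linarith
  have card: "card (x ` S) = card S" using inj by (rule card_image)
  have "q = L"
  proof (rule poly_eqI_degree[of "x ` S"])
    fix w assume "w \<in> x ` S"
    then obtain l where l: "l \<in> S" "w = x l" by auto
    have "(\<Prod>i\<in>S - {j}. (x l - x i) / (x j - x i)) = (if j = l then 1 else 0)" if "j \<in> S" for j
    proof (cases "j = l")
      case True
      have "x l - x i \<noteq> 0" if "i \<in> S - {j}" for i
        using that True l inj by (auto simp: inj_on_def)
      then have "(\<Prod>i\<in>S - {j}. (x l - x i) / (x j - x i)) = (\<Prod>i\<in>S - {j}. 1)"
        using True by (intro prod.cong) auto
      then show ?thesis using True by simp
    next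
      case False
      then show ?thesis using S l by (auto intro!: prod_zero)
    qed
    then have "poly L w = (\<Sum>j\<in>S. poly q (x j) * (if j = l then 1 else 0))"
      unfolding pL l by (intro sum.cong) auto
    also have "\<dots> = poly q w + (\<Sum>j\<in>S - {l}. poly q (x j) * (if j = l then 1 else 0))"
      by (subst sum.remove[OF S l(1)]) (simp add: l(2))
    also have "(\<Sum>j\<in>S - {l}. poly q (x j) * (if j = l then 1 else 0)) = 0"
      by (rule sum.neutral) auto
    finally show "poly q w = poly L w" by simp
  qed (use deg degL card in auto)
  then have "poly q z = poly L z" by (rule arg_cong)
  then show ?thesis unfolding pL .
qed

text \<open>The left inverse of the Cauchy matrix comes from interpolating the polynomial
  \<open>\<Prod>i\<noteq>k. (X + y i)\<close> at the nodes \<open>x j\<close> and evaluating at \<open>- y l\<close>.\<close>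
lemma cauchy_matrix_left_inverse:
  fixes x y :: "'a \<Rightarrow> real"
  assumes S: "finite S" and injx: "inj_on x S" and injy: "inj_on y S"
    and pos: "\<And>j. j \<in> S \<Longrightarrow> 0 < x j" "\<And>j. j \<in> S \<Longrightarrow> 0 < y j" and kl: "k \<in> S" "l \<in> S"
  shows "(\<Sum>j\<in>S. ((\<Prod>i\<in>S. - y k - x i) / (\<Prod>i\<in>S - {k}. y i - y k)) *
     ((\<Prod>i\<in>S - {k}. x j + y i) / (\<Prod>i\<in>S - {j}. x j - x i)) / (x j + y l)) = (if k = l then -1 else 0)"
proof -
  define q where "q = (\<Prod>i\<in>S - {k}. [:y i, 1:])"
  have pq: "poly q z = (\<Prod>i\<in>S - {k}. z + y i)" for z by (simp add: q_def poly_prod add.commute)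
  have "degree q \<le> (\<Sum>i\<in>S - {k}. degree [:y i, 1:])"
    unfolding q_def using S by (intro degree_prod_sum_le[unfolded o_def]) auto
  also have "\<dots> = card S - 1" using S kl by simp
  also have "\<dots> < card S" using S kl by (metis card_gt_0_iff diff_less empty_iff zero_less_one)
  finally have deg: "degree q < card S" .
  have nz: "(\<Prod>i\<in>S. - y l - x i) \<noteq> 0"
  proof -
    have "- y l - x i \<noteq> 0" if "i \<in> S" for i using pos(1)[OF that] pos(2)[OF kl(2)] by linarith
    then show ?thesis using S by (simp only: prod_zero_iff) blast
  qed
  have ql: "poly q (- y l) = (if k = l then (\<Prod>i\<in>S - {k}. y i - y k) else 0)"
    using S kl unfolding pq by (auto intro!: prod.cong)
  have qk: "(\<Prod>i\<in>S - {k}. y i - y k) \<noteq> 0"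
    using S kl injy by (auto simp: inj_on_def)
  have prod_eq: "(\<Prod>i\<in>S - {j}. (- y l - x i) / (x j - x i)) =
      - (\<Prod>i\<in>S. - y l - x i) / ((\<Prod>i\<in>S - {j}. x j - x i) * (x j + y l))" if "j \<in> S" for j
  proof -
    have "(\<Prod>i\<in>S. - y l - x i) = (- y l - x j) * (\<Prod>i\<in>S - {j}. - y l - x i)"
      using S that by (rule prod.remove)
    moreover have "x j + y l \<noteq> 0" using pos that kl by (smt (verit))
    moreover have "(- y l - x j) * (\<Prod>i\<in>S - {j}. - y l - x i) = - ((x j + y l) * (\<Prod>i\<in>S - {j}. - y l - x i))"
      by (simp add: algebra_simps)
    ultimately show ?thesis
      unfolding prod_dividef by simp
  qed
  have "poly q (- y l) = (\<Sum>j\<in>S. poly q (x j) * (\<Prod>i\<in>S - {j}. (- y l - x i) / (x j - x i)))"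
    by (rule lagrange_interpolation[OF S injx deg])
  also have "\<dots> = (\<Sum>j\<in>S. - (\<Prod>i\<in>S. - y l - x i) * ((\<Prod>i\<in>S - {k}. x j + y i) / (\<Prod>i\<in>S - {j}. x j - x i) / (x j + y l)))"
    by (intro sum.cong refl) (simp add: prod_eq pq)
  also have "\<dots> = - (\<Prod>i\<in>S. - y l - x i) * (\<Sum>j\<in>S. (\<Prod>i\<in>S - {k}. x j + y i) / (\<Prod>i\<in>S - {j}. x j - x i) / (x j + y l))"
    by (simp only: sum_distrib_left)
  finally have eq: "poly q (- y l) = - (\<Prod>i\<in>S. - y l - x i) *
      (\<Sum>j\<in>S. (\<Prod>i\<in>S - {k}. x j + y i) / (\<Prod>i\<in>S - {j}. x j - x i) / (x j + y l))" .
  have main: "(\<Sum>j\<in>S. (\<Prod>i\<in>S - {k}. x j + y i) / (\<Prod>i\<in>S - {j}. x j - x i) / (x j + y l)) =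
      - poly q (- y l) / (\<Prod>i\<in>S. - y l - x i)"
    unfolding eq minus_mult_left[symmetric] minus_minus using nz by (rule nonzero_mult_div_cancel_left[symmetric])
  have "(\<Sum>j\<in>S. ((\<Prod>i\<in>S. - y k - x i) / (\<Prod>i\<in>S - {k}. y i - y k)) *
     ((\<Prod>i\<in>S - {k}. x j + y i) / (\<Prod>i\<in>S - {j}. x j - x i)) / (x j + y l)) =
     ((\<Prod>i\<in>S. - y k - x i) / (\<Prod>i\<in>S - {k}. y i - y k)) *
      (\<Sum>j\<in>S. (\<Prod>i\<in>S - {k}. x j + y i) / (\<Prod>i\<in>S - {j}. x j - x i) / (x j + y l))"
    unfolding sum_distrib_left by (simp only: times_divide_eq_right)
  also have "\<dots> = (if k = l then -1 else 0)"
    unfolding main ql using nz qk by (cases "k = l") simp_all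
  finally show ?thesis .
qed

text \<open>Treats what remains of the Cauchy products after the leading exponentials are taken out.
  Each factor differs from 1 by a multiple of exp (-\<kappa> |i - k|), a summable amount, so the
  product is bounded independently of the window. Leaving out i = k keeps the denominators away from
  0.\<close>

lemma prod_correction_le:
  fixes \<kappa> :: real and S :: "int set" and u v :: "int \<Rightarrow> real"
  assumes \<kappa>: "\<kappa> > 0" and S: "finite S" and k: "k \<notin> S"
    and uv: "\<And>i. i \<in> S \<Longrightarrow> 0 \<le> u i \<and> u i \<le> exp (- \<kappa> * \<bar>real_of_int (i - k)\<bar>)"
      "\<And>i. i \<in> S \<Longrightarrow> 0 \<le> v i \<and> v i \<le> exp (- \<kappa> * \<bar>real_of_int (i - k)\<bar>)"
  shows "(\<Prod>i\<in>S. (1 + u i) / (1 - v i)) \<le> exp ((1 + 1 / (1 - exp (- \<kappa>))) * (1 + 2 / \<kappa>))"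
proof -
  let ?D = "1 / (1 - exp (- \<kappa>))"
  have D: "?D > 0" using \<kappa> by simp
  have fac: "0 \<le> (1 + u i) / (1 - v i) \<and> (1 + u i) / (1 - v i) \<le> exp ((1 + ?D) * exp (- \<kappa> * \<bar>real_of_int (i - k)\<bar>))"
    if i: "i \<in> S" for i
  proof -
    have "\<bar>real_of_int (i - k)\<bar> \<ge> 1" using i k by (cases "i = k") auto
    then have "exp (- \<kappa> * \<bar>real_of_int (i - k)\<bar>) \<le> exp (- \<kappa>)" using \<kappa> by simp
    then have v: "v i \<le> exp (- \<kappa>)" using uv(2)[OF i] by linarith
    have e1: "exp (- \<kappa>) < 1" using \<kappa> by simp
    have v1: "v i < 1" using v e1 by linarith
    have "1 / (1 - v i) = ((1 - v i) + v i) / (1 - v i)" by simp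
    also have "\<dots> = 1 + v i / (1 - v i)"
      using le_less_trans[OF v e1] by (subst add_divide_distrib) simp
    finally have "1 / (1 - v i) = 1 + v i / (1 - v i)" .
    also have "\<dots> \<le> 1 + v i * ?D"
    proof -
      have "v i / (1 - v i) \<le> v i / (1 - exp (- \<kappa>))"
        using v e1 uv(2)[OF i] by (intro frac_le) auto
      then show ?thesis by simp
    qed
    also have "\<dots> \<le> exp (v i * ?D)" by (rule exp_ge_add_one_self)
    also have "\<dots> \<le> exp (exp (- \<kappa> * \<bar>real_of_int (i - k)\<bar>) * ?D)"
      using uv(2)[OF i] D by (intro iffD2[OF exp_le_cancel_iff] mult_right_mono) auto
    finally have 1: "1 / (1 - v i) \<le> exp (exp (- \<kappa> * \<bar>real_of_int (i - k)\<bar>) * ?D)" .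
    have "1 + u i \<le> exp (u i)" by (rule exp_ge_add_one_self)
    also have "\<dots> \<le> exp (exp (- \<kappa> * \<bar>real_of_int (i - k)\<bar>))" using uv(1)[OF i] by simp
    finally have 2: "1 + u i \<le> exp (exp (- \<kappa> * \<bar>real_of_int (i - k)\<bar>))" .
    have "(1 + u i) * (1 / (1 - v i)) \<le>
        exp (exp (- \<kappa> * \<bar>real_of_int (i - k)\<bar>)) * exp (exp (- \<kappa> * \<bar>real_of_int (i - k)\<bar>) * ?D)"
      by (rule mult_mono[OF 2 1]) (use v1 in auto)
    also have "\<dots> = exp ((1 + ?D) * exp (- \<kappa> * \<bar>real_of_int (i - k)\<bar>))"
      unfolding exp_add[symmetric] by (simp only: distrib_right mult_1_left mult.commute)
    finally have "(1 + u i) / (1 - v i) \<le> exp ((1 + ?D) * exp (- \<kappa> * \<bar>real_of_int (i - k)\<bar>))"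
      by simp
    moreover have "0 \<le> (1 + u i) / (1 - v i)" using uv(1)[OF i] v1 by simp
    ultimately show ?thesis by simp
  qed
  have "(\<Prod>i\<in>S. (1 + u i) / (1 - v i)) \<le> (\<Prod>i\<in>S. exp ((1 + ?D) * exp (- \<kappa> * \<bar>real_of_int (i - k)\<bar>)))"
    by (intro prod_mono fac)
  also have "\<dots> = exp ((1 + ?D) * (\<Sum>i\<in>S. exp (- \<kappa> * \<bar>real_of_int (i - k)\<bar>)))"
    using S by (simp add: exp_sum sum_distrib_left)
  also have "\<dots> \<le> exp ((1 + ?D) * (1 + 2 / \<kappa>))"
    using D sum_exp_abs_int_le[OF \<kappa> S, of k] by (intro iffD2[OF exp_le_cancel_iff] mult_left_mono) auto
  finally show ?thesis .
qed

text \<open>Full blocks are peeled off one at a time. The subtracted 1 pays for the incomplete last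
  block, about which only nonnegativity is known. Half-open ranges make the blocks fit
  together.\<close>

lemma sum_ge_of_block_sums:
  fixes w :: "int \<Rightarrow> real"
  assumes w: "\<And>i. 0 \<le> w i" and n: "n \<ge> 1" and c: "c \<ge> 0"
    and block: "\<And>i. c \<le> sum w {i<..i + int n}"
  shows "c * (real m / real n - 1) \<le> sum w {i<..i + int m}"
proof (induction m arbitrary: i rule: less_induct)
  case (less m)
  show ?case
  proof (cases "m < n")
    case True
    then have "real m / real n - 1 \<le> 0" using n by simp
    then have "c * (real m / real n - 1) \<le> 0" using c by (simp add: mult_nonneg_nonpos)
    also have "\<dots> \<le> sum w {i<..i + int m}" using w by (simp add: sum_nonneg)
    finally show ?thesis .
  next
    case False
    have "(i + int n) + int (m - n) = i + int m" using False by simp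
    then have "{i<..i + int m} = {i<..i + int n} \<union> {i + int n<..(i + int n) + int (m - n)}"
      using False by (auto simp: set_eq_iff)
    then have "sum w {i<..i + int m} = sum w {i<..i + int n} + sum w {i + int n<..(i + int n) + int (m - n)}"
      by (simp only:) (rule sum.union_disjoint; auto)
    moreover have "c * (real (m - n) / real n - 1) \<le> sum w {i + int n<..(i + int n) + int (m - n)}"
      using False n by (intro less.IH) auto
    moreover have "c * (real m / real n - 1) = c + c * (real (m - n) / real n - 1)"
    proof -
      have "real (m - n) / real n = real m / real n - 1"
        using False n by (simp add: of_nat_diff diff_divide_distrib)
      then show ?thesis by (simp only:) (simp add: algebra_simps)
    qed
    moreover have "c \<le> sum w {i<..i + int n}" by (rule block)
    ultimately show ?thesis by linarith
  qed
qed

text \<open>Meant for a' >= b': the dominant exponentials are pulled out of numerator and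
  denominator, leaving a correction close to 1. All growth and decay of the inverse matrix then sits
  in exp (a' - a).\<close>

lemma exp_sum_diff_ratio:
  fixes a a' b b' :: real
  assumes "b < a"
  shows "(exp a' + exp b') / \<bar>exp a - exp b\<bar> = exp (a' - a) * ((1 + exp (- (a' - b'))) / (1 - exp (- (a - b))))"
proof -
  have "exp a' + exp b' = exp a' * (1 + exp (- (a' - b')))" by (simp add: exp_diff exp_minus field_simps)
  moreover have "\<bar>exp a - exp b\<bar> = exp a * (1 - exp (- (a - b)))"
    using assms by (simp add: exp_diff exp_minus field_simps)
  ultimately show ?thesis by (simp add: exp_diff)
qed

lemma int_fun_diff_ge:
  fixes f :: "int \<Rightarrow> int"
  assumes "\<And>i. f i + 1 \<le> f (i + 1)" and "i \<le> j"
  shows "f i + (j - i) \<le> f j"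
  using assms(2)
proof (induction j rule: int_ge_induct)
  case (step j)
  then show ?case using assms(1)[of j] by linarith
qed simp

text \<open>Only indices beyond \<open>k\<close> carry a leading exponential. The gaps of at least
  |i - k| / 2 reduce the rate 2\<kappa> of the corrections to the rate \<kappa> that
  \<open>prod_correction_le\<close> expects.\<close>

lemma prod_ratio_le:
  fixes \<kappa> :: real and S :: "int set" and R u v :: "int \<Rightarrow> real"
  assumes \<kappa>: "\<kappa> > 0" and S: "finite S"
    and R: "\<And>i. i \<in> S - {k} \<Longrightarrow> R i = exp (if k < i then w i else 0) *
      ((1 + exp (- (2 * \<kappa> * \<bar>u i\<bar>))) / (1 - exp (- (2 * \<kappa> * \<bar>v i\<bar>))))"
    and uv: "\<And>i. i \<in> S - {k} \<Longrightarrow> \<bar>real_of_int (i - k)\<bar> / 2 \<le> \<bar>u i\<bar>"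
      "\<And>i. i \<in> S - {k} \<Longrightarrow> \<bar>real_of_int (i - k)\<bar> / 2 \<le> \<bar>v i\<bar>"
  shows "(\<Prod>i\<in>S - {k}. R i) \<le> exp (\<Sum>i\<in>S - {k}. if k < i then w i else 0) *
    exp ((1 + 1 / (1 - exp (- \<kappa>))) * (1 + 2 / \<kappa>))"
proof -
  let ?e = "\<lambda>z :: real. exp (- (2 * \<kappa> * \<bar>z\<bar>))"
  have gap: "?e z \<le> exp (- \<kappa> * \<bar>real_of_int n\<bar>)" if "\<bar>real_of_int n\<bar> / 2 \<le> \<bar>z\<bar>" for n z
    using mult_left_mono[OF that, of "2 * \<kappa>"] \<kappa> by simp
  have "(\<Prod>i\<in>S - {k}. R i) = exp (\<Sum>i\<in>S - {k}. if k < i then w i else 0) *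
      (\<Prod>i\<in>S - {k}. (1 + ?e (u i)) / (1 - ?e (v i)))"
    unfolding exp_sum[OF finite_Diff[OF S]] prod.distrib[symmetric] by (rule prod.cong[OF refl R])
  also have "\<dots> \<le> exp (\<Sum>i\<in>S - {k}. if k < i then w i else 0) *
      exp ((1 + 1 / (1 - exp (- \<kappa>))) * (1 + 2 / \<kappa>))"
    by (intro mult_left_mono prod_correction_le[OF \<kappa>, where k = k] conjI gap uv exp_ge_zero)
      (use S in auto)
  finally show ?thesis .
qed

text \<open>The first factor is the prefactor from the diagonal entries, exp (\<kappa> / 2) pays for
  the displacement of a sample by at most 1/2, and the squared exponential is one correction product
  for each of the two ratio products in an entry of the inverse.\<close>

definition sech_inverse_const :: "real \<Rightarrow> real" where
  "sech_inverse_const \<kappa> = (1 + exp \<kappa>)\<^sup>2 / 2 * exp (\<kappa> / 2) * (exp ((1 + 1 / (1 - exp (- \<kappa>))) * (1 + 2 / \<kappa>)))\<^sup>2"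

text \<open>The variables exp (2\<kappa> s) and exp (2\<kappa> p) turn the secant matrix into a
  Cauchy matrix. For k <= j the ratio products give exp (2\<kappa> \<open>\<Sum>\<close> \<delta> i)
  over k < i <= j, and the prefactor gives exp (-\<kappa> |s j - p k|). Since |s j - p k| is T (j -
  k) up to 1/2, spreading that distance evenly over the j - k indices produces the terms T/2 -
  \<delta> i; for j <= k the sign of \<delta> is reversed.\<close>

lemma sech_matrix_left_inverse:
  fixes \<kappa> T \<alpha> t :: real and f :: "int \<Rightarrow> int" and lo hi :: int
  assumes \<kappa>: "\<kappa> > 0" and \<alpha>: "1/2 \<le> \<alpha>" "\<alpha> \<le> 1" and T: "1 \<le> T"
    and f: "\<And>i. f i + 1 \<le> f (i + 1)"
  defines "p \<equiv> \<lambda>i::int. t + T * of_int i" and "s \<equiv> \<lambda>i. \<alpha> * of_int (f i)"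
  assumes near: "\<And>i. \<bar>s i - p i\<bar> \<le> \<alpha> / 2"
  obtains K :: "int \<Rightarrow> int \<Rightarrow> real" where
    "\<And>k l. k \<in> {lo..hi} \<Longrightarrow> l \<in> {lo..hi} \<Longrightarrow>
      (\<Sum>j\<in>{lo..hi}. K k j * sech (\<kappa> * (s j - p l))) = (if k = l then 1 else 0)"
    "\<And>k j. k \<in> {lo..hi} \<Longrightarrow> j \<in> {lo..hi} \<Longrightarrow> k \<le> j \<Longrightarrow>
      \<bar>K k j\<bar> \<le> sech_inverse_const \<kappa> * exp (- 2 * \<kappa> * (\<Sum>i\<in>{k<..j}. T / 2 - (s i - p i)))"
    "\<And>k j. k \<in> {lo..hi} \<Longrightarrow> j \<in> {lo..hi} \<Longrightarrow> j \<le> k \<Longrightarrow>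
      \<bar>K k j\<bar> \<le> sech_inverse_const \<kappa> * exp (- 2 * \<kappa> * (\<Sum>i\<in>{j<..k}. T / 2 + (s i - p i)))"
proof -
  define S where "S = {lo..hi}"
  define x where "x = (\<lambda>i. exp (2 * \<kappa> * s i))"
  define y where "y = (\<lambda>i. exp (2 * \<kappa> * p i))"
  define \<delta> where "\<delta> = (\<lambda>i. s i - p i)"
  define corr where "corr = exp ((1 + 1 / (1 - exp (- \<kappa>))) * (1 + 2 / \<kappa>))"
  have S: "finite S" by (simp add: S_def)
  have g1': "p j - p i = T * real_of_int (j - i)" for i j by (simp add: p_def algebra_simps)
  \<comment> \<open>The spare 1/2 absorbs the displacement \<alpha>/2 <= 1/2 when a point p is
    replaced by its sample s.\<close>
  have aux: "z / 2 + 1 / 2 \<le> T * z" if "1 \<le> z" for z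
    using mult_right_mono[OF T, of z] that by linarith
  have g1'': "real_of_int (j - i) / 2 + 1/2 \<le> p j - p i" if "i < j" for i j
    unfolding g1' by (rule aux) (use that in linarith)
  have g1: "real_of_int (j - i) / 2 \<le> p j - p i" if "i < j" for i j
    using g1''[OF that] by linarith
  have g2: "real_of_int (j - i) / 2 \<le> s j - p i" "real_of_int (j - i) / 2 \<le> p j - s i" if "i < j" for i j
    using g1''[OF that] near[of j] near[of i] \<alpha> by argo+
  have g4: "real_of_int (j - i) / 2 \<le> s j - s i" if "i < j" for i j
  proof -
    have "f i + (j - i) \<le> f j" using int_fun_diff_ge[of f i j] f that by simp
    then have "real_of_int (j - i) \<le> real_of_int (f j - f i)" by linarith
    then have "1/2 * real_of_int (j - i) \<le> \<alpha> * real_of_int (f j - f i)"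
      using \<alpha> that by (intro mult_mono) auto
    then show ?thesis by (simp add: s_def algebra_simps)
  qed
  have ij: "0 < real_of_int (j - i) / 2" if "i < j" for i j using that by simp
  have p_less: "p i < p j" if "i < j" for i j using less_le_trans[OF ij[OF that] g1[OF that]] by simp
  have s_less: "s i < s j" if "i < j" for i j using less_le_trans[OF ij[OF that] g4[OF that]] by simp
  have injx: "inj_on x S"
    unfolding x_def inj_on_def using \<kappa> s_less by (auto, metis linorder_neqE_linordered_idom order_less_irrefl)
  have injy: "inj_on y S"
    unfolding y_def inj_on_def using \<kappa> p_less by (auto, metis linorder_neqE_linordered_idom order_less_irrefl)
  have pos: "0 < x i" "0 < y i" for i by (auto simp: x_def y_def)
  define L where "L = (\<lambda>k j. ((\<Prod>i\<in>S. - y k - x i) / (\<Prod>i\<in>S - {k}. y i - y k)) *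
     ((\<Prod>i\<in>S - {k}. x j + y i) / (\<Prod>i\<in>S - {j}. x j - x i)))"
  \<comment> \<open>The sign undoes the -1 on the diagonal produced by interpolation; the
    exponentials undo the row and column factors that separate sech from the Cauchy kernel.\<close>
  define K where "K = (\<lambda>k j. - L k j / (2 * exp (\<kappa> * s j) * exp (\<kappa> * p k)))"
  have inv: "(\<Sum>j\<in>S. K k j * sech (\<kappa> * (s j - p l))) = (if k = l then 1 else 0)"
    if "k \<in> S" "l \<in> S" for k l
  proof -
    have cosh: "sech (\<kappa> * (s j - p l)) = 2 * exp (\<kappa> * s j) * exp (\<kappa> * p l) / (x j + y l)" for j
    proof -
      have "x j = exp (\<kappa> * s j) * exp (\<kappa> * s j)" "y l = exp (\<kappa> * p l) * exp (\<kappa> * p l)"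
        by (simp_all add: x_def y_def exp_add[symmetric])
      then have "cosh (\<kappa> * (s j - p l)) * (2 * exp (\<kappa> * s j) * exp (\<kappa> * p l)) = x j + y l"
        by (simp add: cosh_def right_diff_distrib exp_diff exp_minus field_simps)
      moreover have "x j + y l \<noteq> 0" using pos[of j] pos[of l] by linarith
      moreover have "cosh (\<kappa> * (s j - p l)) \<noteq> 0" using cosh_real_pos[of "\<kappa> * (s j - p l)"] by linarith
      ultimately show ?thesis by (simp add: field_simps)
    qed
    have "K k j * sech (\<kappa> * (s j - p l)) = - (exp (\<kappa> * p l) / exp (\<kappa> * p k)) * (L k j / (x j + y l))" for j
      unfolding cosh K_def by simp
    then have "(\<Sum>j\<in>S. K k j * sech (\<kappa> * (s j - p l))) =
        - (exp (\<kappa> * p l) / exp (\<kappa> * p k)) * (\<Sum>j\<in>S. L k j / (x j + y l))"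
      by (simp only: sum_distrib_left)
    also have "(\<Sum>j\<in>S. L k j / (x j + y l)) = (if k = l then -1 else 0)"
      unfolding L_def by (rule cauchy_matrix_left_inverse[OF S injx injy pos that])
    finally show ?thesis by simp
  qed
  have bound: "\<bar>K k j\<bar> \<le> (1 + exp \<kappa>)\<^sup>2 / 2 * exp (- \<kappa> * \<bar>s j - p k\<bar>) * corr\<^sup>2 *
      exp (2 * \<kappa> * ((\<Sum>i\<in>{k<..hi}. \<delta> i) - (\<Sum>i\<in>{j<..hi}. \<delta> i)))"
    if kS: "k \<in> S" and jS: "j \<in> S" for k j
  proof -
    define R where "R = (\<lambda>i. (x i + y k) / \<bar>y i - y k\<bar>)"
    define Q where "Q = (\<lambda>i. (x j + y i) / \<bar>x j - x i\<bar>)"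
    have absL: "\<bar>L k j\<bar> = ((\<Prod>i\<in>S. x i + y k) / (\<Prod>i\<in>S - {k}. \<bar>y i - y k\<bar>)) *
      ((\<Prod>i\<in>S - {k}. x j + y i) / (\<Prod>i\<in>S - {j}. \<bar>x j - x i\<bar>))"
    proof -
      have "\<bar>\<Prod>i\<in>S. - y k - x i\<bar> = (\<Prod>i\<in>S. x i + y k)"
        unfolding abs_prod by (intro prod.cong refl) (use pos in \<open>smt (verit)\<close>)
      moreover have "\<bar>\<Prod>i\<in>S - {k}. x j + y i\<bar> = (\<Prod>i\<in>S - {k}. x j + y i)"
        unfolding abs_prod by (intro prod.cong refl) (use pos in \<open>smt (verit)\<close>)
      ultimately show ?thesis unfolding L_def by (simp add: abs_mult abs_prod)
    qed
    \<comment> \<open>Both sides are the full product over \<open>S\<close>. Exchanging the omitted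
      index k for j pairs the numerators with the denominators x j - x i, which omit j.\<close>
    have "(x j + y k) * (\<Prod>i\<in>S - {k}. x j + y i) = (x j + y j) * (\<Prod>i\<in>S - {j}. x j + y i)"
      using prod.remove[OF S kS, of "\<lambda>i. x j + y i"] prod.remove[OF S jS, of "\<lambda>i. x j + y i"] by simp
    moreover have xy: "x j + y k \<noteq> 0" using pos[of j] pos[of k] by linarith
    ultimately have "(\<Prod>i\<in>S - {k}. x j + y i) = (x j + y j) / (x j + y k) * (\<Prod>i\<in>S - {j}. x j + y i)"
      by (simp add: field_simps)
    moreover have "(\<Prod>i\<in>S. x i + y k) = (x k + y k) * (\<Prod>i\<in>S - {k}. x i + y k)"
      by (rule prod.remove[OF S kS])
    ultimately have "\<bar>L k j\<bar> = (x k + y k) * ((x j + y j) / (x j + y k)) * (\<Prod>i\<in>S - {k}. R i) * (\<Prod>i\<in>S - {j}. Q i)"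
      unfolding absL R_def Q_def prod_dividef by (simp add: mult_ac)
    then have absK: "\<bar>K k j\<bar> = (x k + y k) * (x j + y j) / ((x j + y k) * (2 * exp (\<kappa> * s j) * exp (\<kappa> * p k))) *
        (\<Prod>i\<in>S - {k}. R i) * (\<Prod>i\<in>S - {j}. Q i)"
      unfolding K_def by (simp add: abs_mult mult_ac)
    \<comment> \<open>As |s - p| <= 1/2, x k is at most exp \<kappa> times y k, and y j at most exp
      \<kappa> times x j. What is left is the geometric mean \<open>E\<close> of x j and y k over
      their sum, which decays like exp (-\<kappa> |s j - p k|).\<close>
    have pre: "(x k + y k) * (x j + y j) / ((x j + y k) * (2 * exp (\<kappa> * s j) * exp (\<kappa> * p k))) \<le>
        (1 + exp \<kappa>)\<^sup>2 / 2 * exp (- \<kappa> * \<bar>s j - p k\<bar>)"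
    proof -
      define E where "E = exp (\<kappa> * s j) * exp (\<kappa> * p k)"
      have E: "E > 0" by (simp add: E_def)
      have E2: "y k * x j = E * E" unfolding E_def x_def y_def exp_add[symmetric] by (simp add: algebra_simps)
      have "2 * (s k - p k) \<le> 1" "2 * (p j - s j) \<le> 1"
        using near[of k] near[of j] \<alpha> by argo+
      then have "\<kappa> * (2 * (s k - p k)) \<le> \<kappa> * 1" "\<kappa> * (2 * (p j - s j)) \<le> \<kappa> * 1"
        using \<kappa> by (auto intro: mult_left_mono)
      then have "x k \<le> exp \<kappa> * y k" "y j \<le> exp \<kappa> * x j"
        unfolding x_def y_def exp_add[symmetric] by (simp_all add: algebra_simps)
      then have "x k + y k \<le> (1 + exp \<kappa>) * y k" "x j + y j \<le> (1 + exp \<kappa>) * x j"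
        by (simp_all add: distrib_right)
      then have "(x k + y k) * (x j + y j) \<le> ((1 + exp \<kappa>) * y k) * ((1 + exp \<kappa>) * x j)"
        by (intro mult_mono mult_nonneg_nonneg add_nonneg_nonneg) (simp_all add: less_imp_le pos)
      also have "\<dots> = (1 + exp \<kappa>)\<^sup>2 * (E * E)" unfolding E2[symmetric] by (simp add: power2_eq_square)
      finally have num: "(x k + y k) * (x j + y j) \<le> (1 + exp \<kappa>)\<^sup>2 * (E * E)" .
      have xy_pos: "x j + y k > 0" using pos by (intro add_pos_pos)
      have "E \<le> exp (- \<kappa> * \<bar>s j - p k\<bar>) * (x j + y k)"
      proof (cases "p k \<le> s j")
        case True
        then have "E = exp (- \<kappa> * \<bar>s j - p k\<bar>) * x j"
          unfolding E_def x_def exp_add[symmetric] by (simp add: algebra_simps)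
        then show ?thesis using pos(2)[of k] by (simp add: distrib_left)
      next
        case False
        then have "E = exp (- \<kappa> * \<bar>s j - p k\<bar>) * y k"
          unfolding E_def y_def exp_add[symmetric] by (simp add: algebra_simps)
        then show ?thesis using pos(1)[of j] by (simp add: distrib_left)
      qed
      then have den: "E / (x j + y k) \<le> exp (- \<kappa> * \<bar>s j - p k\<bar>)"
        using xy_pos by (simp add: divide_le_eq)
      have "(x k + y k) * (x j + y j) / ((x j + y k) * (2 * E)) \<le> (1 + exp \<kappa>)\<^sup>2 * (E * E) / ((x j + y k) * (2 * E))"
        using num xy_pos E by (intro divide_right_mono) auto
      also have "\<dots> = (1 + exp \<kappa>)\<^sup>2 / 2 * (E / (x j + y k))" using E by simp
      also have "\<dots> \<le> (1 + exp \<kappa>)\<^sup>2 / 2 * exp (- \<kappa> * \<bar>s j - p k\<bar>)"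
        by (intro mult_left_mono den) auto
      finally show ?thesis unfolding E_def by (simp only: mult.assoc)
    qed
    have abs_half_gap: "\<bar>real_of_int (i - l)\<bar> / 2 \<le> \<bar>z - z'\<bar>"
      if "i \<noteq> l" "i < l \<Longrightarrow> real_of_int (l - i) / 2 \<le> z' - z"
        "l < i \<Longrightarrow> real_of_int (i - l) / 2 \<le> z - z'" for i l z z'
    proof (cases "i < l")
      case True
      then have "\<bar>real_of_int (i - l)\<bar> = real_of_int (l - i)" by simp
      with that(2)[OF True] show ?thesis by (simp only:; metis abs_ge_self abs_minus_commute order_trans)
    next
      case False
      then have "l < i" using that(1) by simp
      then have "\<bar>real_of_int (i - l)\<bar> = real_of_int (i - l)" by simp
      with that(3)[OF \<open>l < i\<close>] show ?thesis by (simp only:; metis abs_ge_self order_trans)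
    qed
    have filter_sum: "(\<Sum>i\<in>S - {l}. if l < i then h i else 0) = (\<Sum>i\<in>{l<..hi}. h i)" if "l \<in> S" for l and h :: "int \<Rightarrow> real"
      by (rule sum.mono_neutral_cong_right) (use that in \<open>auto simp: S_def\<close>)
    \<comment> \<open>For i < k the term y k dominates numerator and denominator alike and cancels;
      for i > k the quotient x i / y i = exp (2\<kappa> \<delta> i) survives. In the product of the
      Q i the quotient is inverted, hence the opposite sign there.\<close>
    have prodR: "(\<Prod>i\<in>S - {k}. R i) \<le> exp (2 * \<kappa> * (\<Sum>i\<in>{k<..hi}. \<delta> i)) * corr"
    proof -
      have R: "R i = exp (if k < i then 2 * \<kappa> * \<delta> i else 0) * ((1 + exp (- (2 * \<kappa> * \<bar>s i - p k\<bar>))) / (1 - exp (- (2 * \<kappa> * \<bar>p i - p k\<bar>))))" if "i \<in> S - {k}" for i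
      proof (cases "k < i")
        case True
        from p_less[OF True] less_le_trans[OF ij[OF True] g2(1)[OF True]] have "p k < p i" "s i \<ge> p k" by simp_all
        then show ?thesis
          using exp_sum_diff_ratio[of "2 * \<kappa> * p k" "2 * \<kappa> * p i" "2 * \<kappa> * s i" "2 * \<kappa> * p k"] True \<kappa>
          unfolding R_def x_def y_def \<delta>_def by (simp add: right_diff_distrib)
      next
        case False
        then have ik: "i < k" using that by auto
        from p_less[OF ik] less_le_trans[OF ij[OF ik] g2(2)[OF ik]] have "p i < p k" "p k \<ge> s i" by simp_all
        then show ?thesis
          using exp_sum_diff_ratio[of "2 * \<kappa> * p i" "2 * \<kappa> * p k" "2 * \<kappa> * p k" "2 * \<kappa> * s i"] False \<kappa>
          unfolding R_def x_def y_def by (simp add: right_diff_distrib add.commute abs_minus_commute)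
      qed
      have U: "\<bar>real_of_int (i - k)\<bar> / 2 \<le> \<bar>s i - p k\<bar>" if "i \<in> S - {k}" for i
        using g2[of i k] g2[of k i] that by (intro abs_half_gap) auto
      have V: "\<bar>real_of_int (i - k)\<bar> / 2 \<le> \<bar>p i - p k\<bar>" if "i \<in> S - {k}" for i
        using g1[of i k] g1[of k i] that by (intro abs_half_gap) auto
      from prod_ratio_le[OF \<kappa> S R U V] show ?thesis
        unfolding filter_sum[OF kS] corr_def by (simp only: sum_distrib_left sum_negf)
    qed
    have prodQ: "(\<Prod>i\<in>S - {j}. Q i) \<le> exp (- (2 * \<kappa> * (\<Sum>i\<in>{j<..hi}. \<delta> i))) * corr"
    proof -
      have R: "Q i = exp (if j < i then - (2 * \<kappa> * \<delta> i) else 0) * ((1 + exp (- (2 * \<kappa> * \<bar>s j - p i\<bar>))) / (1 - exp (- (2 * \<kappa> * \<bar>s j - s i\<bar>))))" if "i \<in> S - {j}" for i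
      proof (cases "j < i")
        case True
        from s_less[OF True] less_le_trans[OF ij[OF True] g2(2)[OF True]] have "s j < s i" "p i \<ge> s j" by simp_all
        then show ?thesis
          using exp_sum_diff_ratio[of "2 * \<kappa> * s j" "2 * \<kappa> * s i" "2 * \<kappa> * p i" "2 * \<kappa> * s j"] True \<kappa>
          unfolding Q_def x_def y_def \<delta>_def by (simp add: right_diff_distrib add.commute abs_minus_commute)
      next
        case False
        then have ik: "i < j" using that by auto
        from s_less[OF ik] less_le_trans[OF ij[OF ik] g2(1)[OF ik]] have "s i < s j" "s j \<ge> p i" by simp_all
        then show ?thesis
          using exp_sum_diff_ratio[of "2 * \<kappa> * s i" "2 * \<kappa> * s j" "2 * \<kappa> * s j" "2 * \<kappa> * p i"] False \<kappa>
          unfolding Q_def x_def y_def by (simp add: right_diff_distrib)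
      qed
      have U: "\<bar>real_of_int (i - j)\<bar> / 2 \<le> \<bar>s j - p i\<bar>" if "i \<in> S - {j}" for i
        using g2[of i j] g2[of j i] that by (subst abs_minus_commute) (intro abs_half_gap, auto)
      have V: "\<bar>real_of_int (i - j)\<bar> / 2 \<le> \<bar>s j - s i\<bar>" if "i \<in> S - {j}" for i
        using g4[of i j] g4[of j i] that by (subst abs_minus_commute) (intro abs_half_gap, auto)
      from prod_ratio_le[OF \<kappa> S R U V] show ?thesis
        unfolding filter_sum[OF jS] corr_def by (simp only: sum_distrib_left sum_negf)
    qed
    have nn: "0 \<le> (\<Prod>i\<in>S - {k}. R i)" "0 \<le> (\<Prod>i\<in>S - {j}. Q i)"
      unfolding R_def Q_def by (intro prod_nonneg divide_nonneg_nonneg add_nonneg_nonneg abs_ge_zero less_imp_le[OF pos(1)] less_imp_le[OF pos(2)])+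
    have "\<bar>K k j\<bar> \<le> ((1 + exp \<kappa>)\<^sup>2 / 2 * exp (- \<kappa> * \<bar>s j - p k\<bar>)) *
       (exp (2 * \<kappa> * (\<Sum>i\<in>{k<..hi}. \<delta> i)) * corr) * (exp (- (2 * \<kappa> * (\<Sum>i\<in>{j<..hi}. \<delta> i))) * corr)"
      unfolding absK by (intro mult_mono pre prodR prodQ nn mult_nonneg_nonneg) (auto simp: corr_def)
    also have "\<dots> = (1 + exp \<kappa>)\<^sup>2 / 2 * exp (- \<kappa> * \<bar>s j - p k\<bar>) * corr\<^sup>2 *
      exp (2 * \<kappa> * ((\<Sum>i\<in>{k<..hi}. \<delta> i) - (\<Sum>i\<in>{j<..hi}. \<delta> i)))"
      by (simp add: right_diff_distrib exp_diff exp_minus power2_eq_square field_simps)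
    finally show ?thesis .
  qed
  have const: "(1 + exp \<kappa>)\<^sup>2 / 2 * exp (- \<kappa> * \<bar>s j - p k\<bar>) * corr\<^sup>2 * exp (2 * \<kappa> * D) \<le>
      sech_inverse_const \<kappa> * exp (- 2 * \<kappa> * E)" if "- \<bar>s j - p k\<bar> + 2 * D \<le> 1/2 - 2 * E" for j k D E
  proof -
    have "\<kappa> * (- \<bar>s j - p k\<bar> + 2 * D) \<le> \<kappa> * (1/2 - 2 * E)"
      using that \<kappa> by (intro mult_left_mono) auto
    then have "exp (- \<kappa> * \<bar>s j - p k\<bar>) * exp (2 * \<kappa> * D) \<le> exp (\<kappa> / 2) * exp (- 2 * \<kappa> * E)"
      unfolding exp_add[symmetric] by (simp add: algebra_simps)
    then have "((1 + exp \<kappa>)\<^sup>2 / 2 * corr\<^sup>2) * (exp (- \<kappa> * \<bar>s j - p k\<bar>) * exp (2 * \<kappa> * D)) \<le>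
       ((1 + exp \<kappa>)\<^sup>2 / 2 * corr\<^sup>2) * (exp (\<kappa> / 2) * exp (- 2 * \<kappa> * E))"
      by (intro mult_left_mono) auto
    then show ?thesis unfolding sech_inverse_const_def corr_def by (simp add: mult_ac)
  qed
  \<comment> \<open>The parts of both sums beyond the larger index cancel, so the bound no longer
    sees the right end of the window.\<close>
  have split_sum: "(\<Sum>i\<in>{k<..hi}. \<delta> i) - (\<Sum>i\<in>{j<..hi}. \<delta> i) = (\<Sum>i\<in>{k<..j}. \<delta> i)"
    if "k \<le> j" "j \<le> hi" for k j
  proof -
    have "{k<..hi} = {k<..j} \<union> {j<..hi}" using that by auto
    then show ?thesis by (simp add: sum.union_disjoint)
  qed
  show ?thesis
  proof (rule that[of K])
    fix k l assume "k \<in> {lo..hi}" "l \<in> {lo..hi}"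
    then show "(\<Sum>j\<in>{lo..hi}. K k j * sech (\<kappa> * (s j - p l))) = (if k = l then 1 else 0)"
      using inv unfolding S_def by blast
  next
    fix k j assume kj: "k \<in> {lo..hi}" "j \<in> {lo..hi}" "k \<le> j"
    have "(\<Sum>i\<in>{k<..j}. T / 2 - (s i - p i)) = T / 2 * of_int (j - k) - (\<Sum>i\<in>{k<..j}. \<delta> i)"
      using kj by (simp add: sum_subtractf \<delta>_def)
    moreover have "- \<bar>s j - p k\<bar> \<le> 1/2 - T * of_int (j - k)"
      using near[of j] \<alpha> unfolding g1'[symmetric] by argo
    ultimately have "- \<bar>s j - p k\<bar> + 2 * (\<Sum>i\<in>{k<..j}. \<delta> i) \<le> 1/2 - 2 * (\<Sum>i\<in>{k<..j}. T / 2 - (s i - p i))"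
      by (simp add: field_simps)
    note c = const[OF this]
    have "sum \<delta> {k<..hi} - sum \<delta> {j<..hi} = sum \<delta> {k<..j}"
      using kj by (intro split_sum) auto
    then have "\<bar>K k j\<bar> \<le> (1 + exp \<kappa>)\<^sup>2 / 2 * exp (- \<kappa> * \<bar>s j - p k\<bar>) * corr\<^sup>2 *
        exp (2 * \<kappa> * sum \<delta> {k<..j})"
      using bound[of k j] kj unfolding S_def by (simp only:)
    then show "\<bar>K k j\<bar> \<le> sech_inverse_const \<kappa> * exp (- 2 * \<kappa> * (\<Sum>i\<in>{k<..j}. T / 2 - (s i - p i)))"
      using c by (rule order_trans)
  next
    fix k j assume kj: "k \<in> {lo..hi}" "j \<in> {lo..hi}" "j \<le> k"
    have "(\<Sum>i\<in>{j<..k}. T / 2 + (s i - p i)) = T / 2 * of_int (k - j) + (\<Sum>i\<in>{j<..k}. \<delta> i)"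
      using kj by (simp add: sum.distrib \<delta>_def)
    moreover have "- \<bar>s j - p k\<bar> \<le> 1/2 - T * of_int (k - j)"
      using near[of j] \<alpha> unfolding g1'[symmetric] by argo
    ultimately have "- \<bar>s j - p k\<bar> + 2 * - (\<Sum>i\<in>{j<..k}. \<delta> i) \<le> 1/2 - 2 * (\<Sum>i\<in>{j<..k}. T / 2 + (s i - p i))"
      by (simp add: field_simps)
    note c = const[OF this]
    have "sum \<delta> {j<..hi} - sum \<delta> {k<..hi} = sum \<delta> {j<..k}"
      using kj by (intro split_sum) auto
    then have "sum \<delta> {k<..hi} - sum \<delta> {j<..hi} = - sum \<delta> {j<..k}" by linarith
    then have "\<bar>K k j\<bar> \<le> (1 + exp \<kappa>)\<^sup>2 / 2 * exp (- \<kappa> * \<bar>s j - p k\<bar>) * corr\<^sup>2 *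
        exp (2 * \<kappa> * - sum \<delta> {j<..k})"
      using bound[of k j] kj unfolding S_def by (simp only:)
    then show "\<bar>K k j\<bar> \<le> sech_inverse_const \<kappa> * exp (- 2 * \<kappa> * (\<Sum>i\<in>{j<..k}. T / 2 + (s i - p i)))"
      using c by (rule order_trans)
  qed
qed

subsection \<open>Fibre bounds for the hyperbolic secant\<close>

text \<open>Write d = T - \<alpha>. The offsets at distance q differ by -q d plus a multiple z of
  \<alpha>. If z <= 0 the second offset is lower by at least q d; if z >= 1 it is higher by at least
  \<alpha> - q d >= q d. Either way the two cannot both be close to the same end of
  [-\<alpha>/2, \<alpha>/2].\<close>

lemma drift_pair_sum_ge:
  fixes T \<alpha> t :: real and f :: "int \<Rightarrow> int" and q :: nat
  defines "\<delta> \<equiv> \<lambda>i. \<alpha> * of_int (f i) - (t + T * of_int i)"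
  assumes \<alpha>: "0 < \<alpha>" "\<alpha> \<le> T" and near: "\<And>i. \<bar>\<delta> i\<bar> \<le> \<alpha> / 2"
    and q: "real q * (T - \<alpha>) \<le> \<alpha> / 2"
  shows "real q * (T - \<alpha>) \<le> (T / 2 - \<delta> i) + (T / 2 - \<delta> (i + int q))"
    and "real q * (T - \<alpha>) \<le> (T / 2 + \<delta> i) + (T / 2 + \<delta> (i + int q))"
proof -
  define z where "z = f (i + int q) - f i - int q"
  have eq: "\<delta> (i + int q) = \<delta> i - real q * (T - \<alpha>) + \<alpha> * of_int z"
    unfolding \<delta>_def z_def by (simp add: algebra_simps)
  have "\<alpha> * of_int z \<le> 0 \<or> \<alpha> \<le> \<alpha> * of_int z"
  proof (cases "z \<le> 0")
    case True then show ?thesis using \<alpha> by (simp add: mult_le_0_iff)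
  next
    case False
    then have "1 \<le> real_of_int z" by linarith
    then show ?thesis using \<alpha> by simp
  qed
  note near[of i] near[of "i + int q"]
  then show "real q * (T - \<alpha>) \<le> (T / 2 - \<delta> i) + (T / 2 - \<delta> (i + int q))"
    and "real q * (T - \<alpha>) \<le> (T / 2 + \<delta> i) + (T / 2 + \<delta> (i + int q))"
    using eq q \<alpha> \<open>_ \<or> _\<close> by argo+
qed

text \<open>For d > 0, the smallest q with q^2 d >= 1: q pairs of indices at distance q, each worth
  q d, then contribute at least 1. The tent of the test function uses the same length.\<close>

definition block_length :: "real \<Rightarrow> nat" where
  "block_length d = nat \<lceil>1 / sqrt d\<rceil>"

lemma block_length_bounds:
  assumes "0 < d"
  shows "1 / sqrt d \<le> real (block_length d)" "real (block_length d) \<le> 1 / sqrt d + 1" "1 \<le> block_length d"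
proof -
  have pos: "1 / sqrt d > 0" using assms by simp
  show 1: "1 / sqrt d \<le> real (block_length d)" unfolding block_length_def using pos by linarith
  show "real (block_length d) \<le> 1 / sqrt d + 1" unfolding block_length_def using pos by linarith
  show "1 \<le> block_length d" using 1 pos by (cases "block_length d") auto
qed

lemma drift_block_sum_ge:
  fixes T \<alpha> t :: real and f :: "int \<Rightarrow> int" and w :: "int \<Rightarrow> real"
  defines "\<delta> \<equiv> \<lambda>i. \<alpha> * of_int (f i) - (t + T * of_int i)"
  assumes \<alpha>: "1 / 2 \<le> \<alpha>" "\<alpha> < T" and near: "\<And>i. \<bar>\<delta> i\<bar> \<le> \<alpha> / 2"
    and w: "w = (\<lambda>i. T / 2 - \<delta> i) \<or> w = (\<lambda>i. T / 2 + \<delta> i)"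
  defines "q \<equiv> block_length (T - \<alpha>)"
  shows "1 / 6 \<le> sum w {i<..i + int (2 * q)}"
proof -
  define d where "d = T - \<alpha>"
  have d: "d > 0" using \<alpha> by (simp add: d_def)
  have q1: "1 / sqrt d \<le> real q" "real q \<le> 1 / sqrt d + 1"
    using block_length_bounds[OF d] by (simp_all add: q_def d_def)
  have sd: "sqrt d > 0" "sqrt d * sqrt d = d" using d by simp_all
  have qs: "1 \<le> real q * sqrt d" using mult_right_mono[OF q1(1), of "sqrt d"] sd by simp
  have qd: "sqrt d \<le> real q * d"
  proof -
    have "1 * sqrt d \<le> (real q * sqrt d) * sqrt d" using qs sd by (intro mult_right_mono) auto
    then show ?thesis using sd by (simp add: mult.assoc)
  qed
  \<comment> \<open>The threshold 1/36 gives q d <= sqrt d + d <= 1/6 + 1/36 <= 1/4 <= \<alpha>/2,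
    which the pairing argument needs; pairing then yields at least 1. For larger d each weight is at
    least d/2, and 2q of them give q d >= sqrt d >= 1/6.\<close>
  show ?thesis
  proof (cases "d \<le> 1 / 36")
    case True
    have "sqrt d \<le> sqrt ((1/6)\<^sup>2)" using True by (intro real_sqrt_le_mono) (simp add: power2_eq_square)
    then have s6: "sqrt d \<le> 1/6" by simp
    have "real q * d \<le> (1 / sqrt d + 1) * d" using q1 d by (intro mult_right_mono) auto
    also have "\<dots> = sqrt d + d" using sd by (simp add: distrib_right real_div_sqrt)
    also have "\<dots> \<le> 1 / 4" using s6 True by argo
    also have "\<dots> \<le> \<alpha> / 2" using \<alpha> by argo
    finally have qa: "real q * (T - \<alpha>) \<le> \<alpha> / 2" by (simp add: d_def)
    have a0: "0 < \<alpha>" "\<alpha> \<le> T" using \<alpha> by linarith+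
    have pair: "real q * d \<le> w l + w (l + int q)" for l
      using drift_pair_sum_ge[where f = f and t = t, OF a0 near[unfolded \<delta>_def] qa, of l] w
      unfolding \<delta>_def d_def by (elim disjE) simp_all
    have un: "{i<..i + int (2 * q)} = {i<..i + int q} \<union> {i + int q<..i + int q + int q}" by auto
    have img: "(+) (int q) ` {i<..i + int q} = {i + int q<..i + int q + int q}"
      by (simp only: image_add_greaterThanAtMost add_ac)
    have "sum w {i + int q<..i + int q + int q} = (\<Sum>l\<in>{i<..i + int q}. w (l + int q))"
      unfolding img[symmetric] by (subst sum.reindex) (simp_all add: o_def add.commute)
    then have "sum w {i<..i + int (2 * q)} = (\<Sum>l\<in>{i<..i + int q}. w l + w (l + int q))"
      unfolding un by (subst sum.union_disjoint) (auto simp: sum.distrib)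
    moreover have "(\<Sum>l\<in>{i<..i + int q}. real q * d) \<le> (\<Sum>l\<in>{i<..i + int q}. w l + w (l + int q))"
      by (intro sum_mono pair)
    moreover have "(\<Sum>l\<in>{i<..i + int q}. real q * d) = (real q * sqrt d) * (real q * sqrt d)"
      using sd by (simp add: mult_ac)
    moreover have "1 * 1 \<le> (real q * sqrt d) * (real q * sqrt d)" using qs by (intro mult_mono) auto
    ultimately show ?thesis by linarith
  next
    case False
    have "sqrt ((1/6)\<^sup>2) \<le> sqrt d" using False by (intro real_sqrt_le_mono) (simp add: power2_eq_square)
    then have s6: "1/6 \<le> sqrt d" by simp
    have "d / 2 \<le> w l" for l using near[of l] w \<alpha> unfolding d_def by (elim disjE; simp; argo)
    then have "(\<Sum>l\<in>{i<..i + int (2 * q)}. d / 2) \<le> sum w {i<..i + int (2 * q)}" by (intro sum_mono)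
    moreover have "(\<Sum>l\<in>{i<..i + int (2 * q)}. d / 2) = real q * d" by simp
    ultimately show ?thesis using qd s6 by linarith
  qed
qed

lemma drift_sum_ge:
  fixes T \<alpha> t :: real and f :: "int \<Rightarrow> int" and w :: "int \<Rightarrow> real"
  defines "\<delta> \<equiv> \<lambda>i. \<alpha> * of_int (f i) - (t + T * of_int i)"
  assumes \<alpha>: "1 / 2 \<le> \<alpha>" "\<alpha> < T" and near: "\<And>i. \<bar>\<delta> i\<bar> \<le> \<alpha> / 2"
    and w: "w = (\<lambda>i. T / 2 - \<delta> i) \<or> w = (\<lambda>i. T / 2 + \<delta> i)"
    and ij: "i \<le> j"
  defines "q \<equiv> block_length (T - \<alpha>)"
  shows "of_int (j - i) / (12 * real q) - 1/6 \<le> sum w {i<..j}"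
proof -
  have q: "q \<ge> 1" using block_length_bounds(3)[of "T - \<alpha>"] \<alpha> by (simp add: q_def)
  have w0: "0 \<le> w l" for l using near[of l] w \<alpha> by (elim disjE; simp; argo)
  have "1 / 6 * (real (nat (j - i)) / real (2 * q) - 1) \<le> sum w {i<..i + int (nat (j - i))}"
  proof (rule sum_ge_of_block_sums)
    show "1 / 6 \<le> sum w {l<..l + int (2 * q)}" for l
      unfolding q_def by (rule drift_block_sum_ge[where f = f and t = t]) (use \<alpha> near w in \<open>auto simp: \<delta>_def\<close>)
  qed (use w0 q in auto)
  moreover have "1 / 6 * (real (nat (j - i)) / real (2 * q) - 1) = of_int (j - i) / (12 * real q) - 1/6"
    using ij q by (simp add: field_simps)
  ultimately show ?thesis using ij by simp
qed

text \<open>Discarding all m except the nearest samples lowers the right side and leaves a square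
  system, inverted with Schur norm of order q. \<open>F\<close> may be any finite superset of those
  samples, so that one \<open>F\<close> can serve every fibre when the estimate is integrated over
  t.\<close>

theorem sech_fibre_lower_bound:
  fixes \<kappa> T \<alpha> t :: real and c :: "int \<Rightarrow> complex" and lo hi :: int
  assumes \<kappa>: "\<kappa> > 0" and \<alpha>: "1/2 \<le> \<alpha>" "\<alpha> \<le> 1" and T: "1 \<le> T" "\<alpha> < T"
  defines "q \<equiv> block_length (T - \<alpha>)"
  assumes F: "finite F" "(\<lambda>j. round ((t + T * of_int j) / \<alpha>)) ` {lo..hi} \<subseteq> F"
  shows "(\<Sum>k\<in>{lo..hi}. (cmod (c k))\<^sup>2) \<le>
     (sech_inverse_const \<kappa> * exp (\<kappa> / 3) * (1 + 12 * real q / \<kappa>))\<^sup>2 *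
     (\<Sum>m\<in>F. (cmod (\<Sum>k\<in>{lo..hi}. c k * of_real (sech (\<kappa> * (t + T * of_int k - \<alpha> * of_int m)))))\<^sup>2)"
proof -
  define f :: "int \<Rightarrow> int" where "f = (\<lambda>j. round ((t + T * of_int j) / \<alpha>))"
  define R where "R = sech_inverse_const \<kappa> * exp (\<kappa> / 3) * (1 + 12 * real q / \<kappa>)"
  define H where "H = (\<lambda>m. \<Sum>k\<in>{lo..hi}. c k * of_real (sech (\<kappa> * (t + T * of_int k - \<alpha> * of_int m))))"
  have a0: "0 < \<alpha>" using \<alpha> by linarith
  have near: "\<bar>\<alpha> * of_int (f i) - (t + T * of_int i)\<bar> \<le> \<alpha> / 2" for i
  proof -
    have "\<bar>\<alpha> * of_int (f i) - (t + T * of_int i)\<bar> = \<alpha> * \<bar>of_int (f i) - (t + T * of_int i) / \<alpha>\<bar>"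
      using a0 by (simp add: abs_mult_pos' field_simps)
    also have "\<dots> \<le> \<alpha> * (1 / 2)"
      unfolding f_def using a0 by (intro mult_left_mono of_int_round_abs_le) auto
    finally show ?thesis by simp
  qed
  \<comment> \<open>Equal samples for neighbouring points would force T <= \<alpha>. Here \<alpha> <
    T makes the nodes distinct and the matrix invertible.\<close>
  have fstep: "f i + 1 \<le> f (i + 1)" for i
  proof -
    have "T \<le> \<alpha> * of_int (f (i + 1)) - \<alpha> * of_int (f i) + \<alpha>"
      using near[of i] near[of "i + 1"] by (simp add: distrib_left abs_le_iff) argo
    then have "0 < \<alpha> * of_int (f (i + 1) - f i)" using T by (simp add: right_diff_distrib)
    then have "0 < f (i + 1) - f i" using a0 by (simp add: zero_less_mult_iff)
    then show ?thesis by simp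
  qed
  have q: "q \<ge> 1" using block_length_bounds(3)[of "T - \<alpha>"] T by (simp add: q_def)
  have C: "0 \<le> sech_inverse_const \<kappa>" unfolding sech_inverse_const_def by simp
  obtain K :: "int \<Rightarrow> int \<Rightarrow> real" where
    inv: "\<And>k l. k \<in> {lo..hi} \<Longrightarrow> l \<in> {lo..hi} \<Longrightarrow>
      (\<Sum>j\<in>{lo..hi}. K k j * sech (\<kappa> * (\<alpha> * of_int (f j) - (t + T * of_int l)))) = (if k = l then 1 else 0)"
    and up: "\<And>k j. k \<in> {lo..hi} \<Longrightarrow> j \<in> {lo..hi} \<Longrightarrow> k \<le> j \<Longrightarrow>
      \<bar>K k j\<bar> \<le> sech_inverse_const \<kappa> * exp (- 2 * \<kappa> * (\<Sum>i\<in>{k<..j}. T / 2 - (\<alpha> * of_int (f i) - (t + T * of_int i))))"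
    and down: "\<And>k j. k \<in> {lo..hi} \<Longrightarrow> j \<in> {lo..hi} \<Longrightarrow> j \<le> k \<Longrightarrow>
      \<bar>K k j\<bar> \<le> sech_inverse_const \<kappa> * exp (- 2 * \<kappa> * (\<Sum>i\<in>{j<..k}. T / 2 + (\<alpha> * of_int (f i) - (t + T * of_int i))))"
    by (rule sech_matrix_left_inverse[OF \<kappa> \<alpha> T(1) fstep near, of lo hi]) blast
  \<comment> \<open>The decay rate per index: 2\<kappa> times the slope 1/(12 q) from
    \<open>drift_sum_ge\<close>. The loss 1/6 there becomes the factor exp (\<kappa>/3), and 1 +
    2/\<theta> becomes 1 + 12 q/\<kappa>.\<close>
  define \<theta> where "\<theta> = \<kappa> / (6 * real q)"
  have \<theta>: "\<theta> > 0" using \<kappa> q by (simp add: \<theta>_def)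
  have ex: "exp (- 2 * \<kappa> * S) \<le> exp (\<kappa> / 3) * exp (- \<theta> * of_int n)"
    if "of_int n / (12 * real q) - 1/6 \<le> S" for S n
  proof -
    have "2 * \<kappa> * (of_int n / (12 * real q) - 1/6) \<le> 2 * \<kappa> * S"
      using that \<kappa> by (intro mult_left_mono) auto
    moreover have "2 * \<kappa> * (of_int n / (12 * real q) - 1/6) = \<theta> * of_int n - \<kappa> / 3"
      by (simp add: \<theta>_def right_diff_distrib)
    ultimately have "- 2 * \<kappa> * S \<le> \<kappa> / 3 + - \<theta> * of_int n" by simp
    then show ?thesis unfolding exp_add[symmetric] by simp
  qed
  have Kb: "\<bar>K k j\<bar> \<le> sech_inverse_const \<kappa> * exp (\<kappa> / 3) * exp (- \<theta> * \<bar>of_int (j - k)\<bar>)"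
    if kj: "k \<in> {lo..hi}" "j \<in> {lo..hi}" for k j
  proof (cases "k \<le> j")
    case True
    have "of_int (j - k) / (12 * real q) - 1/6 \<le> (\<Sum>i\<in>{k<..j}. T / 2 - (\<alpha> * of_int (f i) - (t + T * of_int i)))"
      unfolding q_def by (rule drift_sum_ge[where f = f and t = t]) (use \<alpha> T near True in auto)
    from mult_left_mono[OF ex[OF this] C] up[OF kj True] True show ?thesis
      by (simp add: mult.assoc)
  next
    case False
    then have jk: "j \<le> k" by simp
    have "of_int (k - j) / (12 * real q) - 1/6 \<le> (\<Sum>i\<in>{j<..k}. T / 2 + (\<alpha> * of_int (f i) - (t + T * of_int i)))"
      unfolding q_def by (rule drift_sum_ge[where f = f and t = t]) (use \<alpha> T near jk in auto)
    from mult_left_mono[OF ex[OF this] C] down[OF kj jk] jk show ?thesis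
      by (simp add: mult.assoc)
  qed
  have tot: "sech_inverse_const \<kappa> * exp (\<kappa> / 3) * (1 + 2 / \<theta>) = R"
    using q \<kappa> by (simp add: R_def \<theta>_def)
  have row: "(\<Sum>j\<in>{lo..hi}. \<bar>K k j\<bar>) \<le> R" if k: "k \<in> {lo..hi}" for k
  proof -
    have "(\<Sum>j\<in>{lo..hi}. \<bar>K k j\<bar>) \<le> (\<Sum>j\<in>{lo..hi}. sech_inverse_const \<kappa> * exp (\<kappa> / 3) * exp (- \<theta> * \<bar>of_int (j - k)\<bar>))"
      by (intro sum_mono Kb k)
    also have "\<dots> \<le> sech_inverse_const \<kappa> * exp (\<kappa> / 3) * (1 + 2 / \<theta>)"
      unfolding sum_distrib_left[symmetric] using C by (intro mult_left_mono sum_exp_abs_int_le \<theta>) auto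
    finally show ?thesis unfolding tot .
  qed
  have col: "(\<Sum>k\<in>{lo..hi}. \<bar>K k j\<bar>) \<le> R" if j: "j \<in> {lo..hi}" for j
  proof -
    have "(\<Sum>k\<in>{lo..hi}. \<bar>K k j\<bar>) \<le> (\<Sum>k\<in>{lo..hi}. sech_inverse_const \<kappa> * exp (\<kappa> / 3) * exp (- \<theta> * \<bar>of_int (j - k)\<bar>))"
      by (intro sum_mono Kb j)
    also have "\<dots> = (\<Sum>k\<in>{lo..hi}. sech_inverse_const \<kappa> * exp (\<kappa> / 3) * exp (- \<theta> * \<bar>of_int (k - j)\<bar>))"
      by (simp only: of_int_diff abs_minus_commute)
    also have "\<dots> \<le> sech_inverse_const \<kappa> * exp (\<kappa> / 3) * (1 + 2 / \<theta>)"
      unfolding sum_distrib_left[symmetric] using C by (intro mult_left_mono sum_exp_abs_int_le \<theta>) auto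
    finally show ?thesis unfolding tot .
  qed
  have R: "R \<ge> 0" unfolding R_def using C \<kappa> by (intro mult_nonneg_nonneg) auto
  have rec: "c k = (\<Sum>j\<in>{lo..hi}. H (f j) * of_real (K k j))" if k: "k \<in> {lo..hi}" for k
  proof -
    have g: "sech (\<kappa> * (t + T * of_int l - \<alpha> * of_int (f j))) =
        sech (\<kappa> * (\<alpha> * of_int (f j) - (t + T * of_int l)))" for l j
      by (metis cosh_minus minus_diff_eq mult_minus_right)
    have "(\<Sum>j\<in>{lo..hi}. H (f j) * of_real (K k j)) =
        (\<Sum>j\<in>{lo..hi}. \<Sum>l\<in>{lo..hi}. c l * of_real (K k j * sech (\<kappa> * (\<alpha> * of_int (f j) - (t + T * of_int l)))))"
      unfolding H_def g by (simp add: sum_distrib_right sum_distrib_left mult_ac)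
    also have "\<dots> = (\<Sum>l\<in>{lo..hi}. c l * of_real (\<Sum>j\<in>{lo..hi}. K k j * sech (\<kappa> * (\<alpha> * of_int (f j) - (t + T * of_int l)))))"
      by (subst sum.swap) (simp only: of_real_sum sum_distrib_left)
    also have "\<dots> = (\<Sum>l\<in>{lo..hi}. c l * of_real (if k = l then 1 else 0))"
      by (intro sum.cong refl) (simp only: inv[OF k])
    also have "\<dots> = c k + (\<Sum>l\<in>{lo..hi} - {k}. c l * of_real (if k = l then 1 else 0))"
      by (subst sum.remove[OF _ k]) simp_all
    also have "(\<Sum>l\<in>{lo..hi} - {k}. c l * of_real (if k = l then 1 else 0)) = 0"
      by (rule sum.neutral) auto
    finally show ?thesis by simp
  qed
  have "(\<Sum>k\<in>{lo..hi}. (cmod (c k))\<^sup>2) = (\<Sum>k\<in>{lo..hi}. (cmod (\<Sum>j\<in>{lo..hi}. H (f j) * of_real (K k j)))\<^sup>2)"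
    by (intro sum.cong refl) (simp only: rec[symmetric])
  also have "\<dots> \<le> R * R * (\<Sum>j\<in>{lo..hi}. (cmod (H (f j)))\<^sup>2)"
    by (rule schur_test) (use R row col in auto)
  also have "(\<Sum>j\<in>{lo..hi}. (cmod (H (f j)))\<^sup>2) = (\<Sum>m\<in>f ` {lo..hi}. (cmod (H m))\<^sup>2)"
  proof (subst sum.reindex)
    have "f i < f j" if "i < j" for i j using int_fun_diff_ge[of f i j] fstep that by fastforce
    then show "inj_on f {lo..hi}" by (metis inj_onI linorder_neqE order_less_irrefl)
  qed simp
  also have "R * R * (\<Sum>m\<in>f ` {lo..hi}. (cmod (H m))\<^sup>2) \<le> R * R * (\<Sum>m\<in>F. (cmod (H m))\<^sup>2)"
    using F R by (intro mult_left_mono sum_mono2) (auto simp: f_def)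
  finally show ?thesis unfolding R_def H_def power2_eq_square[of "_ * _ * _"] .
qed

section \<open>Exponential majorant of the secant and the upper fibre bound\<close>

lemma sech_le: "sech u \<le> 2 * exp (- \<bar>u\<bar>)" for u :: real
proof -
  have "exp \<bar>u\<bar> \<le> 2 * cosh \<bar>u\<bar>" unfolding cosh_def by simp
  then have "exp \<bar>u\<bar> / 2 \<le> cosh u" by simp
  then have "sech u \<le> inverse (exp \<bar>u\<bar> / 2)" by (intro le_imp_inverse_le) auto
  then show ?thesis unfolding inverse_divide by (simp only: exp_minus divide_inverse)
qed

lemma sech_pos: "0 < sech u" for u :: real
  by (simp add: cosh_real_pos)

lemma sum_sech_progression_le:
  fixes \<kappa> b u :: real and F :: "int set"
  assumes "\<kappa> > 0" "b > 0" "finite F"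
  shows "(\<Sum>k\<in>F. sech (\<kappa> * (u + b * of_int k))) \<le> 2 * (exp (\<kappa> * b) * (1 + 2 / (\<kappa> * b)))"
proof -
  have "(\<Sum>k\<in>F. sech (\<kappa> * (u + b * of_int k))) \<le> (\<Sum>k\<in>F. 2 * exp (- \<kappa> * \<bar>u + b * of_int k\<bar>))"
  proof (rule sum_mono)
    fix k
    show "sech (\<kappa> * (u + b * of_int k)) \<le> 2 * exp (- \<kappa> * \<bar>u + b * of_int k\<bar>)"
      using sech_le[of "\<kappa> * (u + b * of_int k)"] assms(1) by (simp add: abs_mult)
  qed
  also have "\<dots> \<le> 2 * (exp (\<kappa> * b) * (1 + 2 / (\<kappa> * b)))"
    unfolding sum_distrib_left[symmetric] using sum_exp_abs_progression_le[OF assms] by (intro mult_left_mono) auto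
  finally show ?thesis .
qed

text \<open>Schur's test applied directly: rows sample sech along a progression of step T, columns
  along one of step \<alpha>. Both steps lie in [1/2, 2], which gives a common constant.\<close>

theorem sech_fibre_upper_bound:
  fixes \<kappa> T \<alpha> t :: real and c :: "int \<Rightarrow> complex"
  assumes \<kappa>: "\<kappa> > 0" and \<alpha>: "1/2 \<le> \<alpha>" "\<alpha> \<le> 1" and T: "1 \<le> T" "T \<le> 2" and fin: "finite F" "finite S"
  shows "(\<Sum>m\<in>F. (cmod (\<Sum>k\<in>S. c k * of_real (sech (\<kappa> * (t + T * of_int k - \<alpha> * of_int m)))))\<^sup>2)
    \<le> (2 * (exp (2 * \<kappa>) * (1 + 4 / \<kappa>)))\<^sup>2 * (\<Sum>k\<in>S. (cmod (c k))\<^sup>2)"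
proof -
  have le: "2 * (exp (\<kappa> * b) * (1 + 2 / (\<kappa> * b))) \<le> 2 * (exp (2 * \<kappa>) * (1 + 4 / \<kappa>))"
    if b: "1/2 \<le> b" "b \<le> 2" for b
  proof -
    have "2 / (\<kappa> * b) \<le> 2 / (\<kappa> * (1/2))" using \<kappa> b by (intro divide_left_mono mult_left_mono mult_pos_pos) auto
    then have "1 + 2 / (\<kappa> * b) \<le> 1 + 4 / \<kappa>" by simp
    moreover have "exp (\<kappa> * b) \<le> exp (2 * \<kappa>)" using \<kappa> b by simp
    ultimately show ?thesis using \<kappa> b by (intro mult_left_mono mult_mono) auto
  qed
  have row: "(\<Sum>k\<in>S. \<bar>sech (\<kappa> * (t + T * of_int k - \<alpha> * of_int m))\<bar>) \<le> 2 * (exp (2 * \<kappa>) * (1 + 4 / \<kappa>))" for m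
  proof -
    have "(\<Sum>k\<in>S. \<bar>sech (\<kappa> * (t + T * of_int k - \<alpha> * of_int m))\<bar>) =
        (\<Sum>k\<in>S. sech (\<kappa> * ((t - \<alpha> * of_int m) + T * of_int k)))"
      by (intro sum.cong refl) (simp add: abs_of_pos[OF sech_pos] algebra_simps)
    also have "\<dots> \<le> 2 * (exp (\<kappa> * T) * (1 + 2 / (\<kappa> * T)))"
      using \<kappa> T fin by (intro sum_sech_progression_le) auto
    finally show ?thesis using le[of T] T by simp
  qed
  have col: "(\<Sum>m\<in>F. \<bar>sech (\<kappa> * (t + T * of_int k - \<alpha> * of_int m))\<bar>) \<le> 2 * (exp (2 * \<kappa>) * (1 + 4 / \<kappa>))" for k
  proof -
    have "cosh (\<kappa> * (t + T * of_int k - \<alpha> * of_int m)) = cosh (\<kappa> * (- (t + T * of_int k) + \<alpha> * of_int m))" for m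
    proof -
      have "\<kappa> * (- (t + T * of_int k) + \<alpha> * of_int m) = - (\<kappa> * (t + T * of_int k - \<alpha> * of_int m))"
        by (simp add: algebra_simps)
      then show ?thesis by (simp only: cosh_minus)
    qed
    then have "(\<Sum>m\<in>F. \<bar>sech (\<kappa> * (t + T * of_int k - \<alpha> * of_int m))\<bar>) =
        (\<Sum>m\<in>F. sech (\<kappa> * (- (t + T * of_int k) + \<alpha> * of_int m)))"
      by (simp only: abs_of_pos[OF sech_pos])
    also have "\<dots> \<le> 2 * (exp (\<kappa> * \<alpha>) * (1 + 2 / (\<kappa> * \<alpha>)))"
      using \<kappa> \<alpha> fin by (intro sum_sech_progression_le) auto
    finally show ?thesis using le[of \<alpha>] \<alpha> by simp
  qed
  show ?thesis
    unfolding power2_eq_square[of "2 * _"]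
    by (rule schur_test) (use fin row col \<kappa> in auto)
qed

subsection \<open>From fibres to Gabor coefficients\<close>

text \<open>Folds the line onto one period. Compact support keeps the sum over cells finite, so no
  series has to be exchanged with an integral; general functions are reached by truncation.\<close>

lemma integral_eq_sum_translates:
  fixes \<phi> :: "real \<Rightarrow> 'a::{banach, second_countable_topology}"
  assumes T: "T > 0" and int: "integrable lborel \<phi>"
    and supp: "\<forall>t. \<phi> t \<noteq> 0 \<longrightarrow> - real N * T \<le> t \<and> t < real N * T"
  shows "(LINT t|lborel. \<phi> t) =
      (\<Sum>k\<in>window N. LINT t|period_measure T. \<phi> (t + T * of_int k))"
    and "\<And>k. integrable (period_measure T) (\<lambda>t. \<phi> (t + T * of_int k))"
proof -
  have [measurable]: "\<phi> \<in> borel_measurable borel" using int by auto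
  define I where "I = (\<lambda>k::int. {T * of_int k<..<T * (of_int k + 1)})"
  have [measurable]: "I k \<in> sets borel" for k by (simp add: I_def)
  have Ik: "integrable lborel (\<lambda>t. indicator (I k) t *\<^sub>R \<phi> t)" for k
    by (rule integrable_mult_indicator) (use int in auto)
  have tr: "indicator (I k) (T * of_int k + t) *\<^sub>R \<phi> (T * of_int k + t) =
      indicator {0<..<T} t *\<^sub>R \<phi> (t + T * of_int k)" for k t
    by (auto simp: I_def indicator_def algebra_simps)
  have Ik': "(LINT t|lborel. indicator (I k) t *\<^sub>R \<phi> t) = (LINT t|period_measure T. \<phi> (t + T * of_int k))" for k
  proof -
    have "(LINT t|lborel. indicator (I k) t *\<^sub>R \<phi> t) =
        (LINT t|lborel. indicator (I k) (T * of_int k + t) *\<^sub>R \<phi> (T * of_int k + t))"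
      by (subst lborel_integral_real_affine[of 1 _ "T * of_int k"]) simp_all
    then show ?thesis unfolding tr by (simp add: integral_period_measure)
  qed
  show "integrable (period_measure T) (\<lambda>t. \<phi> (t + T * of_int k))" for k
    using lborel_integrable_real_affine[OF Ik[of k], of 1 "T * of_int k"] tr
    by (simp add: integrable_period_measure)
  have "AE t in lborel. t \<notin> range (\<lambda>k::int. T * of_int k)"
    by (intro AE_not_in countable_imp_null_set_lborel) auto
  then have "AE t in lborel. \<phi> t = (\<Sum>k\<in>window N. indicator (I k) t *\<^sub>R \<phi> t)"
  proof eventually_elim
    case (elim t)
    show ?case
    proof (cases "\<phi> t = 0")
      case False
      define k where "k = \<lfloor>t / T\<rfloor>"
      have fl: "of_int k \<le> t / T" "t / T < of_int k + 1" unfolding k_def by linarith+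
      have k1: "T * of_int k \<le> t" "t < T * (of_int k + 1)"
        using fl T by (simp_all add: field_simps)
      moreover have "T * of_int k \<noteq> t" using elim by auto
      ultimately have tk: "t \<in> I k" by (simp add: I_def)
      have uniq: "l = k" if "t \<in> I l" for l
      proof -
        have "T * of_int l < T * (of_int k + 1)" "T * of_int k < T * (of_int l + 1)"
          using that tk unfolding I_def by auto
        then have "real_of_int l < of_int k + 1" "real_of_int k < of_int l + 1" using T by auto
        then show ?thesis by linarith
      qed
      have "- real N \<le> t / T" "t / T < real N" using supp False T by (simp_all add: field_simps)
      then have "k \<in> window N" unfolding k_def by (auto simp: le_floor_iff floor_less_iff)
      then have "(\<Sum>l\<in>window N. indicator (I l) t *\<^sub>R \<phi> t) =
          indicator (I k) t *\<^sub>R \<phi> t + (\<Sum>l\<in>window N - {k}. indicator (I l) t *\<^sub>R \<phi> t)"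
        by (intro sum.remove) auto
      also have "(\<Sum>l\<in>window N - {k}. indicator (I l) t *\<^sub>R \<phi> t) = 0"
        by (rule sum.neutral) (use uniq in \<open>auto simp: indicator_def\<close>)
      finally show ?thesis using tk by simp
    qed simp
  qed
  then have "(LINT t|lborel. \<phi> t) = (LINT t|lborel. (\<Sum>k\<in>window N. indicator (I k) t *\<^sub>R \<phi> t))"
    by (rule integral_cong_AE[rotated 2]) measurable
  also have "\<dots> = (\<Sum>k\<in>window N. LINT t|lborel. indicator (I k) t *\<^sub>R \<phi> t)"
    by (rule Bochner_Integration.integral_sum) (rule Ik)
  finally show "(LINT t|lborel. \<phi> t) =
      (\<Sum>k\<in>window N. LINT t|period_measure T. \<phi> (t + T * of_int k))"
    by (simp only: Ik')
qed

lemma integrable_sech_square: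
  fixes \<kappa> :: real
  assumes \<kappa>: "\<kappa> > 0"
  shows "integrable lborel (\<lambda>t. (sech (\<kappa> * t))\<^sup>2)"
proof -
  define F where "F = (\<lambda>t. tanh (\<kappa> * t) / \<kappa>)"
  have "set_integrable lborel (einterval (-\<infinity>) \<infinity>) (\<lambda>t. (sech (\<kappa> * t))\<^sup>2)"
  proof (rule interval_integral_FTC_nonneg(1))
    show "-\<infinity> < (\<infinity>::ereal)" by simp
    fix x :: real
    have "cosh (\<kappa> * x) \<noteq> 0" using cosh_real_pos[of "\<kappa> * x"] by linarith
    moreover have "1 - (tanh (\<kappa> * x))\<^sup>2 = ((cosh (\<kappa> * x))\<^sup>2 - (sinh (\<kappa> * x))\<^sup>2) / (cosh (\<kappa> * x))\<^sup>2"
      using \<open>cosh (\<kappa> * x) \<noteq> 0\<close> by (simp add: tanh_def power_divide diff_divide_distrib)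
    then have "1 - (tanh (\<kappa> * x))\<^sup>2 = (sech (\<kappa> * x))\<^sup>2"
      by (simp add: hyperbolic_pythagoras power_inverse divide_inverse)
    ultimately show "DERIV F x :> (sech (\<kappa> * x))\<^sup>2"
      unfolding F_def using \<kappa> by (auto intro!: derivative_eq_intros)
    show "isCont (\<lambda>t. (sech (\<kappa> * t))\<^sup>2) x"
      using \<open>cosh (\<kappa> * x) \<noteq> 0\<close> by (auto intro!: continuous_intros)
  next
    have "((\<lambda>t. tanh (\<kappa> * t) / \<kappa>) \<longlongrightarrow> 1 / \<kappa>) at_top"
      by (intro tendsto_divide filterlim_compose[OF tanh_real_at_top]
          filterlim_tendsto_pos_mult_at_top[OF tendsto_const \<kappa> filterlim_ident] tendsto_const) (use \<kappa> in auto)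
    then show "((F \<circ> real_of_ereal) \<longlongrightarrow> 1 / \<kappa>) (at_left \<infinity>)"
      by (simp add: ereal_tendsto_simps F_def)
    have "((\<lambda>t. tanh (\<kappa> * t) / \<kappa>) \<longlongrightarrow> - 1 / \<kappa>) at_bot"
      by (intro tendsto_divide filterlim_compose[OF tanh_real_at_bot]
          filterlim_tendsto_pos_mult_at_bot[OF tendsto_const \<kappa> filterlim_ident] tendsto_const) (use \<kappa> in auto)
    then show "((F \<circ> real_of_ereal) \<longlongrightarrow> - 1 / \<kappa>) (at_right (-\<infinity>))"
      by (simp add: ereal_tendsto_simps F_def)
  qed auto
  then show ?thesis by (simp add: set_integrable_def)
qed

section \<open>Gabor coefficients as Fourier coefficients of periodizations\<close>

definition gabor_coeff :: "real \<Rightarrow> real \<Rightarrow> (real \<Rightarrow> complex) \<Rightarrow> int \<Rightarrow> int \<Rightarrow> complex" where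
  "gabor_coeff \<gamma> a f m n = L2_inner f (tf_shift (a * of_int m, a * of_int n) (g1 \<gamma>))"

abbreviation coeff_energy :: "real \<Rightarrow> real \<Rightarrow> (real \<Rightarrow> complex) \<Rightarrow> (int \<times> int) set \<Rightarrow> real" where
  "coeff_energy \<gamma> a f F \<equiv> \<Sum>(m, n)\<in>F. (cmod (gabor_coeff \<gamma> a f m n))\<^sup>2"

text \<open>The bridge from the extended-valued sum to real arithmetic: from here on only finite
  sets of coefficients and real energies are estimated.\<close>

lemma gabor_sum_eq_SUP:
  assumes "a \<noteq> 0"
  shows "gabor_sum (g1 \<gamma>) (square_lattice a) f =
    (SUP F\<in>{F. finite F}. ennreal (coeff_energy \<gamma> a f F))"
proof -
  have lat: "square_lattice a = (\<lambda>(m, n). (a * of_int m, a * of_int n)) ` UNIV"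
    unfolding square_lattice_def by auto
  have inj: "inj (\<lambda>(m::int, n::int). (a * of_int m, a * of_int n))"
    using assms by (auto simp: inj_on_def)
  have "gabor_sum (g1 \<gamma>) (square_lattice a) f =
      (\<Sum>\<^sub>\<infinity>p. ennreal ((cmod (gabor_coeff \<gamma> a f (fst p) (snd p)))\<^sup>2))"
    unfolding gabor_sum_def lat by (subst infsum_reindex[OF inj]) (simp add: o_def case_prod_unfold gabor_coeff_def)
  also have "\<dots> = (SUP F\<in>{F. finite F}. \<Sum>p\<in>F. ennreal ((cmod (gabor_coeff \<gamma> a f (fst p) (snd p)))\<^sup>2))"
    by (subst nonneg_infsum_complete) auto
  finally show ?thesis by (simp add: case_prod_unfold sum_ennreal)
qed

lemma gabor_sum_leI:
  assumes "a \<noteq> 0" "\<And>F. finite F \<Longrightarrow> coeff_energy \<gamma> a f F \<le> r"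
  shows "gabor_sum (g1 \<gamma>) (square_lattice a) f \<le> ennreal r"
  unfolding gabor_sum_eq_SUP[OF assms(1)] using assms(2) by (auto intro!: SUP_least ennreal_leI)

lemma gabor_sum_ge:
  assumes "a \<noteq> 0" "finite F"
  shows "ennreal (coeff_energy \<gamma> a f F) \<le> gabor_sum (g1 \<gamma>) (square_lattice a) f"
  unfolding gabor_sum_eq_SUP[OF assms(1)] using assms(2) by (intro SUP_upper) auto

lemma L2_norm_square: "(L2_norm f)\<^sup>2 = (LINT t|lborel. (cmod (f t))\<^sup>2)"
  unfolding L2_norm_def by (simp add: integral_nonneg_AE)

lemma L2_measurable: "f \<in> L2 \<Longrightarrow> f \<in> borel_measurable borel"
  by (simp add: L2_def)

lemma L2_integrable: "f \<in> L2 \<Longrightarrow> integrable lborel (\<lambda>t. (cmod (f t))\<^sup>2)"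
  by (simp add: L2_def)

context
  fixes \<gamma> a :: real
  assumes \<gamma>: "\<gamma> > 0" and a: "1/2 < a" "a < 1"
begin

definition sech_at :: "int \<Rightarrow> real \<Rightarrow> real" where
  "sech_at m t = sech (pi * \<gamma> * (t - a * of_int m))"

lemma sech_at_measurable [measurable]: "sech_at m \<in> borel_measurable borel"
  unfolding sech_at_def
  by (intro borel_measurable_continuous_onI continuous_intros) (metis cosh_real_pos less_irrefl)

lemma sech_at_bounds: "0 < sech_at m t" "sech_at m t \<le> 1"
  unfolding sech_at_def using sech_pos cosh_real_ge_1 by (auto intro: inverse_le_1_iff[THEN iffD2])

text \<open>The modulation frequencies a n are exactly the Fourier frequencies of period 1/a. This
  is the reason for taking T = 1/a.\<close>

lemma gabor_coeff_eq:
  "gabor_coeff \<gamma> a f m n = (LINT t|lborel. f t * of_real (sech_at m t) * cnj (fourier_exp (1 / a) n t))"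
proof -
  have "exp (2 * complex_of_real pi * \<i> * complex_of_real (a * of_int n) * complex_of_real t) =
      fourier_exp (1 / a) n t" for t
    by (simp add: cis_conv_exp mult_ac)
  then show ?thesis
    unfolding gabor_coeff_def L2_inner_def tf_shift_def g1_def sech_at_def by (simp add: mult_ac)
qed

lemma sech_at_square_integrable: "integrable lborel (\<lambda>t. (sech_at m t)\<^sup>2)"
proof -
  have "integrable lborel (\<lambda>t. (sech (pi * \<gamma> * t))\<^sup>2)"
    using \<gamma> by (intro integrable_sech_square) simp
  from lborel_integrable_real_affine[OF this, of 1 "- (a * of_int m)"]
  show ?thesis unfolding sech_at_def by simp
qed

lemma L2_times_sech_integrable:
  assumes "f \<in> L2"
  shows "integrable lborel (\<lambda>t. cmod (f t) * sech_at m t)"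
proof (rule Bochner_Integration.integrable_bound[of _ "\<lambda>t. (cmod (f t))\<^sup>2 + (sech_at m t)\<^sup>2"])
  note [measurable] = L2_measurable[OF assms]
  show "integrable lborel (\<lambda>t. (cmod (f t))\<^sup>2 + (sech_at m t)\<^sup>2)"
    using L2_integrable[OF assms] sech_at_square_integrable by simp
  show "AE t in lborel. norm (cmod (f t) * sech_at m t) \<le> norm ((cmod (f t))\<^sup>2 + (sech_at m t)\<^sup>2)"
  proof (rule AE_I2)
    fix t
    have "cmod (f t) * sech_at m t \<le> 2 * cmod (f t) * sech_at m t"
      using sech_at_bounds(1)[of m t] by simp
    also have "\<dots> \<le> (cmod (f t))\<^sup>2 + (sech_at m t)\<^sup>2" by (rule sum_squares_bound)
    finally show "norm (cmod (f t) * sech_at m t) \<le> norm ((cmod (f t))\<^sup>2 + (sech_at m t)\<^sup>2)"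
      using sech_at_bounds(1)[of m t] by simp
  qed
  show "(\<lambda>t. cmod (f t) * sech_at m t) \<in> borel_measurable lborel" by measurable
qed

lemma gabor_integrand_integrable:
  assumes "f \<in> L2"
  shows "integrable lborel (\<lambda>t. f t * of_real (sech_at m t) * cnj (fourier_exp (1 / a) n t))"
proof (rule Bochner_Integration.integrable_bound[OF L2_times_sech_integrable[OF assms, of m]])
  note [measurable] = L2_measurable[OF assms]
  show "(\<lambda>t. f t * of_real (sech_at m t) * cnj (fourier_exp (1 / a) n t)) \<in> borel_measurable lborel"
    by measurable
qed (simp add: norm_mult abs_mult)

text \<open>The 1/a-periodization of f times the m-th translate of the generator, restricted to the
  cells of \<open>window N\<close>. It is the full periodization, up to null sets, when f is
  supported there; on the fibre of t it is the m-th entry of the secant matrix applied to the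
  samples of f.\<close>

definition periodized :: "nat \<Rightarrow> (real \<Rightarrow> complex) \<Rightarrow> int \<Rightarrow> real \<Rightarrow> complex" where
  "periodized N f m t = (\<Sum>k\<in>window N. f (t + 1 / a * of_int k) *
     of_real (sech (pi * \<gamma> * (t + 1 / a * of_int k - a * of_int m))))"

definition supported_in :: "nat \<Rightarrow> (real \<Rightarrow> complex) \<Rightarrow> bool" where
  "supported_in N f \<longleftrightarrow> (\<forall>t. f t \<noteq> 0 \<longrightarrow> - real N * (1 / a) \<le> t \<and> t < real N * (1 / a))"

definition upper_const :: real where
  "upper_const = (2 * (exp (2 * (pi * \<gamma>)) * (1 + 4 / (pi * \<gamma>))))\<^sup>2"

lemma upper_const_nonneg: "0 \<le> upper_const" by (simp add: upper_const_def)

lemma period_bounds: "0 < 1 / a" "1 \<le> 1 / a" "1 / a \<le> 2" "a < 1 / a"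
proof -
  show "0 < 1 / a" "1 \<le> 1 / a" "1 / a \<le> 2" using a by (auto simp: field_simps)
  then show "a < 1 / a" using a by linarith
qed

lemma periodized_upper:
  assumes "finite F"
  shows "(\<Sum>m\<in>F. (cmod (periodized N f m t))\<^sup>2) \<le>
    upper_const * (\<Sum>k\<in>window N. (cmod (f (t + 1 / a * of_int k)))\<^sup>2)"
  unfolding periodized_def upper_const_def
  by (rule sech_fibre_upper_bound) (use \<gamma> a period_bounds assms in auto)

lemma norm_square_periodized:
  assumes f: "f \<in> L2" and supp: "supported_in N f"
  shows "(L2_norm f)\<^sup>2 = (LINT t|period_measure (1 / a). (\<Sum>k\<in>window N. (cmod (f (t + 1 / a * of_int k)))\<^sup>2))"
    and "integrable (period_measure (1 / a)) (\<lambda>t. \<Sum>k\<in>window N. (cmod (f (t + 1 / a * of_int k)))\<^sup>2)"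
proof -
  note tr = integral_eq_sum_translates[of "1 / a" "\<lambda>t. (cmod (f t))\<^sup>2" N]
  have s: "\<forall>t. (cmod (f t))\<^sup>2 \<noteq> 0 \<longrightarrow> - real N * (1 / a) \<le> t \<and> t < real N * (1 / a)"
    using supp by (simp add: supported_in_def)
  have i: "integrable (period_measure (1 / a)) (\<lambda>t. (cmod (f (t + 1 / a * of_int k)))\<^sup>2)" for k :: int
    using tr(2)[OF period_bounds(1) L2_integrable[OF f] s] .
  then show "integrable (period_measure (1 / a)) (\<lambda>t. \<Sum>k\<in>window N. (cmod (f (t + 1 / a * of_int k)))\<^sup>2)"
    by (intro Bochner_Integration.integrable_sum)
  show "(L2_norm f)\<^sup>2 = (LINT t|period_measure (1 / a). (\<Sum>k\<in>window N. (cmod (f (t + 1 / a * of_int k)))\<^sup>2))"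
    unfolding L2_norm_square tr(1)[OF period_bounds(1) L2_integrable[OF f] s]
    by (rule Bochner_Integration.integral_sum[symmetric]) (rule i)
qed

lemma periodized_measurable [measurable]:
  assumes "f \<in> L2"
  shows "periodized N f m \<in> borel_measurable borel"
proof -
  note [measurable] = L2_measurable[OF assms]
  have [measurable]: "(\<lambda>t. sech (pi * \<gamma> * (t + 1 / a * of_int k - a * of_int m))) \<in> borel_measurable borel" for k :: int
    using measurable_compose[OF _ sech_at_measurable[of m], of "\<lambda>t. t + 1 / a * of_int k" borel]
    unfolding sech_at_def by measurable
  show ?thesis unfolding periodized_def by measurable
qed

lemma periodized_square_integrable:
  assumes f: "f \<in> L2" and supp: "supported_in N f"
  shows "integrable (period_measure (1 / a)) (\<lambda>t. (cmod (periodized N f m t))\<^sup>2)"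
proof (rule Bochner_Integration.integrable_bound)
  show "integrable (period_measure (1 / a))
     (\<lambda>t. upper_const * (\<Sum>k\<in>window N. (cmod (f (t + 1 / a * of_int k)))\<^sup>2))"
    using norm_square_periodized(2)[OF assms] by simp
  show "(\<lambda>t. (cmod (periodized N f m t))\<^sup>2) \<in> borel_measurable (period_measure (1 / a))"
    using periodized_measurable[OF f] by measurable
  show "AE t in period_measure (1 / a). norm ((cmod (periodized N f m t))\<^sup>2)
      \<le> norm (upper_const * (\<Sum>k\<in>window N. (cmod (f (t + 1 / a * of_int k)))\<^sup>2))"
    using periodized_upper[of "{m}" N f] by (auto intro: order_trans[OF _ abs_ge_self])
qed

lemma gabor_coeff_fourier:
  assumes f: "f \<in> L2" and supp: "supported_in N f"
  shows "gabor_coeff \<gamma> a f m n = (LINT t|period_measure (1 / a). periodized N f m t * cnj (fourier_exp (1 / a) n t))"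
proof -
  let ?\<phi> = "\<lambda>t. f t * of_real (sech_at m t) * cnj (fourier_exp (1 / a) n t)"
  have s: "\<forall>t. ?\<phi> t \<noteq> 0 \<longrightarrow> - real N * (1 / a) \<le> t \<and> t < real N * (1 / a)"
    using supp by (auto simp: supported_in_def)
  note tr = integral_eq_sum_translates[OF period_bounds(1) gabor_integrand_integrable[OF f, of m n] s]
  have per: "fourier_exp (1 / a) n (t + 1 / a * of_int k) = fourier_exp (1 / a) n t" for t and k :: int
  proof -
    have "2 * pi * of_int n * (t + 1 / a * of_int k) / (1 / a) = 2 * pi * of_int n * t / (1 / a) + 2 * pi * of_int (n * k)"
      using a by (simp add: field_simps)
    then show ?thesis by (simp only: cis_mult[symmetric]) (simp add: cis_multiple_2pi)
  qed
  have "gabor_coeff \<gamma> a f m n = (LINT t|period_measure (1 / a). (\<Sum>k\<in>window N. ?\<phi> (t + 1 / a * of_int k)))"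
    unfolding gabor_coeff_eq tr(1) by (rule Bochner_Integration.integral_sum[symmetric]) (rule tr(2))
  also have "\<dots> = (LINT t|period_measure (1 / a). periodized N f m t * cnj (fourier_exp (1 / a) n t))"
    unfolding per periodized_def sech_at_def sum_distrib_right ..
  finally show ?thesis .
qed

end

lemma gabor_coeff_diff:
  assumes \<gamma>: "\<gamma> > 0" and a: "1/2 < a" "a < 1" and f: "f \<in> L2" and g: "g \<in> L2"
  shows "gabor_coeff \<gamma> a (\<lambda>t. f t - g t) m n = gabor_coeff \<gamma> a f m n - gabor_coeff \<gamma> a g m n"
  unfolding gabor_coeff_eq[OF \<gamma> a] left_diff_distrib
  by (rule Bochner_Integration.integral_diff; rule gabor_integrand_integrable[OF \<gamma> a]; fact)

lemma L2_diff: "f \<in> L2 \<Longrightarrow> g \<in> L2 \<Longrightarrow> (\<lambda>t. f t - g t) \<in> L2"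
  unfolding L2_def by (auto intro!: integrable_cmod_square_diff)

text \<open>The factor on the coefficient side: it bounds squared norms by coefficient energies,
  hence grows like 1/d near the critical density. It is the constant of
  \<open>sech_fibre_lower_bound\<close> at T = 1/a and \<alpha> = a.\<close>

definition lower_const :: "real \<Rightarrow> real \<Rightarrow> real" where
  "lower_const \<gamma> a = (sech_inverse_const (pi * \<gamma>) * exp (pi * \<gamma> / 3) *
     (1 + 12 * real (block_length (1 / a - a)) / (pi * \<gamma>)))\<^sup>2"

lemma sech_inverse_const_pos: "0 < sech_inverse_const \<kappa>"
proof -
  have "0 < 1 + exp \<kappa>" by (rule add_pos_pos) auto
  then show ?thesis unfolding sech_inverse_const_def by (intro mult_pos_pos zero_less_power) auto
qed

section \<open>Frame inequalities for compactly supported functions\<close>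

context
  fixes \<gamma> a :: real
  assumes \<gamma>: "\<gamma> > 0" and a: "1/2 < a" "a < 1"
begin

interpretation finite_measure "period_measure (1 / a)" by (rule finite_measure_period)

lemma lower_const_pos: "0 < lower_const \<gamma> a"
  unfolding lower_const_def using \<gamma> sech_inverse_const_pos[of "pi * \<gamma>"]
  by (intro zero_less_power mult_pos_pos add_pos_nonneg) auto

lemma bessel_supported:
  assumes f: "f \<in> L2" and supp: "supported_in a N f" and F: "finite F"
  shows "coeff_energy \<gamma> a f F \<le>
    1 / a * (\<Sum>m\<in>fst ` F. LINT t|period_measure (1 / a). (cmod (periodized \<gamma> a N f m t))\<^sup>2)"
proof -
  \<comment> \<open>Enlarging \<open>F\<close> to the product of its projections allows Bessel to be
    applied for each m separately.\<close>
  have "coeff_energy \<gamma> a f F \<le> (\<Sum>(m, n)\<in>fst ` F \<times> snd ` F. (cmod (gabor_coeff \<gamma> a f m n))\<^sup>2)"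
    using F by (intro sum_mono2) force+
  also have "\<dots> = (\<Sum>m\<in>fst ` F. \<Sum>n\<in>snd ` F. (cmod (gabor_coeff \<gamma> a f m n))\<^sup>2)"
    by (rule sum.cartesian_product[symmetric])
  also have "\<dots> \<le> (\<Sum>m\<in>fst ` F. 1 / a * (LINT t|period_measure (1 / a). (cmod (periodized \<gamma> a N f m t))\<^sup>2))"
    unfolding gabor_coeff_fourier[OF \<gamma> a f supp]
    by (intro sum_mono bessel_inequality period_bounds(1)[OF \<gamma> a] periodized_measurable[OF \<gamma> a f]
        periodized_square_integrable[OF \<gamma> a f supp] finite_imageI F)
  finally show ?thesis by (simp only: sum_distrib_left)
qed

lemma upper_supported:
  assumes f: "f \<in> L2" and supp: "supported_in a N f" and F: "finite F"
  shows "coeff_energy \<gamma> a f F \<le> 1 / a * upper_const \<gamma> * (L2_norm f)\<^sup>2"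
proof -
  let ?S = "\<lambda>t. \<Sum>k\<in>window N. (cmod (f (t + 1 / a * of_int k)))\<^sup>2"
  have "(\<Sum>m\<in>fst ` F. LINT t|period_measure (1 / a). (cmod (periodized \<gamma> a N f m t))\<^sup>2) =
      (LINT t|period_measure (1 / a). (\<Sum>m\<in>fst ` F. (cmod (periodized \<gamma> a N f m t))\<^sup>2))"
    by (rule Bochner_Integration.integral_sum[symmetric]) (rule periodized_square_integrable[OF \<gamma> a f supp])
  also have "\<dots> \<le> (LINT t|period_measure (1 / a). upper_const \<gamma> * ?S t)"
  proof (rule integral_mono)
    show "integrable (period_measure (1 / a)) (\<lambda>t. \<Sum>m\<in>fst ` F. (cmod (periodized \<gamma> a N f m t))\<^sup>2)"
      by (intro Bochner_Integration.integrable_sum periodized_square_integrable[OF \<gamma> a f supp])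
    show "integrable (period_measure (1 / a)) (\<lambda>t. upper_const \<gamma> * ?S t)"
      using norm_square_periodized(2)[OF \<gamma> a f supp] by simp
    show "(\<Sum>m\<in>fst ` F. (cmod (periodized \<gamma> a N f m t))\<^sup>2) \<le> upper_const \<gamma> * ?S t" for t
      by (rule periodized_upper[OF \<gamma> a]) (use F in simp)
  qed
  also have "\<dots> = upper_const \<gamma> * (L2_norm f)\<^sup>2"
    unfolding norm_square_periodized(1)[OF \<gamma> a f supp] by simp
  finally have "1 / a * (\<Sum>m\<in>fst ` F. LINT t|period_measure (1 / a). (cmod (periodized \<gamma> a N f m t))\<^sup>2) \<le>
      1 / a * (upper_const \<gamma> * (L2_norm f)\<^sup>2)"
    using a by (intro mult_left_mono) auto
  then show ?thesis using bessel_supported[OF assms] by (simp only: mult.assoc)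
qed

lemma lower_supported:
  assumes f: "f \<in> L2" and supp: "supported_in a N f" and e: "e > 0"
  obtains F where "finite F" "(L2_norm f)\<^sup>2 \<le> lower_const \<gamma> a * a * coeff_energy \<gamma> a f F + e"
proof -
  let ?S = "\<lambda>t. \<Sum>k\<in>window N. (cmod (f (t + 1 / a * of_int k)))\<^sup>2"
  let ?I = "\<lambda>m. LINT t|period_measure (1 / a). (cmod (periodized \<gamma> a N f m t))\<^sup>2"
  \<comment> \<open>Chosen independently of t: |t + j/a| <= (N + 1)/a over the whole window, and the
    summand 1 covers the rounding to the nearest sample. A set of m varying with t could not be
    pulled out of the integral.\<close>
  define M where "M = \<lceil>(real N + 1) * (1 / a) / a\<rceil> + 1"
  define F1 where "F1 = {- M..M}"
  have rng: "(\<lambda>j. round ((t + 1 / a * of_int j) / a)) ` window N \<subseteq> F1" if t: "0 < t" "t < 1 / a" for t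
  proof -
    have "round ((t + 1 / a * of_int j) / a) \<in> F1" if j: "j \<in> window N" for j
    proof -
      have j': "- real N \<le> of_int j" "real_of_int j \<le> real N" using j by auto
      have "1 / a * (- real N) \<le> 1 / a * of_int j" "1 / a * of_int j \<le> 1 / a * real N"
        using j' a by (intro mult_left_mono; simp)+
      moreover have "(real N + 1) * (1 / a) = 1 / a * real N + 1 / a" by (simp add: algebra_simps)
      ultimately have "\<bar>t + 1 / a * of_int j\<bar> \<le> (real N + 1) * (1 / a)" using t by argo
      then have "\<bar>(t + 1 / a * of_int j) / a\<bar> \<le> (real N + 1) * (1 / a) / a"
        using a by (simp only: abs_divide) (intro frac_le; simp)
      also have "\<dots> \<le> of_int \<lceil>(real N + 1) * (1 / a) / a\<rceil>" by (rule le_of_int_ceiling)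
      finally have "\<bar>(t + 1 / a * of_int j) / a\<bar> \<le> of_int (M - 1)" by (simp add: M_def)
      moreover have "\<bar>of_int (round ((t + 1 / a * of_int j) / a)) - (t + 1 / a * of_int j) / a\<bar> \<le> 1/2"
        by (rule of_int_round_abs_le)
      ultimately have "\<bar>real_of_int (round ((t + 1 / a * of_int j) / a))\<bar> \<le> of_int (M - 1) + 1/2" by argo
      then have "\<bar>real_of_int (round ((t + 1 / a * of_int j) / a))\<bar> \<le> of_int M" by simp
      then show ?thesis unfolding F1_def by (simp only: of_int_abs[symmetric] of_int_le_iff atLeastAtMost_iff) linarith
    qed
    then show ?thesis by blast
  qed
  have pw: "AE t in period_measure (1 / a). ?S t \<le> lower_const \<gamma> a * (\<Sum>m\<in>F1. (cmod (periodized \<gamma> a N f m t))\<^sup>2)"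
    using AE_period_measure
  proof eventually_elim
    case (elim t)
    show ?case
      unfolding lower_const_def periodized_def[OF \<gamma> a]
      by (rule sech_fibre_lower_bound) (use \<gamma> a period_bounds[OF \<gamma> a] rng elim in \<open>auto simp: F1_def\<close>)
  qed
  have "(L2_norm f)\<^sup>2 \<le> (LINT t|period_measure (1 / a). lower_const \<gamma> a * (\<Sum>m\<in>F1. (cmod (periodized \<gamma> a N f m t))\<^sup>2))"
    unfolding norm_square_periodized(1)[OF \<gamma> a f supp]
    by (intro integral_mono_AE pw norm_square_periodized(2)[OF \<gamma> a f supp] integrable_mult_right
        Bochner_Integration.integrable_sum periodized_square_integrable[OF \<gamma> a f supp])
  also have "\<dots> = lower_const \<gamma> a * (\<Sum>m\<in>F1. ?I m)"
    using periodized_square_integrable[OF \<gamma> a f supp] by simp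
  finally have norm_le: "(L2_norm f)\<^sup>2 \<le> lower_const \<gamma> a * (\<Sum>m\<in>F1. ?I m)" .
  \<comment> \<open>Distributes \<open>e\<close> over the Parseval errors of all m in
    \<open>F1\<close>, after their amplification by lower_const and a.\<close>
  define e' where "e' = e / (lower_const \<gamma> a * a * (real (card F1) + 1))"
  have den: "lower_const \<gamma> a * a * (real (card F1) + 1) > 0"
    using lower_const_pos a by (intro mult_pos_pos) auto
  then have e': "e' > 0" using e by (simp add: e'_def)
  have "\<forall>m. \<exists>G. finite G \<and> 1 / a * ?I m - e' \<le> (\<Sum>n\<in>G. (cmod (gabor_coeff \<gamma> a f m n))\<^sup>2)"
  proof
    fix m
    obtain G where "finite G" "1 / a * ?I m - e' \<le> (\<Sum>n\<in>G. (cmod (gabor_coeff \<gamma> a f m n))\<^sup>2)"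
      unfolding gabor_coeff_fourier[OF \<gamma> a f supp]
      by (rule parseval_lower[OF period_bounds(1)[OF \<gamma> a] periodized_measurable[OF \<gamma> a f]
            periodized_square_integrable[OF \<gamma> a f supp] e'])
    then show "\<exists>G. finite G \<and> 1 / a * ?I m - e' \<le> (\<Sum>n\<in>G. (cmod (gabor_coeff \<gamma> a f m n))\<^sup>2)" by blast
  qed
  then obtain G where G: "\<And>m. finite (G m)" "\<And>m. 1 / a * ?I m - e' \<le> (\<Sum>n\<in>G m. (cmod (gabor_coeff \<gamma> a f m n))\<^sup>2)"
    by metis
  define F where "F = Sigma F1 G"
  have F: "finite F" using G by (simp add: F_def F1_def)
  have "?I m \<le> a * ((\<Sum>n\<in>G m. (cmod (gabor_coeff \<gamma> a f m n))\<^sup>2) + e')" for m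
  proof -
    have "a * (1 / a * ?I m) \<le> a * ((\<Sum>n\<in>G m. (cmod (gabor_coeff \<gamma> a f m n))\<^sup>2) + e')"
      using G(2)[of m] a by (intro mult_left_mono) auto
    then show ?thesis using a by simp
  qed
  then have "(\<Sum>m\<in>F1. ?I m) \<le> (\<Sum>m\<in>F1. a * ((\<Sum>n\<in>G m. (cmod (gabor_coeff \<gamma> a f m n))\<^sup>2) + e'))"
    by (rule sum_mono)
  also have "\<dots> = a * coeff_energy \<gamma> a f F + a * (real (card F1) * e')"
    unfolding F_def using G by (simp add: sum.Sigma[symmetric] F1_def sum_distrib_left[symmetric] sum.distrib distrib_left)
  finally have "lower_const \<gamma> a * (\<Sum>m\<in>F1. ?I m) \<le>
      lower_const \<gamma> a * (a * coeff_energy \<gamma> a f F + a * (real (card F1) * e'))"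
    using lower_const_pos by (intro mult_left_mono) auto
  also have "\<dots> = lower_const \<gamma> a * a * coeff_energy \<gamma> a f F +
      lower_const \<gamma> a * a * real (card F1) * e'" by (simp add: algebra_simps)
  also have "lower_const \<gamma> a * a * real (card F1) * e' \<le> lower_const \<gamma> a * a * (real (card F1) + 1) * e'"
    using lower_const_pos a e' by (intro mult_right_mono mult_left_mono) auto
  also have "\<dots> = e"
    unfolding e'_def using den by (metis less_irrefl nonzero_mult_div_cancel_left times_divide_eq_right)
  finally show ?thesis using norm_le F that[of F] by simp
qed

section \<open>Truncation and passage to all of L2\<close>

definition truncate :: "nat \<Rightarrow> (real \<Rightarrow> complex) \<Rightarrow> real \<Rightarrow> complex" where
  "truncate N f t = (if - real N * (1 / a) \<le> t \<and> t < real N * (1 / a) then f t else 0)"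

lemma truncate_L2:
  assumes "f \<in> L2"
  shows "truncate N f \<in> L2"
proof -
  note [measurable] = L2_measurable[OF assms]
  have m: "truncate N f \<in> borel_measurable lborel" unfolding truncate_def by measurable
  then have "integrable lborel (\<lambda>t. (cmod (truncate N f t))\<^sup>2)"
    by (intro Bochner_Integration.integrable_bound[OF L2_integrable[OF assms]]) (auto simp: truncate_def)
  then show ?thesis using m by (simp add: L2_def)
qed

lemma truncate_supported: "supported_in a N (truncate N f)"
  unfolding supported_in_def[OF \<gamma> a] truncate_def by auto

lemma truncate_eventually: "eventually (\<lambda>N. truncate N f t = f t) sequentially"
proof -
  obtain N0 where N0: "real N0 > \<bar>t\<bar>" using reals_Archimedean2 by blast
  show ?thesis
  proof (rule eventually_sequentiallyI[of N0])
    fix N assume "N0 \<le> N"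
    then have "\<bar>t\<bar> < real N * 1" using N0 by linarith
    also have "real N * 1 \<le> real N * (1 / a)"
      using period_bounds(2)[OF \<gamma> a] by (intro mult_left_mono) auto
    finally have "- (real N * (1 / a)) \<le> t \<and> t < real N * (1 / a)" by argo
    then show "truncate N f t = f t" unfolding truncate_def by simp
  qed
qed

lemma truncate_coeff_tendsto:
  assumes f: "f \<in> L2"
  shows "(\<lambda>N. gabor_coeff \<gamma> a (truncate N f) m n) \<longlonglongrightarrow> gabor_coeff \<gamma> a f m n"
  unfolding gabor_coeff_eq[OF \<gamma> a]
proof (rule integral_dominated_convergence[OF _ _ L2_times_sech_integrable[OF \<gamma> a f, of m]])
  show "(\<lambda>t. f t * of_real (sech_at \<gamma> a m t) * cnj (fourier_exp (1 / a) n t)) \<in> borel_measurable lborel"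
    using gabor_integrand_integrable[OF \<gamma> a f] by (rule borel_measurable_integrable)
  show "(\<lambda>t. truncate N f t * of_real (sech_at \<gamma> a m t) * cnj (fourier_exp (1 / a) n t)) \<in> borel_measurable lborel" for N
    using gabor_integrand_integrable[OF \<gamma> a truncate_L2[OF f]] by (rule borel_measurable_integrable)
  show "AE t in lborel. (\<lambda>N. truncate N f t * of_real (sech_at \<gamma> a m t) * cnj (fourier_exp (1 / a) n t))
      \<longlonglongrightarrow> f t * of_real (sech_at \<gamma> a m t) * cnj (fourier_exp (1 / a) n t)"
  proof (rule AE_I2)
    fix t
    show "(\<lambda>N. truncate N f t * of_real (sech_at \<gamma> a m t) * cnj (fourier_exp (1 / a) n t))
      \<longlonglongrightarrow> f t * of_real (sech_at \<gamma> a m t) * cnj (fourier_exp (1 / a) n t)"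
      by (rule tendsto_eventually, rule eventually_mono[OF truncate_eventually[of f t]]) simp
  qed
  show "AE t in lborel. norm (truncate N f t * of_real (sech_at \<gamma> a m t) * cnj (fourier_exp (1 / a) n t))
      \<le> cmod (f t) * sech_at \<gamma> a m t" for N
    using sech_at_bounds(1)[OF \<gamma> a, of m] by (auto simp: norm_mult truncate_def less_imp_le)
qed

lemma truncate_norm_le:
  assumes f: "f \<in> L2"
  shows "(L2_norm (truncate N f))\<^sup>2 \<le> (L2_norm f)\<^sup>2"
  unfolding L2_norm_square
  by (rule integral_mono[OF L2_integrable[OF truncate_L2[OF f]] L2_integrable[OF f]]) (simp add: truncate_def)

lemma truncate_norm_tendsto:
  assumes f: "f \<in> L2"
  shows "(\<lambda>N. (L2_norm (truncate N f))\<^sup>2) \<longlonglongrightarrow> (L2_norm f)\<^sup>2"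
  unfolding L2_norm_square
proof (rule integral_dominated_convergence[OF _ _ L2_integrable[OF f]])
  show "AE t in lborel. (\<lambda>N. (cmod (truncate N f t))\<^sup>2) \<longlonglongrightarrow> (cmod (f t))\<^sup>2"
  proof (rule AE_I2)
    fix t
    show "(\<lambda>N. (cmod (truncate N f t))\<^sup>2) \<longlonglongrightarrow> (cmod (f t))\<^sup>2"
      by (rule tendsto_eventually, rule eventually_mono[OF truncate_eventually[of f t]]) simp
  qed
qed (use L2_integrable[OF f] L2_integrable[OF truncate_L2[OF f]] in \<open>auto simp: truncate_def\<close>)

lemma truncate_diff_norm: 
  assumes f: "f \<in> L2"
  shows "(L2_norm (\<lambda>t. f t - truncate N f t))\<^sup>2 = (L2_norm f)\<^sup>2 - (L2_norm (truncate N f))\<^sup>2"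
proof -
  have "(cmod (f t - truncate N f t))\<^sup>2 = (cmod (f t))\<^sup>2 - (cmod (truncate N f t))\<^sup>2" for t
    by (simp add: truncate_def)
  then show ?thesis
    unfolding L2_norm_square
    using Bochner_Integration.integral_diff[OF L2_integrable[OF f] L2_integrable[OF truncate_L2[OF f]]] by simp
qed

text \<open>\<open>F\<close> is fixed, so the coefficients of the truncations converge and the
  inequality survives the limit.\<close>

lemma frame_upper:
  assumes f: "f \<in> L2" and F: "finite F"
  shows "coeff_energy \<gamma> a f F \<le> 1 / a * upper_const \<gamma> * (L2_norm f)\<^sup>2"
proof (rule LIMSEQ_le_const2)
  show "(\<lambda>N. \<Sum>(m, n)\<in>F. (cmod (gabor_coeff \<gamma> a (truncate N f) m n))\<^sup>2) \<longlonglongrightarrow> coeff_energy \<gamma> a f F"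
    unfolding case_prod_unfold by (intro tendsto_intros truncate_coeff_tendsto f)
  have "coeff_energy \<gamma> a (truncate N f) F \<le> 1 / a * upper_const \<gamma> * (L2_norm f)\<^sup>2" for N
  proof -
    have "coeff_energy \<gamma> a (truncate N f) F \<le> 1 / a * upper_const \<gamma> * (L2_norm (truncate N f))\<^sup>2"
      by (intro upper_supported[OF truncate_L2[OF f] truncate_supported F])
    also have "\<dots> \<le> 1 / a * upper_const \<gamma> * (L2_norm f)\<^sup>2"
      using a upper_const_nonneg[OF \<gamma> a] by (intro mult_left_mono truncate_norm_le f) auto
    finally show ?thesis .
  qed
  then show "\<exists>N0. \<forall>N\<ge>N0. coeff_energy \<gamma> a (truncate N f) F \<le> 1 / a * upper_const \<gamma> * (L2_norm f)\<^sup>2"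
    by blast
qed

text \<open>The finite set supplied by \<open>lower_supported\<close> depends on the truncation, so
  there is no limit at fixed \<open>F\<close>. Instead one truncation is fixed and the coefficients
  of the small tail are controlled by \<open>frame_upper\<close>; splitting the square costs the
  factor 2.\<close>

lemma frame_lower:
  assumes f: "f \<in> L2" and e: "e > 0"
  obtains F where "finite F" "(L2_norm f)\<^sup>2 \<le> 2 * lower_const \<gamma> a * a * coeff_energy \<gamma> a f F + e"
proof -
  \<comment> \<open>Total amplification of \<open>e'\<close>: one share for the norm lost by
    truncation, one for the error of \<open>lower_supported\<close>, and the product term for the
    coefficients of the tail.\<close>
  define D where "D = 2 * lower_const \<gamma> a * upper_const \<gamma> + 2"
  have D: "D > 0" unfolding D_def using lower_const_pos upper_const_nonneg[OF \<gamma> a] by (intro add_nonneg_pos) auto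
  define e' where "e' = e / D"
  have e': "e' > 0" using e D by (simp add: e'_def)
  have "eventually (\<lambda>N. (L2_norm (truncate N f))\<^sup>2 > (L2_norm f)\<^sup>2 - e') sequentially"
    using order_tendstoD(1)[OF truncate_norm_tendsto[OF f]] e' by simp
  then obtain N where N: "(L2_norm f)\<^sup>2 - e' < (L2_norm (truncate N f))\<^sup>2"
    by (auto simp: eventually_sequentially)
  let ?g = "\<lambda>t. f t - truncate N f t"
  have g: "?g \<in> L2" by (intro L2_diff f truncate_L2)
  have gn: "(L2_norm ?g)\<^sup>2 \<le> e'" using N unfolding truncate_diff_norm[OF f] by linarith
  obtain F where F: "finite F" "(L2_norm (truncate N f))\<^sup>2 \<le>
      lower_const \<gamma> a * a * coeff_energy \<gamma> a (truncate N f) F + e'"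
    by (rule lower_supported[OF truncate_L2[OF f] truncate_supported e'])
  have c: "gabor_coeff \<gamma> a (truncate N f) m n = gabor_coeff \<gamma> a f m n - gabor_coeff \<gamma> a ?g m n" for m n
    using gabor_coeff_diff[OF \<gamma> a f truncate_L2[OF f]] by simp
  have "coeff_energy \<gamma> a (truncate N f) F \<le>
      (\<Sum>(m, n)\<in>F. 2 * (cmod (gabor_coeff \<gamma> a f m n))\<^sup>2 + 2 * (cmod (gabor_coeff \<gamma> a ?g m n))\<^sup>2)"
    unfolding c case_prod_unfold by (intro sum_mono cmod_diff_square_le)
  also have "\<dots> = 2 * coeff_energy \<gamma> a f F + 2 * coeff_energy \<gamma> a ?g F"
    by (simp add: case_prod_unfold sum.distrib sum_distrib_left)
  also have "coeff_energy \<gamma> a ?g F \<le> 1 / a * upper_const \<gamma> * (L2_norm ?g)\<^sup>2"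
    by (rule frame_upper[OF g F(1)])
  also have "\<dots> \<le> 1 / a * upper_const \<gamma> * e'"
    using a upper_const_nonneg[OF \<gamma> a] by (intro mult_left_mono gn) auto
  finally have "lower_const \<gamma> a * a * coeff_energy \<gamma> a (truncate N f) F \<le>
      lower_const \<gamma> a * a * (2 * coeff_energy \<gamma> a f F + 2 * (1 / a * upper_const \<gamma> * e'))"
    using lower_const_pos a by (intro mult_left_mono) auto
  also have "\<dots> = 2 * lower_const \<gamma> a * a * coeff_energy \<gamma> a f F + 2 * lower_const \<gamma> a * upper_const \<gamma> * e'"
    using a by (simp add: distrib_left mult_ac)
  finally have "(L2_norm f)\<^sup>2 \<le> 2 * lower_const \<gamma> a * a * coeff_energy \<gamma> a f F + D * e'"
    using F(2) N unfolding D_def by (simp add: distrib_right)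
  then show ?thesis using that[OF F(1)] D by (simp add: e'_def)
qed

section \<open>Admissible frame bounds and attainment of the best ones\<close>

lemma is_upper_bound_upper_const: "is_upper_bound (g1 \<gamma>) (square_lattice a) (1 / a * upper_const \<gamma> + 1)"
  unfolding is_upper_bound_def
proof (intro conjI ballI)
  \<comment> \<open>\<open>is_upper_bound\<close> demands strict positivity while
    \<open>upper_const\<close> is only shown to be nonnegative, hence the summand 1.\<close>
  have "0 \<le> 1 / a * upper_const \<gamma>" using a upper_const_nonneg[OF \<gamma> a] by simp
  then show "0 < 1 / a * upper_const \<gamma> + 1" by linarith
  fix f assume f: "f \<in> L2"
  have "1 / a * upper_const \<gamma> * (L2_norm f)\<^sup>2 \<le> (1 / a * upper_const \<gamma> + 1) * (L2_norm f)\<^sup>2"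
    by (intro mult_right_mono) auto
  then show "gabor_sum (g1 \<gamma>) (square_lattice a) f \<le> ennreal ((1 / a * upper_const \<gamma> + 1) * (L2_norm f)\<^sup>2)"
    using a frame_upper[OF f] by (intro gabor_sum_leI) (auto intro: order_trans)
qed

lemma is_lower_bound_lower_const: "is_lower_bound (g1 \<gamma>) (square_lattice a) (1 / (2 * lower_const \<gamma> a * a))"
  unfolding is_lower_bound_def
proof (intro conjI ballI)
  define P where "P = 2 * lower_const \<gamma> a * a"
  have P: "P > 0" using lower_const_pos a by (simp add: P_def)
  then show "0 < 1 / (2 * lower_const \<gamma> a * a)" unfolding P_def by simp
  fix f assume f: "f \<in> L2"
  show "ennreal (1 / (2 * lower_const \<gamma> a * a) * (L2_norm f)\<^sup>2) \<le> gabor_sum (g1 \<gamma>) (square_lattice a) f"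
  proof (rule ennreal_le_epsilon)
    fix e :: real assume e: "e > 0"
    \<comment> \<open>\<open>frame_lower\<close> is applied with error P e, so that dividing by P
      leaves exactly e.\<close>
    then have "P * e > 0" using P by simp
    then obtain F where F: "finite F" "(L2_norm f)\<^sup>2 \<le> P * coeff_energy \<gamma> a f F + P * e"
      using frame_lower[OF f] unfolding P_def by blast
    have "1 / P * (L2_norm f)\<^sup>2 \<le> 1 / P * (P * coeff_energy \<gamma> a f F + P * e)"
      using F P by (intro mult_left_mono) auto
    also have "\<dots> = coeff_energy \<gamma> a f F + e" using P by (simp add: distrib_left)
    finally have "ennreal (1 / P * (L2_norm f)\<^sup>2) \<le> ennreal (coeff_energy \<gamma> a f F) + ennreal e"
      using e by (subst ennreal_plus[symmetric]) (auto intro!: sum_nonneg ennreal_leI)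
    also have "\<dots> \<le> gabor_sum (g1 \<gamma>) (square_lattice a) f + ennreal e"
      using a F by (intro add_right_mono gabor_sum_ge) auto
    finally show "ennreal (1 / (2 * lower_const \<gamma> a * a) * (L2_norm f)\<^sup>2) \<le> gabor_sum (g1 \<gamma>) (square_lattice a) f + ennreal e"
      unfolding P_def .
  qed
qed

end

text \<open>\<open>GREATEST\<close> has meaning only if the maximum is attained. For each f the
  condition on A is closed, so the supremum of the admissible constants is again admissible.\<close>

lemma lower_frame_bound_greatest:
  assumes ex: "is_lower_bound g \<Lambda> A0" and bd: "\<And>A. is_lower_bound g \<Lambda> A \<Longrightarrow> A \<le> M"
  shows "is_lower_bound g \<Lambda> (lower_frame_bound g \<Lambda>)"
    and "is_lower_bound g \<Lambda> A \<Longrightarrow> A \<le> lower_frame_bound g \<Lambda>"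
proof -
  define X where "X = {A. is_lower_bound g \<Lambda> A}"
  have X: "X \<noteq> {}" "bdd_above X" using ex bd unfolding X_def by (auto intro!: bdd_aboveI)
  have up: "A \<le> Sup X" if "is_lower_bound g \<Lambda> A" for A
    using X(2) that by (intro cSup_upper) (auto simp: X_def)
  have "is_lower_bound g \<Lambda> (Sup X)" unfolding is_lower_bound_def
  proof (intro conjI ballI)
    show "0 < Sup X" using up[OF ex] ex unfolding is_lower_bound_def by linarith
    fix f assume f: "f \<in> L2"
    have le: "ennreal (A * (L2_norm f)\<^sup>2) \<le> gabor_sum g \<Lambda> f" if "A \<in> X" for A
      using that f unfolding X_def is_lower_bound_def by blast
    show "ennreal (Sup X * (L2_norm f)\<^sup>2) \<le> gabor_sum g \<Lambda> f"
    proof (cases "gabor_sum g \<Lambda> f")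
      case (real r)
      show ?thesis
      proof (cases "L2_norm f = 0")
        case False
        then have pos: "0 < (L2_norm f)\<^sup>2" by simp
        have "Sup X \<le> r / (L2_norm f)\<^sup>2"
        proof (rule cSup_least[OF X(1)])
          fix A assume "A \<in> X"
          from le[OF this] show "A \<le> r / (L2_norm f)\<^sup>2"
            unfolding real(2) using real(1) pos by (simp add: ennreal_le_iff field_simps)
        qed
        then show ?thesis unfolding real(2) using pos by (intro ennreal_leI) (simp add: field_simps)
      qed simp
    qed simp
  qed
  moreover from this have "lower_frame_bound g \<Lambda> = Sup X"
    unfolding lower_frame_bound_def by (rule Greatest_equality) (rule up)
  ultimately show "is_lower_bound g \<Lambda> (lower_frame_bound g \<Lambda>)"
    and "is_lower_bound g \<Lambda> A \<Longrightarrow> A \<le> lower_frame_bound g \<Lambda>" using up by simp_all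
qed

text \<open>Dual to the preceding lemma. Admissibility includes B > 0, which the infimum could lose;
  the uniform bound M > 0 preserves it.\<close>

lemma upper_frame_bound_least:
  assumes ex: "is_upper_bound g \<Lambda> B0" and bd: "\<And>B. is_upper_bound g \<Lambda> B \<Longrightarrow> M \<le> B" and M: "M > 0"
  shows "is_upper_bound g \<Lambda> (upper_frame_bound g \<Lambda>)"
    and "is_upper_bound g \<Lambda> B \<Longrightarrow> upper_frame_bound g \<Lambda> \<le> B"
proof -
  define X where "X = {B. is_upper_bound g \<Lambda> B}"
  have X: "X \<noteq> {}" "bdd_below X" using ex bd unfolding X_def by (auto intro!: bdd_belowI)
  have lo: "Inf X \<le> B" if "is_upper_bound g \<Lambda> B" for B
    using X(2) that by (intro cInf_lower) (auto simp: X_def)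
  have "is_upper_bound g \<Lambda> (Inf X)" unfolding is_upper_bound_def
  proof (intro conjI ballI)
    have "M \<le> Inf X" by (rule cInf_greatest[OF X(1)]) (use bd in \<open>auto simp: X_def\<close>)
    then show "0 < Inf X" using M by linarith
    fix f assume f: "f \<in> L2"
    have le: "gabor_sum g \<Lambda> f \<le> ennreal (B * (L2_norm f)\<^sup>2)" and B0: "0 < B" if "B \<in> X" for B
      using that f unfolding X_def is_upper_bound_def by blast+
    obtain B1 where B1: "B1 \<in> X" using X(1) by blast
    obtain r where r: "0 \<le> r" "gabor_sum g \<Lambda> f = ennreal r"
      using le[OF B1] by (cases "gabor_sum g \<Lambda> f") (auto simp: top_unique)
    have rB: "r \<le> B * (L2_norm f)\<^sup>2" if "B \<in> X" for B
      using le[OF that] B0[OF that] r by (simp add: ennreal_le_iff)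
    show "gabor_sum g \<Lambda> f \<le> ennreal (Inf X * (L2_norm f)\<^sup>2)"
    proof (cases "L2_norm f = 0")
      case True
      then show ?thesis using rB[OF B1] r by simp
    next
      case False
      then have pos: "0 < (L2_norm f)\<^sup>2" by simp
      have "r / (L2_norm f)\<^sup>2 \<le> Inf X"
        by (rule cInf_greatest[OF X(1)]) (use rB pos in \<open>simp add: divide_le_eq\<close>)
      then show ?thesis unfolding r(2) using pos by (intro ennreal_leI) (simp add: divide_le_eq)
    qed
  qed
  moreover from this have "upper_frame_bound g \<Lambda> = Inf X"
    unfolding upper_frame_bound_def by (rule Least_equality) (rule lo)
  ultimately show "is_upper_bound g \<Lambda> (upper_frame_bound g \<Lambda>)"
    and "is_upper_bound g \<Lambda> B \<Longrightarrow> upper_frame_bound g \<Lambda> \<le> B" using lo by simp_all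
qed

subsection \<open>A test function near the critical density\<close>

lemma abs_sinh_le: "\<bar>sinh r\<bar> \<le> \<bar>r\<bar> * exp \<bar>r\<bar>" for r :: real
proof -
  have pos: "sinh x \<le> x * exp x" if "x \<ge> 0" for x :: real
  proof -
    have "sinh x = exp x * (1 - exp (- (2 * x))) / 2"
      by (simp add: sinh_def right_diff_distrib exp_add[symmetric])
    also have "\<dots> \<le> exp x * (2 * x) / 2"
      using exp_ge_add_one_self[of "- (2 * x)"] by (intro divide_right_mono mult_left_mono) auto
    finally show ?thesis by (simp add: mult.commute)
  qed
  show ?thesis
  proof (cases "r \<ge> 0")
    case True
    then show ?thesis using pos[of r] by simp
  next
    case False
    then show ?thesis using pos[of "- r"] by simp
  qed
qed

text \<open>The product cosh (x + r) cosh (x - r) equals (cosh x)^2 + (sinh r)^2, hence is at least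
  (cosh x)^2. So the difference is of order r and keeps the full decay exp (-|x|).\<close>

lemma sech_diff_le:
  fixes x r :: real
  shows "\<bar>sech (x + r) - sech (x - r)\<bar> \<le> 4 * \<bar>r\<bar> * exp \<bar>r\<bar> * exp (- \<bar>x\<bar>)"
proof -
  have c: "cosh (x + r) > 0" "cosh (x - r) > 0" "cosh x > 0" by (simp_all add: cosh_real_pos)
  have d: "cosh (x - r) - cosh (x + r) = - (2 * (sinh x * sinh r))"
    by (simp add: cosh_add cosh_diff)
  have "cosh (x + r) * cosh (x - r) = (cosh x)\<^sup>2 * (cosh r)\<^sup>2 - (sinh x)\<^sup>2 * (sinh r)\<^sup>2"
    by (simp add: cosh_add cosh_diff power2_eq_square algebra_simps)
  also have "\<dots> = (cosh x)\<^sup>2 + (sinh r)\<^sup>2"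
    by (simp add: cosh_square_eq algebra_simps)
  finally have p: "(cosh x)\<^sup>2 \<le> cosh (x + r) * cosh (x - r)" by simp
  have "\<bar>sinh x\<bar> \<le> cosh x"
    using sinh_le_cosh_real[of x] sinh_le_cosh_real[of "- x"] by (simp add: abs_le_iff)
  then have num: "2 * (\<bar>sinh x\<bar> * \<bar>sinh r\<bar>) \<le> 2 * (cosh x * \<bar>sinh r\<bar>)"
    by (intro mult_left_mono mult_right_mono) auto
  have "sech (x + r) - sech (x - r) = (cosh (x - r) - cosh (x + r)) / (cosh (x + r) * cosh (x - r))"
    using c by (simp add: field_simps)
  then have "\<bar>sech (x + r) - sech (x - r)\<bar> =
      2 * (\<bar>sinh x\<bar> * \<bar>sinh r\<bar>) / (cosh (x + r) * cosh (x - r))"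
    unfolding d using c by (simp add: abs_mult)
  also have "\<dots> \<le> 2 * (cosh x * \<bar>sinh r\<bar>) / (cosh x)\<^sup>2"
    using num p c by (intro frac_le) auto
  also have "\<dots> = 2 * \<bar>sinh r\<bar> * sech x"
    using c by (simp add: power2_eq_square field_simps)
  also have "\<dots> \<le> 2 * (\<bar>r\<bar> * exp \<bar>r\<bar>) * (2 * exp (- \<bar>x\<bar>))"
    by (intro mult_mono mult_left_mono abs_sinh_le sech_le) auto
  finally show ?thesis by (simp add: mult_ac)
qed

section \<open>Alternating tent sums of secants\<close>

definition tent :: "nat \<Rightarrow> int \<Rightarrow> real" where
  "tent n k = max 0 (1 - \<bar>of_int k\<bar> / real n)"

definition alt :: "int \<Rightarrow> real" where
  "alt k = (if even k then 1 else - 1)"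

lemma tent_bounds: "0 \<le> tent n k" "tent n k \<le> 1"
  unfolding tent_def by auto

lemma tent_eq_0: "n \<ge> 1 \<Longrightarrow> int n \<le> \<bar>k\<bar> \<Longrightarrow> tent n k = 0"
  unfolding tent_def by (simp add: max_def field_simps) linarith

lemma tent_diff_le:
  assumes "n \<ge> 1"
  shows "\<bar>tent n k - tent n l\<bar> \<le> \<bar>of_int k + of_int l\<bar> / real n"
proof -
  have "\<bar>\<bar>real_of_int k\<bar> / real n - \<bar>of_int l\<bar> / real n\<bar> = \<bar>\<bar>real_of_int k\<bar> - \<bar>of_int l\<bar>\<bar> / real n"
    by (simp only: diff_divide_distrib[symmetric] abs_divide abs_of_nat)
  also have "\<dots> \<le> \<bar>of_int k + of_int l\<bar> / real n"
    by (intro divide_right_mono) auto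
  finally show ?thesis unfolding tent_def by (auto simp: max_def abs_if split: if_splits)
qed

lemma abs_alt [simp]: "\<bar>alt k\<bar> = 1" by (simp add: alt_def)

lemma times_exp_neg_le:
  assumes "c > 0" "x \<ge> 0"
  shows "x * exp (- (c * x)) \<le> 1 / (c :: real)"
proof -
  have "c * x \<le> exp (c * x)" using exp_ge_add_one_self[of "c * x"] by linarith
  then have "c * x * exp (- (c * x)) \<le> exp (c * x) * exp (- (c * x))" by (intro mult_right_mono) auto
  then have "c * (x * exp (- (c * x))) \<le> 1" by (simp add: exp_minus mult.assoc)
  then show ?thesis using assms by (simp add: field_simps)
qed

text \<open>Reflecting \<open>k \<mapsto> 2 m - 1 - k\<close> flips the sign and maps \<open>y\<close> to \<open>- y\<close>; what survives is the
  variation of the slowly varying tent and the offset \<open>\<rho>\<close> from the zero of the alternating sum.\<close>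
lemma alternating_sech_sum_near:
  fixes \<kappa> T \<rho> :: real and m :: int
  assumes \<kappa>: "\<kappa> > 0" and T: "1 \<le> T" "T \<le> 2" and n: "n \<ge> 1"
  shows "\<bar>\<Sum>k\<in>window n. alt k * tent n k * sech (\<kappa> * ((of_int k - of_int m + 1/2) * T + \<rho>))\<bar>
    \<le> exp (\<kappa> * \<bar>\<rho>\<bar>) * (4 / (\<kappa> * real n) + 2 * \<kappa> * \<bar>\<rho>\<bar>) * (exp \<kappa> * (1 + 4 / \<kappa>))"
proof -
  define y where "y = (\<lambda>k::int. (of_int k - of_int m + 1/2) * T)"
  define s where "s = (\<lambda>u. sech (\<kappa> * u))"
  define h where "h = (\<lambda>k. alt k * tent n k * s (y k + \<rho>))"
  \<comment> \<open>The smallest convenient enlargement: it contains \<open>window n\<close> and is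
    invariant under the reflection, and the tent vanishes on the added indices.\<close>
  define S where "S = {m - (int n + \<bar>m\<bar>)..m - 1 + (int n + \<bar>m\<bar>)}"
  define X where "X = exp (\<kappa> * \<bar>\<rho>\<bar>)"
  have E: "(\<Sum>k\<in>window n. h k) = (\<Sum>k\<in>S. h k)"
    by (rule sum.mono_neutral_left) (use n in \<open>auto simp: S_def h_def intro!: tent_eq_0\<close>)
  have reflect: "(\<Sum>k\<in>S. h (2 * m - 1 - k)) = (\<Sum>k\<in>S. h k)"
    by (rule sum.reindex_bij_witness[of _ "\<lambda>k. 2 * m - 1 - k" "\<lambda>k. 2 * m - 1 - k"]) (auto simp: S_def)
  have pair_le: "\<bar>h k + h (2 * m - 1 - k)\<bar> \<le> X * (8 / (\<kappa> * real n) + 4 * \<kappa> * \<bar>\<rho>\<bar>) * exp (- (\<kappa> / 2) * \<bar>y k\<bar>)" for k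
  proof -
    let ?k = "2 * m - 1 - k"
    have yk: "y ?k + \<rho> = - (y k - \<rho>)" by (simp add: y_def algebra_simps)
    have sk: "s (y ?k + \<rho>) = s (y k - \<rho>)" unfolding yk s_def mult_minus_right cosh_minus ..
    have ak: "alt ?k = - alt k" by (simp add: alt_def)
    have "h k + h ?k = alt k * ((tent n k - tent n ?k) * s (y k + \<rho>) + tent n ?k * (s (y k + \<rho>) - s (y k - \<rho>)))"
      unfolding h_def sk ak by (simp add: algebra_simps)
    then have "\<bar>h k + h ?k\<bar> = \<bar>(tent n k - tent n ?k) * s (y k + \<rho>) + tent n ?k * (s (y k + \<rho>) - s (y k - \<rho>))\<bar>"
      by (simp add: abs_mult)
    also have "\<dots> \<le> \<bar>tent n k - tent n ?k\<bar> * \<bar>s (y k + \<rho>)\<bar> + \<bar>tent n ?k\<bar> * \<bar>s (y k + \<rho>) - s (y k - \<rho>)\<bar>"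
      by (rule order_trans[OF abs_triangle_ineq]) (simp add: abs_mult)
    finally have split: "\<bar>h k + h ?k\<bar> \<le> \<bar>tent n k - tent n ?k\<bar> * \<bar>s (y k + \<rho>)\<bar> + \<bar>tent n ?k\<bar> * \<bar>s (y k + \<rho>) - s (y k - \<rho>)\<bar>" .
    have half: "exp (- (\<kappa> * \<bar>y k\<bar>)) \<le> exp (- (\<kappa> / 2) * \<bar>y k\<bar>)" using \<kappa> by simp
    have "\<bar>s (y k + \<rho>)\<bar> \<le> 2 * exp (- \<bar>\<kappa> * (y k + \<rho>)\<bar>)"
      unfolding s_def using sech_le sech_pos by (simp add: abs_of_pos)
    also have "\<dots> \<le> 2 * (X * exp (- (\<kappa> * \<bar>y k\<bar>)))"
    proof -
      have "\<kappa> * \<bar>y k\<bar> \<le> \<kappa> * (\<bar>y k + \<rho>\<bar> + \<bar>\<rho>\<bar>)" using \<kappa> by (intro mult_left_mono) auto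
      then have "- \<bar>\<kappa> * (y k + \<rho>)\<bar> \<le> \<kappa> * \<bar>\<rho>\<bar> + - (\<kappa> * \<bar>y k\<bar>)" unfolding abs_mult using \<kappa> by (simp add: distrib_left)
      then show ?thesis unfolding X_def exp_add[symmetric] by simp
    qed
    finally have s1: "\<bar>s (y k + \<rho>)\<bar> \<le> 2 * (X * exp (- (\<kappa> * \<bar>y k\<bar>)))" .
    have tk: "\<bar>tent n k - tent n ?k\<bar> \<le> 2 * \<bar>y k\<bar> / real n"
    proof -
      have "tent n ?k = tent n (- ?k)" by (simp only: tent_def of_int_minus abs_minus_cancel)
      then have "\<bar>tent n k - tent n ?k\<bar> \<le> \<bar>of_int k + of_int (- ?k)\<bar> / real n"
        using tent_diff_le[OF n, of k "- ?k"] by simp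
      also have "of_int k + of_int (- ?k) = 2 * (of_int k - of_int m + 1/2 :: real)" by simp
      also have "\<bar>2 * (of_int k - of_int m + 1/2 :: real)\<bar> / real n = 2 * \<bar>of_int k - of_int m + 1/2\<bar> / real n"
        by (simp only: abs_mult abs_numeral)
      also have "\<dots> \<le> 2 * \<bar>y k\<bar> / real n"
      proof -
        have "\<bar>of_int k - of_int m + 1/2\<bar> * 1 \<le> \<bar>of_int k - of_int m + 1/2\<bar> * T"
          using T by (intro mult_left_mono) auto
        then show ?thesis using T unfolding y_def by (intro divide_right_mono mult_left_mono) (simp_all add: abs_mult)
      qed
      finally show ?thesis .
    qed
    have "\<bar>tent n k - tent n ?k\<bar> * \<bar>s (y k + \<rho>)\<bar> \<le> (2 * \<bar>y k\<bar> / real n) * (2 * (X * exp (- (\<kappa> * \<bar>y k\<bar>))))"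
      by (intro mult_mono tk s1) auto
    \<comment> \<open>Half of the exponential decay absorbs the factor |y k| that came from the
      variation of the tent; the other half is kept for the summation over k.\<close>
    also have "\<dots> = (4 * X / real n) * (\<bar>y k\<bar> * exp (- (\<kappa> / 2 * \<bar>y k\<bar>))) * exp (- (\<kappa> / 2) * \<bar>y k\<bar>)"
    proof -
      have "exp (- (\<kappa> * \<bar>y k\<bar>)) = exp (- (\<kappa> / 2 * \<bar>y k\<bar>)) * exp (- (\<kappa> / 2) * \<bar>y k\<bar>)"
        unfolding exp_add[symmetric] by simp
      then show ?thesis by simp
    qed
    also have "\<dots> \<le> (4 * X / real n) * (1 / (\<kappa> / 2)) * exp (- (\<kappa> / 2) * \<bar>y k\<bar>)"
      using \<kappa> by (intro mult_right_mono mult_left_mono times_exp_neg_le) (auto simp: X_def)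
    also have "\<dots> = X * (8 / (\<kappa> * real n)) * exp (- (\<kappa> / 2) * \<bar>y k\<bar>)" by (simp add: mult_ac)
    finally have t1: "\<bar>tent n k - tent n ?k\<bar> * \<bar>s (y k + \<rho>)\<bar> \<le> X * (8 / (\<kappa> * real n)) * exp (- (\<kappa> / 2) * \<bar>y k\<bar>)" .
    have "\<bar>s (y k + \<rho>) - s (y k - \<rho>)\<bar> \<le> 4 * \<bar>\<kappa> * \<rho>\<bar> * exp \<bar>\<kappa> * \<rho>\<bar> * exp (- \<bar>\<kappa> * y k\<bar>)"
      unfolding s_def distrib_left right_diff_distrib by (rule sech_diff_le)
    also have "\<dots> = X * (4 * \<kappa> * \<bar>\<rho>\<bar>) * exp (- (\<kappa> * \<bar>y k\<bar>))" using \<kappa> by (simp add: X_def abs_mult)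
    also have "\<dots> \<le> X * (4 * \<kappa> * \<bar>\<rho>\<bar>) * exp (- (\<kappa> / 2) * \<bar>y k\<bar>)"
      using \<kappa> by (intro mult_left_mono half) (auto simp: X_def)
    finally have s2: "\<bar>s (y k + \<rho>) - s (y k - \<rho>)\<bar> \<le> X * (4 * \<kappa> * \<bar>\<rho>\<bar>) * exp (- (\<kappa> / 2) * \<bar>y k\<bar>)" .
    have "\<bar>tent n ?k\<bar> * \<bar>s (y k + \<rho>) - s (y k - \<rho>)\<bar> \<le> 1 * \<bar>s (y k + \<rho>) - s (y k - \<rho>)\<bar>"
      using tent_bounds[of n ?k] by (intro mult_right_mono) auto
    then have "\<bar>h k + h ?k\<bar> \<le> X * (8 / (\<kappa> * real n)) * exp (- (\<kappa> / 2) * \<bar>y k\<bar>) + X * (4 * \<kappa> * \<bar>\<rho>\<bar>) * exp (- (\<kappa> / 2) * \<bar>y k\<bar>)"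
      using split t1 s2 by linarith
    also have "\<dots> = X * (8 / (\<kappa> * real n) + 4 * \<kappa> * \<bar>\<rho>\<bar>) * exp (- (\<kappa> / 2) * \<bar>y k\<bar>)"
      by (simp only: distrib_left distrib_right)
    finally show ?thesis .
  qed
  define W where "W = exp \<kappa> * (1 + 4 / \<kappa>)"
  have W: "(\<Sum>k\<in>S. exp (- (\<kappa> / 2) * \<bar>y k\<bar>)) \<le> W"
  proof -
    have "(\<Sum>k\<in>S. exp (- (\<kappa> / 2) * \<bar>y k\<bar>)) = (\<Sum>k\<in>S. exp (- (\<kappa> / 2) * \<bar>(1/2 - of_int m) * T + T * of_int k\<bar>))"
      by (intro sum.cong refl) (simp add: y_def algebra_simps)
    also have "\<dots> \<le> exp (\<kappa> / 2 * T) * (1 + 2 / (\<kappa> / 2 * T))"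
      using \<kappa> T by (intro sum_exp_abs_progression_le) (auto simp: S_def)
    also have "\<dots> \<le> W" unfolding W_def
    proof (intro mult_mono)
      show "exp (\<kappa> / 2 * T) \<le> exp \<kappa>" using \<kappa> T by simp
      have "2 / (\<kappa> / 2 * T) \<le> 2 / (\<kappa> / 2 * 1)"
        using \<kappa> T by (intro divide_left_mono mult_left_mono mult_pos_pos) auto
      then show "1 + 2 / (\<kappa> / 2 * T) \<le> 1 + 4 / \<kappa>" by simp
    qed (use \<kappa> T in auto)
    finally show ?thesis .
  qed
  have "2 * (\<Sum>k\<in>S. h k) = (\<Sum>k\<in>S. h k + h (2 * m - 1 - k))"
    by (simp add: sum.distrib reflect)
  then have "2 * \<bar>\<Sum>k\<in>S. h k\<bar> = \<bar>\<Sum>k\<in>S. h k + h (2 * m - 1 - k)\<bar>" by simp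
  also have "\<dots> \<le> (\<Sum>k\<in>S. X * (8 / (\<kappa> * real n) + 4 * \<kappa> * \<bar>\<rho>\<bar>) * exp (- (\<kappa> / 2) * \<bar>y k\<bar>))"
    by (rule order_trans[OF sum_abs]) (intro sum_mono pair_le)
  also have "\<dots> = X * (8 / (\<kappa> * real n) + 4 * \<kappa> * \<bar>\<rho>\<bar>) * (\<Sum>k\<in>S. exp (- (\<kappa> / 2) * \<bar>y k\<bar>))"
    by (simp only: sum_distrib_left)
  also have "\<dots> \<le> X * (8 / (\<kappa> * real n) + 4 * \<kappa> * \<bar>\<rho>\<bar>) * W"
    using \<kappa> by (intro mult_left_mono W) (auto simp: X_def intro!: mult_nonneg_nonneg add_nonneg_nonneg)
  also have "\<dots> = 2 * (X * (4 / (\<kappa> * real n) + 2 * \<kappa> * \<bar>\<rho>\<bar>) * W)" by (simp add: algebra_simps)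
  finally show ?thesis using E unfolding h_def s_def y_def X_def W_def by simp
qed

text \<open>No cancellation is used here. The tent reaches at most 5/4 n <= 5/16 |m|, while the
  generator sits at distance at least 4/5 |m|, so they are more than |m|/4 - 2 apart. Half of the
  resulting decay absorbs the 2n terms of the sum.\<close>

lemma alternating_sech_sum_far:
  fixes \<kappa> T \<alpha> t :: real and m :: int
  assumes \<kappa>: "\<kappa> > 0" and \<alpha>: "4/5 \<le> \<alpha>" and T: "0 < T" "T \<le> 5/4" and t: "0 < t" "t < T"
    and n: "n \<ge> 1" and m: "4 * int n < \<bar>m\<bar>"
  shows "\<bar>\<Sum>k\<in>window n. alt k * tent n k * sech (\<kappa> * (t + T * of_int k - \<alpha> * of_int m))\<bar>
    \<le> 8 / \<kappa> * exp (2 * \<kappa>) * exp (- (\<kappa> / 8) * \<bar>of_int m\<bar>)"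
proof -
  let ?M = "\<bar>real_of_int m\<bar>"
  have nM: "4 * real n \<le> ?M" using m by linarith
  have "\<bar>alt k * tent n k * sech (\<kappa> * (t + T * of_int k - \<alpha> * of_int m))\<bar> \<le> 2 * exp (\<kappa> * 2 - \<kappa> * (?M / 4))"
    if k: "k \<in> window n" for k
  proof -
    have "\<bar>real_of_int k\<bar> \<le> real n" using k by auto
    then have Tk: "\<bar>T * of_int k\<bar> \<le> 5/4 * real n" unfolding abs_mult using T by (intro mult_mono) auto
    have "4/5 * ?M \<le> \<bar>\<alpha> * of_int m\<bar>" unfolding abs_mult using \<alpha> by (intro mult_right_mono) auto
    then have "?M / 4 - 2 \<le> \<bar>t + T * of_int k - \<alpha> * of_int m\<bar>"
      using Tk nM t T by argo
    then have "\<kappa> * (?M / 4 - 2) \<le> \<kappa> * \<bar>t + T * of_int k - \<alpha> * of_int m\<bar>" using \<kappa> by (intro mult_left_mono) auto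
    then have "- \<bar>\<kappa> * (t + T * of_int k - \<alpha> * of_int m)\<bar> \<le> \<kappa> * 2 - \<kappa> * (?M / 4)"
      unfolding abs_mult using \<kappa> by (simp add: right_diff_distrib)
    then have "2 * exp (- \<bar>\<kappa> * (t + T * of_int k - \<alpha> * of_int m)\<bar>) \<le> 2 * exp (\<kappa> * 2 - \<kappa> * (?M / 4))" by simp
    then have "sech (\<kappa> * (t + T * of_int k - \<alpha> * of_int m)) \<le> 2 * exp (\<kappa> * 2 - \<kappa> * (?M / 4))"
      using sech_le order_trans by blast
    moreover have "\<bar>alt k * tent n k * sech (\<kappa> * (t + T * of_int k - \<alpha> * of_int m))\<bar> \<le>
        1 * sech (\<kappa> * (t + T * of_int k - \<alpha> * of_int m))"
      unfolding abs_mult abs_alt abs_of_pos[OF sech_pos] mult_1_left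
      using tent_bounds[of n k] by (intro mult_left_le_one_le) (auto simp: less_imp_le[OF sech_pos])
    ultimately show ?thesis by simp
  qed
  then have "\<bar>\<Sum>k\<in>window n. alt k * tent n k * sech (\<kappa> * (t + T * of_int k - \<alpha> * of_int m))\<bar>
      \<le> (\<Sum>k\<in>window n. 2 * exp (\<kappa> * 2 - \<kappa> * (?M / 4)))"
    by (intro order_trans[OF sum_abs] sum_mono)
  also have "\<dots> = 4 * real n * exp (\<kappa> * 2 - \<kappa> * (?M / 4))" by simp
  also have "\<dots> \<le> ?M * exp (\<kappa> * 2 - \<kappa> * (?M / 4))" by (intro mult_right_mono nM) auto
  also have "\<dots> = exp (2 * \<kappa>) * (?M * exp (- (\<kappa> / 8 * ?M))) * exp (- (\<kappa> / 8) * ?M)"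
  proof -
    have "exp (\<kappa> * 2 - \<kappa> * (?M / 4)) = exp (2 * \<kappa>) * exp (- (\<kappa> / 8 * ?M)) * exp (- (\<kappa> / 8) * ?M)"
      unfolding exp_add[symmetric] by simp
    then show ?thesis by simp
  qed
  also have "\<dots> \<le> exp (2 * \<kappa>) * (1 / (\<kappa> / 8)) * exp (- (\<kappa> / 8) * ?M)"
    using \<kappa> by (intro mult_right_mono mult_left_mono times_exp_neg_le) auto
  also have "\<dots> = 8 / \<kappa> * exp (2 * \<kappa>) * exp (- (\<kappa> / 8) * ?M)" by simp
  finally show ?thesis .
qed

lemma tent_square_sum_ge:
  assumes n: "n \<ge> 2"
  shows "real n / 8 \<le> (\<Sum>k\<in>window n. (tent n k)\<^sup>2)"
proof -
  have sub: "int ` {0..n div 2} \<subseteq> window n" using n by auto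
  have "real n / 8 \<le> (\<Sum>i\<in>{0..n div 2}. 1 / 4)"
  proof -
    have "n \<le> 2 * (n div 2 + 1)" by presburger
    then have "real n \<le> real (2 * (n div 2 + 1))" by (rule of_nat_mono)
    then show ?thesis by simp
  qed
  also have "\<dots> \<le> (\<Sum>i\<in>{0..n div 2}. (tent n (int i))\<^sup>2)"
  proof (rule sum_mono)
    fix i assume "i \<in> {0..n div 2}"
    then have "2 * i \<le> n" by simp
    then have "2 * real i \<le> real n" by linarith
    then have "1 / 2 \<le> tent n (int i)" using n by (simp add: tent_def le_max_iff_disj field_simps)
    then have "(1 / 2)\<^sup>2 \<le> (tent n (int i))\<^sup>2" by (intro power_mono) auto
    then show "1 / 4 \<le> (tent n (int i))\<^sup>2" by (simp add: power2_eq_square)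
  qed
  also have "\<dots> = (\<Sum>k\<in>int ` {0..n div 2}. (tent n k)\<^sup>2)" by (subst sum.reindex) auto
  also have "\<dots> \<le> (\<Sum>k\<in>window n. (tent n k)\<^sup>2)" using sub by (intro sum_mono2) auto
  finally show ?thesis .
qed

text \<open>In coordinates s = t + T k with 0 < t < T, the product of an indicator in t and the
  alternating tent in k; the floor recovers k.\<close>

definition test_fun :: "real \<Rightarrow> real \<Rightarrow> nat \<Rightarrow> real \<Rightarrow> complex" where
  "test_fun T \<tau> n s = of_real (alt \<lfloor>s / T\<rfloor> * tent n \<lfloor>s / T\<rfloor> *
     indicator {T / 2 - \<tau>..T / 2 + \<tau>} (s - T * of_int \<lfloor>s / T\<rfloor>))"

lemma test_fun_translate:
  assumes "0 < t" "t < T"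
  shows "test_fun T \<tau> n (t + T * of_int k) = of_real (alt k * tent n k * indicator {T / 2 - \<tau>..T / 2 + \<tau>} t)"
proof -
  have "(t + T * of_int k) / T = t / T + of_int k" using assms by (simp add: add_divide_distrib)
  moreover have "\<lfloor>t / T\<rfloor> = 0" using assms by (simp add: floor_eq_iff)
  ultimately have "\<lfloor>(t + T * of_int k) / T\<rfloor> = k" by simp
  then show ?thesis unfolding test_fun_def by simp
qed

lemma test_fun_measurable [measurable]: "test_fun T \<tau> n \<in> borel_measurable borel"
proof -
  have [measurable]: "(\<lambda>s. alt \<lfloor>s / T\<rfloor> * tent n \<lfloor>s / T\<rfloor>) \<in> borel_measurable borel"
    by (rule measurable_compose[of "\<lambda>s. \<lfloor>s / T\<rfloor>" borel "count_space UNIV"]) measurable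
  show ?thesis unfolding test_fun_def by measurable
qed

lemma test_fun_support:
  assumes T: "T > 0" and n: "n \<ge> 1" and nz: "test_fun T \<tau> n s \<noteq> 0"
  shows "- real n * T \<le> s \<and> s < real n * T"
proof -
  have "tent n \<lfloor>s / T\<rfloor> \<noteq> 0" using nz by (auto simp: test_fun_def)
  then have "\<bar>\<lfloor>s / T\<rfloor>\<bar> < int n" using tent_eq_0[OF n, of "\<lfloor>s / T\<rfloor>"] by linarith
  then have "- int n \<le> \<lfloor>s / T\<rfloor>" "\<lfloor>s / T\<rfloor> < int n" by auto
  then have "- real n \<le> s / T" "s / T < real n" by (simp_all add: le_floor_iff floor_less_iff)
  then show ?thesis using T by (simp add: field_simps)
qed

lemma test_fun_L2:
  assumes T: "T > 0" and n: "n \<ge> 1"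
  shows "test_fun T \<tau> n \<in> L2"
proof -
  have "integrable lborel (\<lambda>s. (cmod (test_fun T \<tau> n s))\<^sup>2)"
  proof (rule Bochner_Integration.integrable_bound[of _ "indicator {- real n * T..real n * T} :: real \<Rightarrow> real"])
    show "integrable lborel (indicator {- real n * T..real n * T} :: real \<Rightarrow> real)"
      by (rule integrable_real_indicator) (auto simp: emeasure_lborel_Icc_eq)
    have le1: "cmod (test_fun T \<tau> n s) \<le> 1" for s
      unfolding test_fun_def norm_of_real abs_mult
      using tent_bounds[of n "\<lfloor>s / T\<rfloor>"] by (auto simp: indicator_def)
    show "AE s in lborel. norm ((cmod (test_fun T \<tau> n s))\<^sup>2) \<le> norm (indicator {- real n * T..real n * T} s :: real)"
    proof (rule AE_I2)
      fix s
      show "norm ((cmod (test_fun T \<tau> n s))\<^sup>2) \<le> norm (indicator {- real n * T..real n * T} s :: real)"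
      proof (cases "test_fun T \<tau> n s = 0")
        case False
        then have "s \<in> {- real n * T..real n * T}" using test_fun_support[OF T n False] by auto
        then show ?thesis using le1[of s] by (simp add: abs_square_le_1)
      qed simp
    qed
  qed measurable
  then show ?thesis unfolding L2_def by simp
qed

text \<open>The bound of \<open>alternating_sech_sum_near\<close> for |\<rho>| <= 7 sqrt d, |\<rho>|
  <= 4 and 1/n <= sqrt d, with sqrt d taken out: 14 \<kappa> is 2\<kappa> times 7.\<close>

definition near_const :: "real \<Rightarrow> real" where
  "near_const \<kappa> = exp (4 * \<kappa>) * (4 / \<kappa> + 14 * \<kappa>) * (exp \<kappa> * (1 + 4 / \<kappa>))"

text \<open>The squared constant of \<open>alternating_sech_sum_far\<close>, times the 2/\<kappa>
  that arises when one of the two exponential factors is traded for sqrt d.\<close>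

definition far_const :: "real \<Rightarrow> real" where
  "far_const \<kappa> = (8 / \<kappa> * exp (2 * \<kappa>))\<^sup>2 * (2 / \<kappa>)"

text \<open>14 bounds (8n + 1) d / sqrt d, the contribution of the near translates; 1 + 16/\<kappa>
  is the sum of exp (-(\<kappa>/8) |m|) over the far ones.\<close>

definition test_const :: "real \<Rightarrow> real" where
  "test_const \<kappa> = 14 * (near_const \<kappa>)\<^sup>2 + far_const \<kappa> * (1 + 16 / \<kappa>)"

lemma period_near_critical:
  fixes a :: real
  assumes a: "1/2 < a" "a < 1" and d: "1 / a - a \<le> 1/4"
  shows "1 / a \<le> 5/4" "4/5 \<le> a"
proof -
  show 1: "1 / a \<le> 5/4" using a d by argo
  then show "4/5 \<le> a" using a by (simp add: field_simps)
qed

lemma half_window: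
  fixes t w e :: real
  assumes "\<bar>t - w / 2\<bar> \<le> e / 2" "0 < e" "e \<le> 1/2" "1 \<le> w"
  shows "0 < t \<and> t < w"
  using assms by linarith

lemma block_length_small:
  fixes d :: real
  assumes d: "0 < d" "d \<le> 1/4"
  defines "n \<equiv> block_length d"
  shows "0 < sqrt d" "sqrt d \<le> 1/2" "sqrt d * sqrt d = d" "1 / sqrt d \<le> real n" "n \<ge> 1"
    "1 / real n \<le> sqrt d" "real n * d \<le> 3/2 * sqrt d"
proof -
  have "sqrt d \<le> sqrt ((1/2)\<^sup>2)" using d by (intro real_sqrt_le_mono) (simp add: power2_eq_square)
  then show sd: "0 < sqrt d" "sqrt d \<le> 1/2" "sqrt d * sqrt d = d" using d by auto
  show n1: "1 / sqrt d \<le> real n" "n \<ge> 1"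
    using block_length_bounds[OF d(1)] by (simp_all add: n_def)
  have n2: "real n \<le> 1 / sqrt d + 1"
    using block_length_bounds[OF d(1)] by (simp add: n_def)
  have "1 \<le> real n * sqrt d" using mult_right_mono[OF n1(1), of "sqrt d"] sd by simp
  then show "1 / real n \<le> sqrt d" using n1(2) by (simp add: field_simps)
  have "real n * sqrt d \<le> (1 / sqrt d + 1) * sqrt d" using n2 sd by (intro mult_right_mono) auto
  also have "\<dots> = 1 + sqrt d" using sd by (simp add: distrib_right)
  finally have "real n * sqrt d * sqrt d \<le> 3/2 * sqrt d" using sd by (intro mult_right_mono) auto
  then show "real n * d \<le> 3/2 * sqrt d" using sd(3) by (simp add: mult.assoc)
qed

text \<open>For |m| <= 4n the alternating sum is of order sqrt d by cancellation, so its square is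
  of order d. There are about 8n + 1 such m, and n d is of order sqrt d, so the far terms are
  brought to the same total order with a summable weight in m.\<close>

lemma test_sum_bound:
  fixes \<kappa> a t :: real and m :: int
  assumes \<kappa>: "\<kappa> > 0" and a: "1/2 < a" "a < 1"
  defines "d \<equiv> 1 / a - a"
  defines "n \<equiv> block_length d"
  assumes d: "d \<le> 1/4" and t: "\<bar>t - 1 / a / 2\<bar> \<le> sqrt d / 2"
  shows "(\<Sum>k\<in>window n. alt k * tent n k * sech (\<kappa> * (t + 1 / a * of_int k - a * of_int m)))\<^sup>2
    \<le> (if \<bar>m\<bar> \<le> 4 * int n then (near_const \<kappa>)\<^sup>2 * d else 0) + far_const \<kappa> * sqrt d * exp (- (\<kappa> / 8) * \<bar>of_int m\<bar>)"
proof -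
  define E where "E = (\<Sum>k\<in>window n. alt k * tent n k * sech (\<kappa> * (t + 1 / a * of_int k - a * of_int m)))"
  have T: "0 < 1 / a" "1 \<le> 1 / a" "1 / a \<le> 5/4" "1 / a \<le> 2" "4/5 \<le> a"
    using period_near_critical[OF a] period_bounds[OF zero_less_one a] d by (auto simp: d_def)
  have d0: "d > 0" using period_bounds(4)[OF zero_less_one a] by (simp add: d_def)
  note sd = block_length_small(1-3)[OF d0 d]
    and n1 = block_length_small(5)[OF d0 d, folded n_def]
    and ninv = block_length_small(6)[OF d0 d, folded n_def]
    and nd = block_length_small(7)[OF d0 d, folded n_def]
  have rn: "real n > 0" using n1 by simp
  have F0: "0 \<le> far_const \<kappa> * sqrt d * exp (- (\<kappa> / 8) * \<bar>of_int m\<bar>)"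
    using \<kappa> sd by (simp add: far_const_def)
  show ?thesis
  proof (cases "\<bar>m\<bar> \<le> 4 * int n")
    case True
    \<comment> \<open>Since k/a - a m = (k - m)/a + d m, the offset from the zero at half a period
      consists of the drift d m and the position of t in the short window. The drift is at most 4 n
      d <= 6 sqrt d and the position at most sqrt d / 2, hence 7 sqrt d.\<close>
    define \<rho> where "\<rho> = d * of_int m + (t - 1 / a / 2)"
    have arg: "t + 1 / a * of_int k - a * of_int m = (of_int k - of_int m + 1/2) * (1 / a) + \<rho>" for k
      unfolding \<rho>_def d_def by (simp add: algebra_simps)
    have "\<bar>real_of_int m\<bar> \<le> 4 * real n" using True by linarith
    then have "\<bar>d * of_int m\<bar> \<le> d * (4 * real n)" unfolding abs_mult using d0 by (intro mult_mono) auto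
    then have "\<bar>d * of_int m\<bar> \<le> 4 * (real n * d)" by (simp add: mult_ac)
    then have \<rho>: "\<bar>\<rho>\<bar> \<le> 7 * sqrt d" using t nd sd unfolding \<rho>_def by argo
    then have \<rho>4: "\<bar>\<rho>\<bar> \<le> 4" using sd by argo
    have "\<bar>E\<bar> \<le> exp (\<kappa> * \<bar>\<rho>\<bar>) * (4 / (\<kappa> * real n) + 2 * \<kappa> * \<bar>\<rho>\<bar>) * (exp \<kappa> * (1 + 4 / \<kappa>))"
      unfolding E_def arg by (rule alternating_sech_sum_near[OF \<kappa> T(2) T(4) n1])
    also have "\<dots> \<le> exp (4 * \<kappa>) * ((4 / \<kappa> + 14 * \<kappa>) * sqrt d) * (exp \<kappa> * (1 + 4 / \<kappa>))"
    proof (intro mult_right_mono mult_mono)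
      show "exp (\<kappa> * \<bar>\<rho>\<bar>) \<le> exp (4 * \<kappa>)" using mult_left_mono[OF \<rho>4, of \<kappa>] \<kappa> by (simp add: mult.commute)
      have "4 / (\<kappa> * real n) = 4 / \<kappa> * (1 / real n)" by simp
      also have "\<dots> \<le> 4 / \<kappa> * sqrt d" using \<kappa> by (intro mult_left_mono ninv) auto
      finally have p: "4 / (\<kappa> * real n) \<le> 4 / \<kappa> * sqrt d" .
      have q: "2 * \<kappa> * \<bar>\<rho>\<bar> \<le> 2 * \<kappa> * (7 * sqrt d)" using \<kappa> by (intro mult_left_mono \<rho>) auto
      show "4 / (\<kappa> * real n) + 2 * \<kappa> * \<bar>\<rho>\<bar> \<le> (4 / \<kappa> + 14 * \<kappa>) * sqrt d"
        using add_mono[OF p q] by (simp add: distrib_right)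
    qed (use \<kappa> sd rn in auto)
    also have "\<dots> = near_const \<kappa> * sqrt d" by (simp add: near_const_def)
    finally have "\<bar>E\<bar>\<^sup>2 \<le> (near_const \<kappa> * sqrt d)\<^sup>2" by (intro power_mono) auto
    also have "\<dots> = (near_const \<kappa>)\<^sup>2 * d" using d0 by (simp add: power_mult_distrib)
    finally have "E\<^sup>2 \<le> (near_const \<kappa>)\<^sup>2 * d" by simp
    then show ?thesis using True F0 unfolding E_def by simp
  next
    case False
    let ?x = "exp (- (\<kappa> / 8) * \<bar>real_of_int m\<bar>)"
    have t': "0 < t" "t < 1 / a" using half_window[OF t sd(1,2) T(2)] by simp_all
    have "\<bar>E\<bar> \<le> 8 / \<kappa> * exp (2 * \<kappa>) * ?x"
      unfolding E_def by (rule alternating_sech_sum_far) (use \<kappa> T t' n1 False in auto)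
    then have "\<bar>E\<bar>\<^sup>2 \<le> (8 / \<kappa> * exp (2 * \<kappa>) * ?x)\<^sup>2" by (intro power_mono) auto
    then have E2: "E\<^sup>2 \<le> (8 / \<kappa> * exp (2 * \<kappa>))\<^sup>2 * (?x * ?x)" by (simp add: power_mult_distrib power2_eq_square mult_ac)
    \<comment> \<open>Squaring leaves two copies of the exponential. As |m| > 4n, one copy is at
      most a multiple of 1/n, hence of sqrt d; the other stays to make the sum over m
      converge.\<close>
    have "?x \<le> exp (- (\<kappa> / 2 * real n))"
    proof -
      have "4 * real n \<le> \<bar>real_of_int m\<bar>" using False by linarith
      then have "\<kappa> / 8 * (4 * real n) \<le> \<kappa> / 8 * \<bar>real_of_int m\<bar>" using \<kappa> by (intro mult_left_mono) auto
      then show ?thesis by simp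
    qed
    also have "\<dots> = 1 / real n * (real n * exp (- (\<kappa> / 2 * real n)))" using rn by simp
    also have "\<dots> \<le> sqrt d * (1 / (\<kappa> / 2))"
      using \<kappa> sd by (intro mult_mono ninv times_exp_neg_le) auto
    finally have x: "?x \<le> 2 / \<kappa> * sqrt d" by (simp add: mult.commute)
    have "(8 / \<kappa> * exp (2 * \<kappa>))\<^sup>2 * (?x * ?x) \<le> (8 / \<kappa> * exp (2 * \<kappa>))\<^sup>2 * (2 / \<kappa> * sqrt d * ?x)"
      by (intro mult_left_mono mult_right_mono x) auto
    also have "\<dots> = far_const \<kappa> * sqrt d * ?x" by (simp add: far_const_def mult_ac)
    finally have "E\<^sup>2 \<le> far_const \<kappa> * sqrt d * ?x" using E2 by (rule order_trans[rotated])
    then show ?thesis using False unfolding E_def[symmetric] by simp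
  qed
qed

lemma test_bound_sum:
  fixes \<kappa> d :: real and M :: "int set"
  assumes \<kappa>: "\<kappa> > 0" and d: "0 < d" "d \<le> 1/4" and M: "finite M"
  defines "n \<equiv> block_length d"
  shows "(\<Sum>m\<in>M. (if \<bar>m\<bar> \<le> 4 * int n then (near_const \<kappa>)\<^sup>2 * d else 0) + far_const \<kappa> * sqrt d * exp (- (\<kappa> / 8) * \<bar>of_int m\<bar>))
    \<le> test_const \<kappa> * sqrt d"
proof -
  note sd = block_length_small(1-3)[OF d] and nd0 = block_length_small(7)[OF d, folded n_def]
  have "d \<le> sqrt d" using mult_right_mono[OF sd(2), of "sqrt d"] sd by simp
  then have nd: "(8 * real n + 1) * d \<le> 14 * sqrt d" using nd0 sd(1)
    by (simp only: distrib_right mult.assoc mult_1_left; linarith)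
  have "(\<Sum>m\<in>M. if \<bar>m\<bar> \<le> 4 * int n then (near_const \<kappa>)\<^sup>2 * d else 0) = (\<Sum>m\<in>{m \<in> M. \<bar>m\<bar> \<le> 4 * int n}. (near_const \<kappa>)\<^sup>2 * d)"
    using M by (simp only: sum.inter_filter)
  also have "\<dots> \<le> (\<Sum>m\<in>{- (4 * int n)..4 * int n}. (near_const \<kappa>)\<^sup>2 * d)"
    using d by (intro sum_mono2) auto
  also have "\<dots> = (near_const \<kappa>)\<^sup>2 * ((8 * real n + 1) * d)" by simp
  also have "\<dots> \<le> (near_const \<kappa>)\<^sup>2 * (14 * sqrt d)" by (intro mult_left_mono nd) auto
  finally have 1: "(\<Sum>m\<in>M. if \<bar>m\<bar> \<le> 4 * int n then (near_const \<kappa>)\<^sup>2 * d else 0) \<le> (near_const \<kappa>)\<^sup>2 * (14 * sqrt d)" .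
  have "(\<Sum>m\<in>M. exp (- (\<kappa> / 8) * \<bar>real_of_int m\<bar>)) \<le> 1 + 2 / (\<kappa> / 8)"
    using sum_exp_abs_int_le[of "\<kappa> / 8" M 0] \<kappa> M by simp
  then have "far_const \<kappa> * sqrt d * (\<Sum>m\<in>M. exp (- (\<kappa> / 8) * \<bar>real_of_int m\<bar>)) \<le> far_const \<kappa> * sqrt d * (1 + 2 / (\<kappa> / 8))"
    using \<kappa> sd by (intro mult_left_mono) (auto simp: far_const_def)
  with 1 show ?thesis
    unfolding sum.distrib sum_distrib_left[symmetric] test_const_def by (simp add: algebra_simps)
qed

lemma test_const_nonneg: "\<kappa> > 0 \<Longrightarrow> 0 \<le> test_const \<kappa>"
  unfolding test_const_def far_const_def by simp

text \<open>With \<mu> = sqrt d the length of the window, the squared norm is \<mu> G with G >= n/8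
  >= 1/(8 sqrt d), while the Gabor sum is at most T \<mu> times test_const sqrt d. The factor \<mu>
  cancels and A <= 8 T test_const d remains; T <= 5/4 gives 10.\<close>

lemma lower_bound_near_critical:
  fixes \<gamma> a A :: real
  assumes \<gamma>: "\<gamma> > 0" and a: "1/2 < a" "a < 1" and d4: "1 / a - a \<le> 1/4"
    and A: "is_lower_bound (g1 \<gamma>) (square_lattice a) A"
  shows "A \<le> 10 * test_const (pi * \<gamma>) * (1 / a - a)"
proof -
  define \<kappa> where "\<kappa> = pi * \<gamma>"
  define d where "d = 1 / a - a"
  define n where "n = block_length d"
  define T where "T = 1 / a"
  \<comment> \<open>Half-width sqrt d / 2 keeps t - T/2 within the order of the drift and of the
    tent's slope; a wider window would spoil the cancellation.\<close>
  define J where "J = {T / 2 - sqrt d / 2..T / 2 + sqrt d / 2}"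
  define f where "f = test_fun T (sqrt d / 2) n"
  define G where "G = (\<Sum>k\<in>window n. (tent n k)\<^sup>2)"
  define \<mu> where "\<mu> = (LINT t|period_measure T. indicator J t :: real)"
  have \<kappa>: "\<kappa> > 0" using \<gamma> by (simp add: \<kappa>_def)
  have T: "0 < T" "1 \<le> T" "T \<le> 5/4"
    using period_near_critical[OF a d4] period_bounds[OF \<gamma> a] by (auto simp: T_def)
  have d: "0 < d" "d \<le> 1/4" using period_bounds(4)[OF \<gamma> a] d4 by (simp_all add: d_def)
  note sd = block_length_small(1-3)[OF d] and n1 = block_length_small(4,5)[OF d, folded n_def]
  have "2 \<le> 1 / sqrt d" using sd by (simp add: field_simps)
  then have n2: "n \<ge> 2" using n1 by linarith
  interpret finite_measure "period_measure T" by (rule finite_measure_period)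
  have [measurable]: "J \<in> sets borel" by (simp add: J_def)
  have \<mu>: "\<mu> = sqrt d"
  proof -
    have "J \<subseteq> {0<..<T}" 
    proof
      fix t assume "t \<in> J"
      then have "T / 2 - sqrt d / 2 \<le> t" "t \<le> T / 2 + sqrt d / 2" by (simp_all add: J_def)
      then have "\<bar>t - T / 2\<bar> \<le> sqrt d / 2" by linarith
      from half_window[OF this sd(1,2) T(2)] show "t \<in> {0<..<T}" by simp
    qed
    then have "(\<lambda>t. indicator {0<..<T} t *\<^sub>R indicator J t) = (indicator J :: real \<Rightarrow> real)"
      by (auto simp: indicator_def fun_eq_iff)
    note eq = this
    have "\<mu> = (LINT t|lborel. indicator {0<..<T} t *\<^sub>R indicator J t)"
      unfolding \<mu>_def by (rule integral_period_measure) measurable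
    also have "\<dots> = (LINT t|lborel. indicator J t)" by (simp only: eq)
    finally have "\<mu> = measure lborel J" by simp
    then show ?thesis using sd by (simp add: J_def)
  qed
  have f: "f \<in> L2" unfolding f_def by (rule test_fun_L2[OF T(1) n1(2)])
  have supp: "supported_in a n f"
    unfolding supported_in_def[OF \<gamma> a] f_def using test_fun_support[OF T(1) n1(2)] by (auto simp: T_def)
  have J_int: "integrable (period_measure T) (\<lambda>t. indicator J t * c)" for c :: real
    by (intro integrable_mult_left integrable_const_bound[of _ 1]) auto
  have fJ: "f (t + T * of_int k) = of_real (alt k * tent n k * indicator J t)" if "0 < t \<and> t < T" for t k
    unfolding f_def J_def using test_fun_translate that by blast
  have norm_f: "(L2_norm f)\<^sup>2 = \<mu> * G"
  proof -
    have "(L2_norm f)\<^sup>2 = (LINT t|period_measure T. (\<Sum>k\<in>window n. (cmod (f (t + T * of_int k)))\<^sup>2))"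
      unfolding T_def by (rule norm_square_periodized(1)[OF \<gamma> a f supp])
    also have "\<dots> = (LINT t|period_measure T. indicator J t * G)"
    proof (rule integral_cong_AE)
      note [measurable] = L2_measurable[OF f]
      show "(\<lambda>t. \<Sum>k\<in>window n. (cmod (f (t + T * of_int k)))\<^sup>2) \<in> borel_measurable (period_measure T)" by measurable
      show "(\<lambda>t. indicator J t * G) \<in> borel_measurable (period_measure T)" by measurable
      show "AE t in period_measure T. (\<Sum>k\<in>window n. (cmod (f (t + T * of_int k)))\<^sup>2) = indicator J t * G"
        using AE_period_measure
      proof eventually_elim
        case (elim t)
        have "(\<bar>alt k * tent n k * indicator J t\<bar>)\<^sup>2 = indicator J t * (tent n k)\<^sup>2" for k
          by (simp add: alt_def indicator_def)
        then show ?case unfolding fJ[OF elim] norm_of_real G_def by (simp only: sum_distrib_left)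
      qed
    qed
    finally show ?thesis by (simp add: \<mu>_def)
  qed
  define b where "b = (\<lambda>m. (if \<bar>m\<bar> \<le> 4 * int n then (near_const \<kappa>)\<^sup>2 * d else 0) + far_const \<kappa> * sqrt d * exp (- (\<kappa> / 8) * \<bar>of_int m\<bar>))"
  have per: "(LINT t|period_measure T. (cmod (periodized \<gamma> a n f m t))\<^sup>2) \<le> \<mu> * b m" for m
  proof -
    have "(LINT t|period_measure T. (cmod (periodized \<gamma> a n f m t))\<^sup>2) \<le> (LINT t|period_measure T. indicator J t * b m)"
    proof (rule integral_mono_AE)
      show "integrable (period_measure T) (\<lambda>t. (cmod (periodized \<gamma> a n f m t))\<^sup>2)"
        unfolding T_def by (rule periodized_square_integrable[OF \<gamma> a f supp])
      show "integrable (period_measure T) (\<lambda>t. indicator J t * b m)" by (rule J_int)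
      show "AE t in period_measure T. (cmod (periodized \<gamma> a n f m t))\<^sup>2 \<le> indicator J t * b m"
        using AE_period_measure
      proof eventually_elim
        case (elim t)
        define E where "E = (\<Sum>k\<in>window n. alt k * tent n k * sech (\<kappa> * (t + 1 / a * of_int k - a * of_int m)))"
        have "periodized \<gamma> a n f m t = of_real (indicator J t * E)"
          unfolding periodized_def[OF \<gamma> a] E_def sum_distrib_left of_real_sum
          by (intro sum.cong refl) (subst fJ[OF elim, unfolded T_def], simp only: \<kappa>_def of_real_mult mult_ac)
        then have eq: "(cmod (periodized \<gamma> a n f m t))\<^sup>2 = indicator J t * E\<^sup>2"
          by (simp add: indicator_def)
        show ?case
        proof (cases "t \<in> J")
          case True
          then have "\<bar>t - 1 / a / 2\<bar> \<le> sqrt d / 2" unfolding J_def T_def by (auto; argo)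
          then have "E\<^sup>2 \<le> b m"
            using test_sum_bound[OF \<kappa> a, of t m] d4 unfolding E_def b_def n_def d_def by blast
          then show ?thesis unfolding eq using True by simp
        qed (simp add: eq)
      qed
    qed
    then show ?thesis by (simp add: \<mu>_def)
  qed
  have "gabor_sum (g1 \<gamma>) (square_lattice a) f \<le> ennreal (T * (\<mu> * (test_const \<kappa> * sqrt d)))"
  proof (rule gabor_sum_leI)
    fix F :: "(int \<times> int) set" assume F: "finite F"
    have "coeff_energy \<gamma> a f F \<le>
        T * (\<Sum>m\<in>fst ` F. LINT t|period_measure T. (cmod (periodized \<gamma> a n f m t))\<^sup>2)"
      unfolding T_def by (rule bessel_supported[OF \<gamma> a f supp F])
    also have "\<dots> \<le> T * (\<Sum>m\<in>fst ` F. \<mu> * b m)"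
      using T by (intro mult_left_mono sum_mono per) auto
    also have "\<dots> = T * (\<mu> * (\<Sum>m\<in>fst ` F. b m))" by (simp only: sum_distrib_left)
    also have "\<dots> \<le> T * (\<mu> * (test_const \<kappa> * sqrt d))"
      unfolding b_def n_def using T sd \<mu> F d by (intro mult_left_mono test_bound_sum \<kappa>) auto
    finally show "coeff_energy \<gamma> a f F \<le> T * (\<mu> * (test_const \<kappa> * sqrt d))" .
  qed (use a in simp)
  moreover have "ennreal (A * (L2_norm f)\<^sup>2) \<le> gabor_sum (g1 \<gamma>) (square_lattice a) f" and A0: "0 < A"
    using A f unfolding is_lower_bound_def by blast+
  ultimately have "ennreal (A * (\<mu> * G)) \<le> ennreal (T * (\<mu> * (test_const \<kappa> * sqrt d)))"
    unfolding norm_f by (metis order_trans)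
  moreover have "0 \<le> T * (\<mu> * (test_const \<kappa> * sqrt d))"
    using T sd \<mu> test_const_nonneg[OF \<kappa>] by simp
  ultimately have "A * (\<mu> * G) \<le> T * (\<mu> * (test_const \<kappa> * sqrt d))" by (simp add: ennreal_le_iff)
  then have "\<mu> * (A * G) \<le> \<mu> * (T * (test_const \<kappa> * sqrt d))" by (simp add: mult_ac)
  then have AG: "A * G \<le> T * (test_const \<kappa> * sqrt d)" using \<mu> sd by (simp only: mult_le_cancel_left_pos)
  have "1 / sqrt d / 8 \<le> G"
    using order_trans[OF divide_right_mono[OF n1(1), of 8] tent_square_sum_ge[OF n2]] by (simp add: G_def)
  then have "A * (1 / sqrt d / 8) \<le> A * G" using A0 by (intro mult_left_mono) auto
  also have "\<dots> \<le> T * (test_const \<kappa> * sqrt d)" by (rule AG)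
  also have "\<dots> \<le> 5/4 * (test_const \<kappa> * sqrt d)"
    using T sd test_const_nonneg[OF \<kappa>] by (intro mult_right_mono) auto
  finally have "A * (1 / sqrt d / 8) * (8 * sqrt d) \<le> 5/4 * (test_const \<kappa> * sqrt d) * (8 * sqrt d)"
    using sd by (intro mult_right_mono) auto
  moreover have "A * (1 / sqrt d / 8) * (8 * sqrt d) = A" using sd by simp
  moreover have "5/4 * (test_const \<kappa> * sqrt d) * (8 * sqrt d) = 10 * test_const \<kappa> * (sqrt d * sqrt d)" by simp
  ultimately have "A \<le> 10 * test_const \<kappa> * (sqrt d * sqrt d)" by (simp only:)
  then show ?thesis unfolding sd(3) unfolding \<kappa>_def d_def .
qed

section \<open>Bounds from the generator itself and assembly of the constants\<close>

lemma g1_L2: "\<gamma> > 0 \<Longrightarrow> g1 \<gamma> \<in> L2"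
proof -
  assume \<gamma>: "\<gamma> > 0"
  have "continuous_on UNIV (\<lambda>t. sech (pi * \<gamma> * t))"
    by (intro continuous_intros) (metis cosh_real_pos less_irrefl)
  then have [measurable]: "(\<lambda>t. sech (pi * \<gamma> * t)) \<in> borel_measurable borel"
    by (rule borel_measurable_continuous_onI)
  have "(\<lambda>t. complex_of_real (sech (pi * \<gamma> * t))) \<in> borel_measurable lborel" by measurable
  moreover have "integrable lborel (\<lambda>t. (sech (pi * \<gamma> * t))\<^sup>2)"
    using \<gamma> by (intro integrable_sech_square) simp
  ultimately show ?thesis unfolding L2_def g1_def[abs_def] by (simp del: of_real_inverse add: norm_inverse)
qed

lemma g1_norm_pos: 
  assumes \<gamma>: "\<gamma> > 0"
  shows "0 < (L2_norm (g1 \<gamma>))\<^sup>2"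
proof -
  have nz: "g1 \<gamma> t \<noteq> 0" for t using sech_pos[of "pi * \<gamma> * t"] by (simp add: g1_def)
  have "(LINT t|lborel. (cmod (g1 \<gamma> t))\<^sup>2) \<noteq> 0"
  proof
    assume "(LINT t|lborel. (cmod (g1 \<gamma> t))\<^sup>2) = 0"
    then have "AE t in lborel. (cmod (g1 \<gamma> t))\<^sup>2 = 0"
      using integral_nonneg_eq_0_iff_AE[OF L2_integrable[OF g1_L2[OF \<gamma>]]] by simp
    then have "AE t in (lborel :: real measure). False" using nz by simp
    then obtain Z where "Z \<in> null_sets lborel" "(UNIV :: real set) \<subseteq> Z"
      by (auto simp: eventually_ae_filter)
    then have "emeasure lborel (UNIV :: real set) = 0" by (auto simp: null_sets_def top.extremum_unique)
    then show False by simp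
  qed
  moreover have "(LINT t|lborel. (cmod (g1 \<gamma> t))\<^sup>2) \<ge> 0" by simp
  ultimately show ?thesis unfolding L2_norm_square by linarith
qed

text \<open>Testing with the generator and keeping only its own coefficient gives N^2 <= B N for its
  squared norm N. This is the uniform positive lower bound for the upper frame bound.\<close>

lemma upper_bound_ge_norm:
  assumes \<gamma>: "\<gamma> > 0" and a: "a \<noteq> 0" and B: "is_upper_bound (g1 \<gamma>) (square_lattice a) B"
  shows "(L2_norm (g1 \<gamma>))\<^sup>2 \<le> B"
proof -
  let ?N = "(L2_norm (g1 \<gamma>))\<^sup>2"
  have "gabor_coeff \<gamma> a (g1 \<gamma>) 0 0 = (LINT t|lborel. complex_of_real ((cmod (g1 \<gamma> t))\<^sup>2))"
    unfolding gabor_coeff_def L2_inner_def tf_shift_def by (simp add: complex_norm_square del: of_real_power)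
  also have "\<dots> = of_real ?N" unfolding L2_norm_square by (rule integral_complex_of_real)
  finally have c: "gabor_coeff \<gamma> a (g1 \<gamma>) 0 0 = of_real ?N" .
  have "ennreal (?N * ?N) \<le> gabor_sum (g1 \<gamma>) (square_lattice a) (g1 \<gamma>)"
  proof -
    have "(cmod (of_real ?N))\<^sup>2 = ?N * ?N" unfolding norm_of_real power2_abs by (rule power2_eq_square)
    moreover have "coeff_energy \<gamma> a (g1 \<gamma>) {(0, 0)} = (cmod (gabor_coeff \<gamma> a (g1 \<gamma>) 0 0))\<^sup>2"
      by simp
    ultimately have eq: "coeff_energy \<gamma> a (g1 \<gamma>) {(0, 0)} = ?N * ?N"
      unfolding c by (rule trans[rotated])
    have "finite {(0::int, 0::int)}" by simp
    from gabor_sum_ge[OF a this, of \<gamma> "g1 \<gamma>"] show ?thesis unfolding eq .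
  qed
  also have "\<dots> \<le> ennreal (B * ?N)"
    using B g1_L2[OF \<gamma>] unfolding is_upper_bound_def by blast
  finally have "?N * ?N \<le> B * ?N" using B by (simp add: ennreal_le_iff is_upper_bound_def)
  then show ?thesis using g1_norm_pos[OF \<gamma>] by (rule mult_right_le_imp_le)
qed

text \<open>The generator serves as a nonzero test vector. The result bounds the admissible lower
  constants from above, so that their supremum exists.\<close>

lemma lower_bound_le_upper_bound:
  assumes \<gamma>: "\<gamma> > 0" and A: "is_lower_bound (g1 \<gamma>) \<Lambda> A" and B: "is_upper_bound (g1 \<gamma>) \<Lambda> B"
  shows "A \<le> B"
proof -
  let ?N = "(L2_norm (g1 \<gamma>))\<^sup>2"
  have "ennreal (A * ?N) \<le> gabor_sum (g1 \<gamma>) \<Lambda> (g1 \<gamma>)"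
    using A g1_L2[OF \<gamma>] unfolding is_lower_bound_def by blast
  also have "\<dots> \<le> ennreal (B * ?N)"
    using B g1_L2[OF \<gamma>] unfolding is_upper_bound_def by blast
  finally have "A * ?N \<le> B * ?N" using B by (simp add: ennreal_le_iff is_upper_bound_def)
  then show ?thesis using g1_norm_pos[OF \<gamma>] by (rule mult_right_le_imp_le)
qed

text \<open>\<open>lower_const\<close> is a square containing the block length q, and q sqrt d <= 1
  + sqrt d. With the generous bound d <= 4 this is at most 3, which turns 12 q into 36 and 1 into
  2.\<close>

lemma lower_const_le:
  fixes \<gamma> a :: real
  assumes \<gamma>: "\<gamma> > 0" and a: "1/2 < a" "a < 1"
  shows "lower_const \<gamma> a * (1 / a - a) \<le> (sech_inverse_const (pi * \<gamma>) * exp (pi * \<gamma> / 3) * (2 + 36 / (pi * \<gamma>)))\<^sup>2"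
proof -
  define d where "d = 1 / a - a"
  define P where "P = sech_inverse_const (pi * \<gamma>) * exp (pi * \<gamma> / 3)"
  let ?q = "real (block_length d)"
  have d: "0 < d" "d \<le> 4"
    using period_bounds[OF \<gamma> a] a by (simp_all add: d_def)
  have "sqrt d \<le> sqrt (2\<^sup>2)" using d by (intro real_sqrt_le_mono) simp
  then have sd: "0 < sqrt d" "sqrt d \<le> 2" using d by auto
  have "?q * sqrt d \<le> (1 / sqrt d + 1) * sqrt d"
    using block_length_bounds(2)[OF d(1)] sd by (intro mult_right_mono) auto
  also have "\<dots> \<le> 3" using sd by (simp add: distrib_right)
  finally have q: "?q * sqrt d \<le> 3" .
  have "(1 + 12 * ?q / (pi * \<gamma>)) * sqrt d = sqrt d + 12 / (pi * \<gamma>) * (?q * sqrt d)" by (simp add: distrib_right)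
  also have "\<dots> \<le> 2 + 12 / (pi * \<gamma>) * 3" using sd \<gamma> by (intro add_mono mult_left_mono q) auto
  finally have f: "(1 + 12 * ?q / (pi * \<gamma>)) * sqrt d \<le> 2 + 36 / (pi * \<gamma>)" by simp
  have "0 \<le> P" unfolding P_def using sech_inverse_const_pos[of "pi * \<gamma>"] by simp
  then have "P * ((1 + 12 * ?q / (pi * \<gamma>)) * sqrt d) \<le> P * (2 + 36 / (pi * \<gamma>))" by (rule mult_left_mono[OF f])
  then have "(P * ((1 + 12 * ?q / (pi * \<gamma>)) * sqrt d))\<^sup>2 \<le> (P * (2 + 36 / (pi * \<gamma>)))\<^sup>2"
    using \<open>0 \<le> P\<close> \<gamma> sd by (intro power_mono mult_nonneg_nonneg) auto
  moreover have "(P * ((1 + 12 * ?q / (pi * \<gamma>)) * sqrt d))\<^sup>2 = lower_const \<gamma> a * d"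
    unfolding lower_const_def P_def[symmetric] d_def[symmetric] using d by (simp add: power_mult_distrib)
  ultimately show ?thesis unfolding P_def d_def by simp
qed

theorem corollary1p3:
  fixes \<gamma> :: real
  assumes "\<gamma> > 0"
  shows "\<exists>c C :: real. 0 < c \<and> c < C \<and>
    (\<forall>a\<in>{1/2<..<1}.
       gabor_frame (g1 \<gamma>) (square_lattice a) \<and>
       c * (1 - a\<^sup>2) \<le> lower_frame_bound (g1 \<gamma>) (square_lattice a) \<and>
       lower_frame_bound (g1 \<gamma>) (square_lattice a) \<le> C * (1 - a\<^sup>2) \<and>
       c \<le> upper_frame_bound (g1 \<gamma>) (square_lattice a) \<and>
       upper_frame_bound (g1 \<gamma>) (square_lattice a) \<le> C)"
proof -
  note \<gamma> = assms
  define P where "P = (sech_inverse_const (pi * \<gamma>) * exp (pi * \<gamma> / 3) * (2 + 36 / (pi * \<gamma>)))\<^sup>2"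
  define Q where "Q = test_const (pi * \<gamma>)"
  define U where "U = 2 * upper_const \<gamma> + 1"
  define N where "N = (L2_norm (g1 \<gamma>))\<^sup>2"
  \<comment> \<open>The first entry serves the lower frame bound, via 1/(2 lower_const a) >= d/(2P);
    the second serves the upper one.\<close>
  define c where "c = min (1 / (2 * P)) N"
  \<comment> \<open>20 Q covers d <= 1/4, from 10 Q d and d <= 2 (1 - a^2). For d > 1/4 one has 1 -
    a^2 >= 1/8, and 8 U follows from A <= B1 <= U. Adding c makes c < C strict.\<close>
  define C where "C = 20 * Q + 8 * U + c"
  have "0 < 2 + 36 / (pi * \<gamma>)" using \<gamma> by (intro add_pos_pos) auto
  then have P: "P > 0" unfolding P_def using sech_inverse_const_pos[of "pi * \<gamma>"] by (intro zero_less_power mult_pos_pos) auto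
  have N: "N > 0" unfolding N_def by (rule g1_norm_pos[OF \<gamma>])
  have c: "0 < c" using P N by (simp add: c_def)
  have Q: "Q \<ge> 0" unfolding Q_def using \<gamma> by (intro test_const_nonneg) simp
  \<comment> \<open>\<open>upper_const\<close> depends on \<gamma> alone; 3/4 is an arbitrary point
    of (1/2, 1) used to discharge the assumptions on a.\<close>
  have "upper_const \<gamma> \<ge> 0" using upper_const_nonneg[OF \<gamma>, of "3/4"] by simp
  then have U: "U \<ge> 1" by (simp add: U_def)
  have main: "gabor_frame (g1 \<gamma>) (square_lattice a) \<and>
       c * (1 - a\<^sup>2) \<le> lower_frame_bound (g1 \<gamma>) (square_lattice a) \<and>
       lower_frame_bound (g1 \<gamma>) (square_lattice a) \<le> C * (1 - a\<^sup>2) \<and>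
       c \<le> upper_frame_bound (g1 \<gamma>) (square_lattice a) \<and>
       upper_frame_bound (g1 \<gamma>) (square_lattice a) \<le> C" if "a \<in> {1/2<..<1}" for a
  proof -
    from that have a: "1/2 < a" "a < 1" by auto
    define d where "d = 1 / a - a"
    have da: "1 - a\<^sup>2 = a * d" using a by (simp add: d_def right_diff_distrib power2_eq_square)
    have d0: "d > 0" using period_bounds(4)[OF \<gamma> a] by (simp add: d_def)
    \<comment> \<open>The passage between d and 1 - a^2 = a d, with constants from 1/2 < a <
      1.\<close>
    have d_le: "d \<le> 2 * (1 - a\<^sup>2)" "1 - a\<^sup>2 \<le> d"
      using mult_right_mono[of "1/2" a d] mult_right_mono[of a 1 d] a d0 unfolding da by auto
    define A1 where "A1 = 1 / (2 * lower_const \<gamma> a * a)"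
    define B1 where "B1 = 1 / a * upper_const \<gamma> + 1"
    have A1: "is_lower_bound (g1 \<gamma>) (square_lattice a) A1"
      unfolding A1_def by (rule is_lower_bound_lower_const[OF \<gamma> a])
    have B1: "is_upper_bound (g1 \<gamma>) (square_lattice a) B1"
      unfolding B1_def by (rule is_upper_bound_upper_const[OF \<gamma> a])
    have B1U: "B1 \<le> U"
      unfolding B1_def U_def using period_bounds(3)[OF \<gamma> a] upper_const_nonneg[OF \<gamma> a]
      by (intro add_right_mono mult_right_mono)
    have le: "A \<le> B1" if "is_lower_bound (g1 \<gamma>) (square_lattice a) A" for A
      by (rule lower_bound_le_upper_bound[OF \<gamma> that B1])
    have ge: "N \<le> B" if "is_upper_bound (g1 \<gamma>) (square_lattice a) B" for B
      unfolding N_def by (rule upper_bound_ge_norm[OF \<gamma> _ that]) (use a in simp)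
    define A where "A = lower_frame_bound (g1 \<gamma>) (square_lattice a)"
    define B where "B = upper_frame_bound (g1 \<gamma>) (square_lattice a)"
    have A: "is_lower_bound (g1 \<gamma>) (square_lattice a) A" and A1A: "A1 \<le> A"
      unfolding A_def using lower_frame_bound_greatest[OF A1 le] A1 by blast+
    have B: "is_upper_bound (g1 \<gamma>) (square_lattice a) B" and BB1: "B \<le> B1"
      unfolding B_def using upper_frame_bound_least[OF B1 ge N] B1 by blast+
    have "c * (1 - a\<^sup>2) \<le> A"
    proof -
      have lc: "0 < lower_const \<gamma> a" by (rule lower_const_pos[OF \<gamma> a])
      have "c * (1 - a\<^sup>2) \<le> 1 / (2 * P) * d"
        using c d_le d0 P a by (intro mult_mono) (auto simp: c_def da)
      also have "\<dots> \<le> A1"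
      proof -
        have "lower_const \<gamma> a * a * d \<le> lower_const \<gamma> a * 1 * d"
          using lc a d0 by (intro mult_right_mono mult_left_mono) auto
        also have "\<dots> \<le> P" using lower_const_le[OF \<gamma> a] by (simp add: P_def d_def)
        finally show ?thesis unfolding A1_def using lc a P by (simp add: field_simps)
      qed
      finally show ?thesis using A1A by simp
    qed
    moreover have "A \<le> C * (1 - a\<^sup>2)"
    proof (cases "d \<le> 1/4")
      case True
      then have "A \<le> 10 * Q * d"
        using lower_bound_near_critical[OF \<gamma> a _ A] by (simp add: d_def Q_def)
      also have "\<dots> \<le> 10 * Q * (2 * (1 - a\<^sup>2))" using Q by (intro mult_left_mono d_le) auto
      also have "\<dots> = 20 * Q * (1 - a\<^sup>2)" by simp
      also have "\<dots> \<le> C * (1 - a\<^sup>2)"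
        unfolding C_def using U c a d0 by (intro mult_right_mono) (auto simp: da)
      finally show ?thesis .
    next
      case False
      then have "1 \<le> 8 * (1 - a\<^sup>2)" using d_le(1) by argo
      then have "U * 1 \<le> U * (8 * (1 - a\<^sup>2))" using U by (intro mult_left_mono) auto
      also have "\<dots> = 8 * U * (1 - a\<^sup>2)" by simp
      also have "\<dots> \<le> C * (1 - a\<^sup>2)"
        unfolding C_def using Q c a d0 by (intro mult_right_mono) (auto simp: da)
      finally show ?thesis using le[OF A] B1U by linarith
    qed
    moreover have "c \<le> B" using ge[OF B] by (simp add: c_def)
    moreover have "B \<le> C" using BB1 B1U U Q c by (simp add: C_def)
    moreover have "gabor_frame (g1 \<gamma>) (square_lattice a)"
      unfolding gabor_frame_def using A1 B1 by blast
    ultimately show ?thesis unfolding A_def B_def by blast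
  qed
  have "c < C" using Q U by (simp add: C_def)
  with c main show ?thesis by blast
qed

end
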